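(* Let $\lambda=(\lambda_1,\dots,\lambda_N)\in\mathbb Z_{\ge0}^N$ with $\sum_l\lambda_l=n$ and let $I\in\mathcal I_\lambda$. There is a scalar function $N(\mathbf w)$ of $\mathbf w=(w_1,\dots,w_n)$ (depending on $I$) such that $\widetilde\xi_I=N(\mathbf w)\,\xi'_I$, and for every $J=J_{\boldsymbol\mu}\in\mathcal I_\lambda$, $\boldsymbol\mu=(\mu_1,\dots,\mu_n)$, $$Z^{\mathbf L\,(1^n)}_{\mathbf K\,\boldsymbol\mu}\big(w_{I_2\cup\cdots\cup I_N},w_{I_3\cup\cdots\cup I_N},\dots,w_{I_N};\mathbf w;\Pi^*\big)=N(\mathbf w)\,\widetilde W_J\big(\mathbf w_I,\mathbf w,\Pi^*q^{2\sum_{j=1}^n\langle\bar\epsilon_{\mu_j},h\rangle}\big),$$ where $\mathbf K=(1^{|I_2\cup\cdots\cup I_N|},2^{|I_3\cup\cdots\cup I_N|},\dots,(N-1)^{|I_N|})$ and $\mathbf L=(2^{|I_2\cup\cdots\cup I_N|},3^{|I_3\cup\cdots\cup I_N|},\dots,N^{|I_N|})$.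
   Context: Notation. $q,p\in\mathbb C^\times$ generic, $|q|,|p|<1$; $(x;p)_\infty=\prod_{n\ge0}(1-xp^n)$, $\Theta_p(z)=(z;p)_\infty(p/z;p)_\infty(p;p)_\infty$, $\theta(z)=-z^{-1/2}\Theta_p(z)$. $\mathbb F$: field of meromorphic functions of the dynamical variables $P_{\epsilon_1},\dots,P_{\epsilon_N}$; $\Pi^*_{j,k}=q^{2(P_{\epsilon_j}-P_{\epsilon_k})}$. The matrix $\widetilde R(z,\Pi^* )=\sum\widetilde R(z,\Pi^* )_{i\mu}^{j\nu}E_{ij}\otimes E_{\mu\nu}$ is $\widetilde R(z,\Pi^* )=\sum_j\theta(q^2z)E_{jj}\otimes E_{jj}+\sum_{j<k}\Big(\frac{\theta(q^2\Pi^*_{j,k})\theta(q^{-2}\Pi^*_{j,k})\theta(z)}{\theta(\Pi^*_{j,k})^2}E_{jj}\otimes E_{kk}+\theta(z)E_{kk}\otimes E_{jj}+\frac{\theta(q^2)\theta(z\Pi^*_{j,k})}{\theta(\Pi^*_{j,k})}E_{jk}\otimes E_{kj}+\frac{\theta(q^2)\theta(z/\Pi^*_{j,k})}{\theta(1/\Pi^*_{j,k})}E_{kj}\otimes E_{jk}\Big)$. Tensor product of vector representations. Let $\widehat V=\bigoplus_{\mu=1}^N\mathbb Fv_\mu$, $w_1,\dots,w_n\in\mathbb C^\times$ generic, and $\mathcal V=\widehat V_{w_1}\widetilde\otimes\cdots\widetilde\otimes\widehat V_{w_n}$, the $\mathbb F$-vector space with basis $v_{\boldsymbol\mu}=v_{\mu_1}\widetilde\otimes\cdots\widetilde\otimes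 v_{\mu_n}$, $\boldsymbol\mu\in[1,N]^n$. Write $\widetilde R^{(0n)}(z/w_n,\Pi^*q^{2\sum_{j=1}^{n-1}h^{(j)}})\cdots\widetilde R^{(02)}(z/w_2,\Pi^*q^{2h^{(1)}})\widetilde R^{(01)}(z/w_1,\Pi^* )=\sum_{k,l}E_{kl}\otimes T_{kl}(z;\Pi^* )$, where $0$ labels an auxiliary copy of $\mathbb C^N$ and $q^{2h^{(i)}}$ multiplies $\Pi^*_{j,k}$ by $q^{2(\delta_{\beta j}-\delta_{\beta k})}$ on vectors with $v_\beta$ in the $i$-th tensor factor. Write $T_{kl}(z;\Pi^* )v_{\boldsymbol\alpha}=\sum_{\boldsymbol\beta}T_{kl}(z;\Pi^* )^{\boldsymbol\alpha}_{\boldsymbol\beta}v_{\boldsymbol\beta}$. The $L$-operators act by $L^+_{kl}(z)(f(P)v_{\boldsymbol\alpha})=f(P+\epsilon_l)\,T_{kl}(z;\Pi^* )v_{\boldsymbol\alpha}$, where $f(P+\epsilon_l)$ means $P_{\epsilon_i}\mapsto P_{\epsilon_i}+\delta_{il}$ (so $\Pi^*_{i,j}\mapsto\Pi^*_{i,j}q^{2(\delta_{li}-\delta_{lj})}$). Put $\zeta=v_{(1^n)}=v_{(1,\dots,1)}$. Partition function. $Z$ is defined by $L^+_{k_ml_m}(z_m)\cdots L^+_{k_1l_1}(z_1)v_{\boldsymbol\alpha}=\sum_{\boldsymbol\beta}Z^{\mathbf L\boldsymbol\alpha}_{\mathbf K\boldsymbol\beta}(z_1,\dots,z_m;w_1,\dots,w_n;\Pi^*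 )v_{\boldsymbol\beta}$, $\mathbf K=(k_1,\dots,k_m)$, $\mathbf L=(l_1,\dots,l_m)$; explicitly $Z^{\mathbf L\boldsymbol\alpha}_{\mathbf K\boldsymbol\beta}=\sum T_{k_ml_m}(z_m;\Pi^* )^{\boldsymbol\alpha_{m-1}}_{\boldsymbol\beta}T_{k_{m-1}l_{m-1}}(z_{m-1};\Pi^*q^{2\langle\bar\epsilon_{l_m},h\rangle})^{\boldsymbol\alpha_{m-2}}_{\boldsymbol\alpha_{m-1}}\cdots T_{k_1l_1}(z_1;\Pi^*q^{2\sum_{i=2}^m\langle\bar\epsilon_{l_i},h\rangle})^{\boldsymbol\alpha}_{\boldsymbol\alpha_1}$, summed over $\boldsymbol\alpha_1,\dots,\boldsymbol\alpha_{m-1}\in[1,N]^n$. Here $\Pi^*q^{2\langle\bar\epsilon_a,h\rangle}$ means $\Pi^*_{j,k}\mapsto\Pi^*_{j,k}q^{2(\delta_{aj}-\delta_{ak})}$. It is the partition function of the 2-dimensional square lattice model with Boltzmann weights $\widetilde R$. In the argument list, $w_S$ for $S=\{s_1<\dots<s_r\}$ stands for $w_{s_1},\dots,w_{s_r}$, and $k^r$ in $\mathbf K,\mathbf L$ means $k$ repeated $r$ times. Partitions. $\mathcal I_\lambda$: ordered partitions $I=(I_1,\dots,I_N)$ of $[1,n]$ with $|I_l|=\lambda_l$. To $\boldsymbol\mu\in[1,N]^n$ corresponds $J_{\boldsymbol\mu}$ with $(J_{\boldsymbol\mu})_l=\{i:\mu_i=l\}$; $v_{J_{\boldsymbol\mu}}=v_{\boldsymbol\mu}$.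 With $L^+_{kl}(w_S)=L^+_{kl}(w_{s_r})\cdots L^+_{kl}(w_{s_1})$, $\widetilde\xi_I=L^+_{N-1,N}(w_{I_N})L^+_{N-2,N-1}(w_{I_{N-1}\cup I_N})\cdots L^+_{12}(w_{I_2\cup\cdots\cup I_N})\zeta$. Elliptic weight functions. For $J=J_{\boldsymbol\mu}\in\mathcal I_\lambda$ let $\lambda^{(l)}=\lambda_1+\cdots+\lambda_l$, $J_1\cup\cdots\cup J_l=\{i^{(l)}_1<\dots<i^{(l)}_{\lambda^{(l)}}\}$, variables $t^{(l)}_a$ $(1\le l\le N,1\le a\le\lambda^{(l)})$ with $t^{(N)}_a=w_a$. Then $\widetilde W_J(\mathbf t,\mathbf w,\Pi^* )=\mathrm{Sym}_{t^{(1)}}\cdots\mathrm{Sym}_{t^{(N-1)}}\widetilde U_J$ ($\mathrm{Sym}_{t^{(l)}}$ = sum over all permutations of $t^{(l)}_1,\dots,t^{(l)}_{\lambda^{(l)}}$), $$\widetilde U_J=\prod_{l=1}^{N-1}\prod_{a=1}^{\lambda^{(l)}}\Bigg(\frac{\theta(q^{-2C_{\mu_s,l+1}(s)}\Pi^*_{\mu_s,l+1}t^{(l+1)}_b/t^{(l)}_a)\theta(q^2)}{\theta(q^2t^{(l+1)}_b/t^{(l)}_a)\theta(q^{-2C_{\mu_s,l+1}(s)}\Pi^*_{\mu_s,l+1})}\Bigg|_{i^{(l+1)}_b=i^{(l)}_a=s}\prod_{b:\,i^{(l+1)}_b>i^{(l)}_a}\frac{\theta(t^{(l+1)}_b/t^{(l)}_a)}{\theta(q^2t^{(l+1)}_b/t^{(l)}_a)}\prod_{b=a+1}^{\lambda^{(l)}}\frac{\theta(q^{-2}t^{(l)}_a/t^{(l)}_b)}{\theta(t^{(l)}_a/t^{(l)}_b)}\Bigg),$$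 $C_{\mu_s,l+1}(s)=\sum_{j=s+1}^n(\delta_{\mu_j,\mu_s}-\delta_{\mu_j,l+1})$. The specialization $\mathbf t=\mathbf w_I$ sets $t^{(l)}_a=w_{i_a}$ where $I_1\cup\cdots\cup I_l=\{i_1<\dots<i_{\lambda^{(l)}}\}$. $\Pi^*q^{2\sum_j\langle\bar\epsilon_{\mu_j},h\rangle}$ means $\Pi^*_{k,l}\mapsto\Pi^*_{k,l}q^{2(\lambda_k-\lambda_l)}$. The vectors $\xi'_I$ are the Gelfand–Tsetlin vectors constructed in earlier work (via the permutation-group action by dynamical $R$-matrices), for which it is known that $\xi'_I=\sum_{J\in\mathcal I_\lambda}\widetilde W_J(\mathbf w_I,\mathbf w,\Pi^*q^{2\sum_j\langle\bar\epsilon_{\mu_j},h\rangle})v_J$. *)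

theory Defs
  imports "HOL-Analysis.Analysis"
begin

text \<open>
  Since \<open>\<theta>(z) = - z\<^sup>-\<^sup>1\<^sup>/\<^sup>2 \<Theta>\<^sub>p(z)\<close> is two-valued in \<open>z\<close>, every multiplicative variable is
  represented by a chosen logarithm: \<open>\<eta>\<close> stands for \<open>log q\<close>, \<open>u i\<close> for \<open>log w\<^sub>i\<close>, and
  \<open>log_Pi \<eta> P j k\<close> for the logarithm \<open>2 \<eta> (P\<^sub>j - P\<^sub>k)\<close> of \<open>\<Pi>*\<^sub>j\<^sub>,\<^sub>k\<close>.  The value of \<open>\<theta>\<close> at a
  monomial in these variables is taken at the corresponding integral linear combination of the
  logarithms; so \<open>q\<^sup>2 z\<close> becomes \<open>2 * \<eta> + z\<close>, \<open>z / w\<close> becomes \<open>z - u\<close>, and so on.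

  Tensor positions \<open>1, \<dots>, n\<close> and basis indices \<open>1, \<dots>, N\<close> start at 1.
\<close>


section \<open>Theta functions\<close>

definition qpoch_inf :: "complex \<Rightarrow> complex \<Rightarrow> complex" where
  "qpoch_inf x p = (\<Prod>n. 1 - x * p ^ n)"

definition Theta :: "complex \<Rightarrow> complex \<Rightarrow> complex" where
  "Theta p z = qpoch_inf z p * qpoch_inf (p / z) p * qpoch_inf p p"

definition theta :: "complex \<Rightarrow> complex \<Rightarrow> complex" where
  "theta p u = - exp (- u / 2) * Theta p (exp u)"


section \<open>Dynamical variables\<close>

text \<open>
  An element of the field of meromorphic functions of \<open>P\<^sub>1, \<dots>, P\<^sub>N\<close> is represented by a function
  of \<open>P\<close>.  All functions below are built from theta functions whose denominators are
  \<open>\<theta>(q\<^sup>2\<^sup>m \<Pi>*\<^sub>j\<^sub>,\<^sub>k)\<close>, so equality of two of them in the field is their equality at every point that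
  avoids the zeros of these denominators.  Those points form a comeagre set that is invariant
  under the shifts \<open>P \<mapsto> P + \<epsilon>\<^sub>l\<close>.
\<close>

type_synonym dynfun = "(nat \<Rightarrow> complex) \<Rightarrow> complex"

definition log_Pi :: "complex \<Rightarrow> (nat \<Rightarrow> complex) \<Rightarrow> nat \<Rightarrow> nat \<Rightarrow> complex" where
  "log_Pi \<eta> P j k = 2 * \<eta> * (P j - P k)"

text \<open>\<open>P \<mapsto> P + \<epsilon>\<^sub>a\<close>, which multiplies \<open>\<Pi>*\<^sub>j\<^sub>,\<^sub>k\<close> by \<open>q\<close> to the power \<open>2 (\<delta>\<^sub>a\<^sub>j - \<delta>\<^sub>a\<^sub>k)\<close>.\<close>

definition dshift :: "nat \<Rightarrow> (nat \<Rightarrow> complex) \<Rightarrow> nat \<Rightarrow> complex" where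
  "dshift a P = (\<lambda>i. P i + of_bool (i = a))"

text \<open>The composite of the shifts by the indices \<open>\<mu> j\<close> with \<open>j \<in> A\<close>.\<close>

definition dshifts :: "nat set \<Rightarrow> (nat \<Rightarrow> nat) \<Rightarrow> (nat \<Rightarrow> complex) \<Rightarrow> nat \<Rightarrow> complex" where
  "dshifts A \<mu> P = (\<lambda>i. P i + (\<Sum>j\<in>A. of_bool (i = \<mu> j)))"

definition generic_dyn :: "complex \<Rightarrow> complex \<Rightarrow> nat \<Rightarrow> (nat \<Rightarrow> complex) \<Rightarrow> bool" where
  "generic_dyn p \<eta> N P \<longleftrightarrow>
     (\<forall>j\<in>{1..N}. \<forall>k\<in>{1..N}. j \<noteq> k \<longrightarrow>
        (\<forall>a b :: int. exp (log_Pi \<eta> P j k) \<noteq> exp \<eta> powi (2 * a) * p powi b))"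

definition dyn_eq :: "complex \<Rightarrow> complex \<Rightarrow> nat \<Rightarrow> dynfun \<Rightarrow> dynfun \<Rightarrow> bool" where
  "dyn_eq p \<eta> N f g \<longleftrightarrow> (\<forall>P. generic_dyn p \<eta> N P \<longrightarrow> f P = g P)"


section \<open>The elliptic dynamical R-matrix\<close>

definition Emat :: "nat \<Rightarrow> nat \<Rightarrow> nat \<Rightarrow> nat \<Rightarrow> complex" where
  "Emat j k a b = of_bool (a = j \<and> b = k)"

text \<open>\<open>Rmat p \<eta> N z P i \<mu> j \<nu>\<close> is the coefficient of \<open>E\<^sub>i\<^sub>j \<otimes> E\<^sub>\<mu>\<^sub>\<nu>\<close>, i.e. lower indices come first.\<close>

definition Rmat :: "complex \<Rightarrow> complex \<Rightarrow> nat \<Rightarrow> complex \<Rightarrow> (nat \<Rightarrow> complex) \<Rightarrow>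
    nat \<Rightarrow> nat \<Rightarrow> nat \<Rightarrow> nat \<Rightarrow> complex" where
  "Rmat p \<eta> N z P i \<mu> i' \<mu>' =
     (\<Sum>j\<in>{1..N}. theta p (2 * \<eta> + z) * (Emat j j i i' * Emat j j \<mu> \<mu>')) +
     (\<Sum>j\<in>{1..N}. \<Sum>k\<in>{j<..N}.
        (let x = log_Pi \<eta> P j k in
           theta p (2 * \<eta> + x) * theta p (- 2 * \<eta> + x) * theta p z / (theta p x)\<^sup>2
             * (Emat j j i i' * Emat k k \<mu> \<mu>')
         + theta p z * (Emat k k i i' * Emat j j \<mu> \<mu>')
         + theta p (2 * \<eta>) * theta p (z + x) / theta p x
             * (Emat j k i i' * Emat k j \<mu> \<mu>')
         + theta p (2 * \<eta>) * theta p (z - x) / theta p (- x)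
             * (Emat k j i i' * Emat j k \<mu> \<mu>')))"


section \<open>Tensor product of vector representations\<close>

definition words :: "nat \<Rightarrow> nat \<Rightarrow> (nat \<Rightarrow> nat) set" where
  "words N n = {1..n} \<rightarrow>\<^sub>E {1..N}"

text \<open>
  The matrix element, from \<open>v\<^sub>c \<otimes> v\<^sub>\<gamma>\<close> to \<open>v\<^sub>b \<otimes> v\<^sub>\<beta>\<close> (the first factor being the auxiliary space), of
  \<open>R\<close> acting in the auxiliary space and the \<open>i\<close>-th tensor factor with spectral parameter \<open>z / w\<^sub>i\<close>
  and with the dynamical parameter shifted by the weights in the factors \<open>1, \<dots>, i - 1\<close>.
\<close>

definition R0 :: "complex \<Rightarrow> complex \<Rightarrow> nat \<Rightarrow> nat \<Rightarrow> (nat \<Rightarrow> complex) \<Rightarrow> nat \<Rightarrow> complex \<Rightarrow>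
    (nat \<Rightarrow> complex) \<Rightarrow> nat \<times> (nat \<Rightarrow> nat) \<Rightarrow> nat \<times> (nat \<Rightarrow> nat) \<Rightarrow> complex" where
  "R0 p \<eta> N n u i z P = (\<lambda>(c, \<gamma>) (b, \<beta>).
     if \<forall>j\<in>{1..n} - {i}. \<gamma> j = \<beta> j
     then Rmat p \<eta> N (z - u i) (dshifts {1..<i} \<gamma> P) b (\<beta> i) c (\<gamma> i)
     else 0)"

text \<open>The product of the first \<open>m\<close> R-matrices; the one acting in factor 1 acts first.\<close>

fun monodromy :: "complex \<Rightarrow> complex \<Rightarrow> nat \<Rightarrow> nat \<Rightarrow> (nat \<Rightarrow> complex) \<Rightarrow> nat \<Rightarrow> complex \<Rightarrow>
    (nat \<Rightarrow> complex) \<Rightarrow> nat \<times> (nat \<Rightarrow> nat) \<Rightarrow> nat \<times> (nat \<Rightarrow> nat) \<Rightarrow> complex" where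
  "monodromy p \<eta> N n u 0 z P x y = of_bool (x = y)"
| "monodromy p \<eta> N n u (Suc m) z P x y =
     (\<Sum>c\<in>{1..N} \<times> words N n. R0 p \<eta> N n u (Suc m) z P c y * monodromy p \<eta> N n u m z P x c)"

text \<open>\<open>Top \<dots> k l z P \<alpha> \<beta>\<close> is the coefficient of \<open>v\<^sub>\<beta>\<close> in \<open>T\<^sub>k\<^sub>l(z; \<Pi>*) v\<^sub>\<alpha>\<close>.\<close>

definition Top :: "complex \<Rightarrow> complex \<Rightarrow> nat \<Rightarrow> nat \<Rightarrow> (nat \<Rightarrow> complex) \<Rightarrow> nat \<Rightarrow> nat \<Rightarrow> complex \<Rightarrow>
    (nat \<Rightarrow> complex) \<Rightarrow> (nat \<Rightarrow> nat) \<Rightarrow> (nat \<Rightarrow> nat) \<Rightarrow> complex" where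
  "Top p \<eta> N n u k l z P \<alpha> \<beta> = monodromy p \<eta> N n u n z P (l, \<alpha>) (k, \<beta>)"

text \<open>A vector is given by its coordinates with respect to the \<open>v\<^sub>\<beta>\<close>, \<open>\<beta> \<in> words N n\<close>.\<close>

type_synonym vec = "(nat \<Rightarrow> nat) \<Rightarrow> dynfun"

definition vec_eq :: "complex \<Rightarrow> complex \<Rightarrow> nat \<Rightarrow> nat \<Rightarrow> vec \<Rightarrow> vec \<Rightarrow> bool" where
  "vec_eq p \<eta> N n x y \<longleftrightarrow> (\<forall>\<beta>\<in>words N n. dyn_eq p \<eta> N (x \<beta>) (y \<beta>))"

definition bvec :: "(nat \<Rightarrow> nat) \<Rightarrow> vec" where
  "bvec \<alpha> = (\<lambda>\<beta> P. of_bool (\<alpha> = \<beta>))"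

definition ones :: "nat \<Rightarrow> nat \<Rightarrow> nat" where
  "ones n = (\<lambda>i\<in>{1..n}. 1)"

definition Lop :: "complex \<Rightarrow> complex \<Rightarrow> nat \<Rightarrow> nat \<Rightarrow> (nat \<Rightarrow> complex) \<Rightarrow> nat \<Rightarrow> nat \<Rightarrow> complex \<Rightarrow>
    vec \<Rightarrow> vec" where
  "Lop p \<eta> N n u k l z x =
     (\<lambda>\<beta> P. \<Sum>\<alpha>\<in>words N n. x \<alpha> (dshift l P) * Top p \<eta> N n u k l z P \<alpha> \<beta>)"

text \<open>\<open>Z\<close> is the coefficient of \<open>v\<^sub>\<beta>\<close> in the product of L-operators applied to \<open>v\<^sub>\<alpha>\<close>; the operator with
  the first entries of the lists \<open>K\<close>, \<open>L\<close>, \<open>z\<close> acts first.\<close>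

definition Zpart :: "complex \<Rightarrow> complex \<Rightarrow> nat \<Rightarrow> nat \<Rightarrow> nat list \<Rightarrow> nat list \<Rightarrow> complex list \<Rightarrow>
    (nat \<Rightarrow> complex) \<Rightarrow> (nat \<Rightarrow> nat) \<Rightarrow> (nat \<Rightarrow> nat) \<Rightarrow> dynfun" where
  "Zpart p \<eta> N n K L z u \<alpha> \<beta> =
     fold (\<lambda>(k, l, x). Lop p \<eta> N n u k l x) (zip K (zip L z)) (bvec \<alpha>) \<beta>"


section \<open>Partitions\<close>

definition opartitions :: "nat \<Rightarrow> nat \<Rightarrow> (nat \<Rightarrow> nat) \<Rightarrow> (nat \<Rightarrow> nat set) set" where
  "opartitions N n lam =
     {I \<in> {1..N} \<rightarrow>\<^sub>E Pow {1..n}.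
        disjoint_family_on I {1..N} \<and> (\<Union>l\<in>{1..N}. I l) = {1..n} \<and>
        (\<forall>l\<in>{1..N}. card (I l) = lam l)}"

definition Jpart :: "nat \<Rightarrow> nat \<Rightarrow> (nat \<Rightarrow> nat) \<Rightarrow> nat \<Rightarrow> nat set" where
  "Jpart N n \<mu> = (\<lambda>l\<in>{1..N}. {i \<in> {1..n}. \<mu> i = l})"

definition lower :: "(nat \<Rightarrow> nat set) \<Rightarrow> nat \<Rightarrow> nat set" where
  "lower I l = (\<Union>j\<in>{1..l}. I j)"

definition upper :: "nat \<Rightarrow> (nat \<Rightarrow> nat set) \<Rightarrow> nat \<Rightarrow> nat set" where
  "upper N I l = (\<Union>j\<in>{l..N}. I j)"

text \<open>The \<open>a\<close>-th smallest element of \<open>S\<close>, for \<open>1 \<le> a \<le> card S\<close>.\<close>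

definition nth_elem :: "nat set \<Rightarrow> nat \<Rightarrow> nat" where
  "nth_elem S a = sorted_list_of_set S ! (a - 1)"

definition Lset :: "complex \<Rightarrow> complex \<Rightarrow> nat \<Rightarrow> nat \<Rightarrow> (nat \<Rightarrow> complex) \<Rightarrow> nat \<Rightarrow> nat \<Rightarrow> nat set \<Rightarrow>
    vec \<Rightarrow> vec" where
  "Lset p \<eta> N n u k l S = fold (\<lambda>s. Lop p \<eta> N n u k l (u s)) (sorted_list_of_set S)"

definition xi_tilde :: "complex \<Rightarrow> complex \<Rightarrow> nat \<Rightarrow> nat \<Rightarrow> (nat \<Rightarrow> complex) \<Rightarrow> (nat \<Rightarrow> nat set) \<Rightarrow>
    vec" where
  "xi_tilde p \<eta> N n u I =
     fold (\<lambda>k. Lset p \<eta> N n u k (k + 1) (upper N I (k + 1))) [1..<N] (bvec (ones n))"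

definition K_list :: "nat \<Rightarrow> (nat \<Rightarrow> nat set) \<Rightarrow> nat list" where
  "K_list N I = concat (map (\<lambda>k. replicate (card (upper N I (k + 1))) k) [1..<N])"

definition L_list :: "nat \<Rightarrow> (nat \<Rightarrow> nat set) \<Rightarrow> nat list" where
  "L_list N I = concat (map (\<lambda>k. replicate (card (upper N I (k + 1))) (k + 1)) [1..<N])"

definition z_list :: "nat \<Rightarrow> (nat \<Rightarrow> complex) \<Rightarrow> (nat \<Rightarrow> nat set) \<Rightarrow> complex list" where
  "z_list N u I =
     concat (map (\<lambda>k. map u (sorted_list_of_set (upper N I (k + 1)))) [1..<N])"


section \<open>Elliptic weight functions\<close>

definition Cnum :: "nat \<Rightarrow> (nat \<Rightarrow> nat) \<Rightarrow> nat \<Rightarrow> nat \<Rightarrow> complex" where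
  "Cnum n \<mu> m s = (\<Sum>j\<in>{s+1..n}. of_bool (\<mu> j = \<mu> s) - of_bool (\<mu> j = m))"

text \<open>
  The variable \<open>t l a\<close> is the logarithm of the \<open>a\<close>-th variable of level \<open>l\<close>.  The first inner product
  has exactly one factor: the index \<open>s\<close> occurs exactly once on level \<open>l + 1\<close>.
\<close>

definition Ufun :: "complex \<Rightarrow> complex \<Rightarrow> nat \<Rightarrow> nat \<Rightarrow> (nat \<Rightarrow> nat) \<Rightarrow> (nat \<Rightarrow> complex) \<Rightarrow>
    (nat \<Rightarrow> nat \<Rightarrow> complex) \<Rightarrow> complex" where
  "Ufun p \<eta> N n \<mu> P t =
     (let S = lower (Jpart N n \<mu>) in
      \<Prod>l\<in>{1..<N}. \<Prod>a\<in>{1..card (S l)}.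
        (let s = nth_elem (S l) a; x = log_Pi \<eta> P (\<mu> s) (l + 1) - 2 * \<eta> * Cnum n \<mu> (l + 1) s in
           (\<Prod>b | b \<in> {1..card (S (l + 1))} \<and> nth_elem (S (l + 1)) b = s.
              theta p (x + t (l + 1) b - t l a) * theta p (2 * \<eta>)
                / (theta p (2 * \<eta> + t (l + 1) b - t l a) * theta p x))
         * (\<Prod>b | b \<in> {1..card (S (l + 1))} \<and> nth_elem (S (l + 1)) b > s.
              theta p (t (l + 1) b - t l a) / theta p (2 * \<eta> + t (l + 1) b - t l a))
         * (\<Prod>b\<in>{a+1..card (S l)}.
              theta p (- 2 * \<eta> + t l a - t l b) / theta p (t l a - t l b))))"

definition Sym :: "nat \<Rightarrow> nat \<Rightarrow> ((nat \<Rightarrow> nat \<Rightarrow> complex) \<Rightarrow> complex) \<Rightarrow>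
    (nat \<Rightarrow> nat \<Rightarrow> complex) \<Rightarrow> complex" where
  "Sym l m F = (\<lambda>t. \<Sum>\<sigma> | \<sigma> permutes {1..m}. F (t(l := t l \<circ> \<sigma>)))"

definition Wfun :: "complex \<Rightarrow> complex \<Rightarrow> nat \<Rightarrow> nat \<Rightarrow> (nat \<Rightarrow> nat) \<Rightarrow>
    (nat \<Rightarrow> nat \<Rightarrow> complex) \<Rightarrow> (nat \<Rightarrow> complex) \<Rightarrow> dynfun" where
  "Wfun p \<eta> N n \<mu> t u P =
     foldr (\<lambda>l. Sym l (card (lower (Jpart N n \<mu>) l))) [1..<N] (Ufun p \<eta> N n \<mu> P) (t(N := u))"

text \<open>The specialization \<open>\<^bold>t = \<^bold>w\<^sub>I\<close>.\<close>

definition spec :: "(nat \<Rightarrow> complex) \<Rightarrow> (nat \<Rightarrow> nat set) \<Rightarrow> nat \<Rightarrow> nat \<Rightarrow> complex" where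
  "spec u I l a = u (nth_elem (lower I l) a)"

text \<open>
  The Gelfand--Tsetlin vector \<open>\<xi>'\<^sub>I\<close>, defined by its expansion in the standard basis.
\<close>

definition xi_prime :: "complex \<Rightarrow> complex \<Rightarrow> nat \<Rightarrow> nat \<Rightarrow> (nat \<Rightarrow> nat) \<Rightarrow> (nat \<Rightarrow> complex) \<Rightarrow>
    (nat \<Rightarrow> nat set) \<Rightarrow> vec" where
  "xi_prime p \<eta> N n lam u I = (\<lambda>\<beta> P.
     \<Sum>\<mu> | \<mu> \<in> words N n \<and> Jpart N n \<mu> \<in> opartitions N n lam.
       Wfun p \<eta> N n \<mu> (spec u I) u (dshifts {1..n} \<mu> P) * bvec \<mu> \<beta> P)"


section \<open>Genericity of the parameters\<close>

definition generic_qp :: "complex \<Rightarrow> complex \<Rightarrow> bool" where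
  "generic_qp q p \<longleftrightarrow> (\<forall>a b :: int. q powi (2 * a) = p powi b \<longrightarrow> a = 0 \<and> b = 0)"

definition generic_w :: "complex \<Rightarrow> complex \<Rightarrow> nat \<Rightarrow> (nat \<Rightarrow> complex) \<Rightarrow> bool" where
  "generic_w q p n w \<longleftrightarrow>
     (\<forall>i\<in>{1..n}. w i \<noteq> 0) \<and>
     (\<forall>i\<in>{1..n}. \<forall>j\<in>{1..n}. i \<noteq> j \<longrightarrow>
        (\<forall>a b :: int. w i / w j \<noteq> q powi (2 * a) * p powi b))"

end

theory Submission
  imports Defs "HOL-Complex_Analysis.Complex_Analysis"
begin

text \<open>
  Both sides of the identity are families of coordinates indexed by words, depending on an ordering
  of the sites \<open>w\<^sub>1, \<dots>, w\<^sub>n\<close>.  Interchanging two adjacent sites acts on either family by the same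
  \<open>2 \<times> 2\<close> dynamical R-matrix: for the products of L-operators this is the dynamical Yang--Baxter
  equation, for the weight functions it follows level by level from the three-term theta identity.
  Hence a relation \<open>\<xi> = c \<xi>'\<close> with a constant \<open>c\<close> is transported along adjacent transpositions, and it
  suffices to treat one ordering.  If the sites in \<open>I\<^sub>N\<close> come first, then those in \<open>I\<^sub>N\<^sub>-\<^sub>1\<close>, and so on,
  both families are supported on the single word \<open>N \<dots> N (N-1) \<dots> (N-1) \<dots> 1 \<dots> 1\<close>, where their
  values do not involve the dynamical variables.

  Only three properties of \<open>\<theta>\<close> enter: oddness, the three-term identity, and the location of zeros.
\<close>

subsection \<open>Theta functions: zeros and the three-term identity\<close>

text \<open>The order of the rows inside a block of L-operators is prescribed and need not match the
  order of the sites. No commutation of L-operators is used; the sites are reordered instead. For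
  each block the sites it acts on are listed in the order of its rows, so that every row meets the
  site with its own parameter, where the R-matrix degenerates to a permutation. Afterwards these
  sites all carry the same letter, on which exchanging two sites is scalar, so the original order
  can be restored.

  The exchange coefficients do depend on the dynamical variables, but they are identical on both
  sides and act linearly, so a factor free of these variables survives every exchange and every
  shift. Each exchange relation is cleared of its denominator \<theta>(q^2 y1 / y2); cancelling this
  factor is where the genericity of the site parameters enters. For weight functions the exchange on
  level l + 1 closes only together with the exchange of the variables of level l, which forces an
  induction on the level and uses unitarity of the two-by-two R-matrix.\<close>

lemma shift_int_induct:
  fixes R :: "complex \<Rightarrow> bool"
  assumes "\<And>z. R (z + w) \<longleftrightarrow> R z"
  shows "R (z + of_int k * w) \<longleftrightarrow> R z"
proof (induction k rule: int_induct[where k = 0])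
  case base
  show ?case by simp
next
  case (step1 i)
  have "z + of_int (i + 1) * w = (z + of_int i * w) + w" by (simp add: algebra_simps)
  then show ?case using assms step1 by metis
next
  case (step2 i)
  have "z + of_int i * w = (z + of_int (i - 1) * w) + w" by (simp add: algebra_simps)
  then show ?case using assms step2 by metis
qed

text \<open>At a zero of \<open>D\<close> the divided differences \<open>G\<close> and
  \<open>E\<close> are entire, and \<open>E\<close> does not vanish there because the zero is
  simple. So the singularity of the quotient is removable, with the l'Hopital value at the zero
  itself.\<close>

lemma holomorphic_quotient_simple_zeros:
  fixes g D :: "complex \<Rightarrow> complex"
  assumes g: "g holomorphic_on UNIV" and D: "D holomorphic_on UNIV"
    and zero: "\<And>z. D z = 0 \<Longrightarrow> g z = 0 \<and> deriv D z \<noteq> 0"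
  obtains h where "h holomorphic_on UNIV" "\<And>z. g z = h z * D z"
proof
  define h where "h = (\<lambda>z. if D z = 0 then deriv g z / deriv D z else g z / D z)"
  have contD: "continuous_on UNIV D" using D by (rule holomorphic_on_imp_continuous_on)
  show "g z = h z * D z" for z
    using zero by (auto simp: h_def)
  have "\<exists>d>0. h holomorphic_on ball z d" for z
  proof (cases "D z = 0")
    case False
    have "open (D -` (- {0}))" using contD by (intro open_vimage) auto
    moreover have "z \<in> D -` (- {0})" using False by simp
    ultimately obtain d where "d > 0" and d: "ball z d \<subseteq> D -` (- {0})"
      using open_contains_ball by blast
    have "(\<lambda>z. g z / D z) holomorphic_on ball z d"
      using d g D by (intro holomorphic_intros) (auto intro: holomorphic_on_subset)
    then have "h holomorphic_on ball z d"
      by (rule holomorphic_transform) (use d in \<open>auto simp: h_def\<close>)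
    with \<open>d > 0\<close> show ?thesis by blast
  next
    case True
    define G where "G = (\<lambda>w. if w = z then deriv g z else (g w - g z) / (w - z))"
    define E where "E = (\<lambda>w. if w = z then deriv D z else (D w - D z) / (w - z))"
    have G: "G holomorphic_on UNIV" unfolding G_def by (rule pole_lemma_open[OF g]) simp
    have E: "E holomorphic_on UNIV" unfolding E_def by (rule pole_lemma_open[OF D]) simp
    have "open (E -` (- {0}))"
      using holomorphic_on_imp_continuous_on[OF E] by (intro open_vimage) auto
    moreover have "z \<in> E -` (- {0})" using zero[OF True] by (simp add: E_def)
    ultimately obtain d where "d > 0" and d: "ball z d \<subseteq> E -` (- {0})"
      using open_contains_ball by blast
    have "(\<lambda>w. G w / E w) holomorphic_on ball z d"
      using d G E by (intro holomorphic_intros) (auto intro: holomorphic_on_subset)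
    moreover have "G w / E w = h w" if "w \<in> ball z d" for w
    proof (cases "w = z")
      case True
      then show ?thesis using \<open>D z = 0\<close> by (simp add: G_def E_def h_def)
    next
      case False
      have "E w \<noteq> 0" using d that by auto
      with False True have "D w \<noteq> 0" by (auto simp: E_def)
      then show ?thesis using False True zero[OF True] by (simp add: G_def E_def h_def)
    qed
    ultimately have "h holomorphic_on ball z d"
      by (rule holomorphic_transform) auto
    with \<open>d > 0\<close> show ?thesis by blast
  qed
  then have "h field_differentiable at z" for z
    using holomorphic_on_imp_differentiable_at by (metis centre_in_ball open_ball)
  then show "h holomorphic_on UNIV"
    by (simp add: holomorphic_on_def)
qed

section \<open>The infinite product and the theta function: recursion, zeros, quasi-periods\<close>

context
  fixes p :: complex
  assumes p0: "p \<noteq> 0" and p1: "norm p < 1"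
begin

lemma abs_convergent_prod_qpoch: "abs_convergent_prod (\<lambda>n. 1 - x * p ^ n)"
proof -
  have "summable (\<lambda>n. norm (x * p ^ n))"
    using p1 by (simp add: norm_mult norm_power summable_mult summable_geometric)
  then show ?thesis
    by (intro summable_imp_abs_convergent_prod) simp
qed

lemma convergent_prod_qpoch: "convergent_prod (\<lambda>n. 1 - x * p ^ n)"
  using abs_convergent_prod_qpoch by (rule abs_convergent_prod_imp_convergent_prod)

lemma qpoch_inf_rec: "qpoch_inf x p = (1 - x) * qpoch_inf (p * x) p"
proof -
  have *: "(\<lambda>n. \<Prod>k<n. 1 - x * p ^ k) \<longlonglongrightarrow> qpoch_inf x p" for x
    unfolding qpoch_inf_def LIMSEQ_lessThan_iff_atMost
    by (rule convergent_prod_LIMSEQ[OF convergent_prod_qpoch])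
  have "(\<lambda>n. \<Prod>k<Suc n. 1 - x * p ^ k) \<longlonglongrightarrow> qpoch_inf x p"
    using * by (rule LIMSEQ_Suc)
  moreover have "(\<lambda>n. \<Prod>k<Suc n. 1 - x * p ^ k) = (\<lambda>n. (1 - x) * (\<Prod>k<n. 1 - (p * x) * p ^ k))"
    by (simp only: prod.lessThan_Suc_shift) (simp add: mult_ac)
  moreover have "(\<lambda>n. (1 - x) * (\<Prod>k<n. 1 - (p * x) * p ^ k)) \<longlonglongrightarrow> (1 - x) * qpoch_inf (p * x) p"
    by (intro tendsto_intros *)
  ultimately show ?thesis
    using LIMSEQ_unique by metis
qed

lemma qpoch_inf_eq_0D:
  assumes "qpoch_inf x p = 0"
  shows "\<exists>n. x * p ^ n = 1"
proof (rule ccontr)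
  assume "\<nexists>n. x * p ^ n = 1"
  then have "1 - x * p ^ n \<noteq> 0" for n by auto
  then have "qpoch_inf x p \<noteq> 0"
    unfolding qpoch_inf_def using convergent_prod_qpoch by (intro prodinf_nonzero) auto
  then show False using assms by simp
qed

text \<open>On each closed unit disc the Weierstrass test applies with a geometric majorant, so the
  partial products converge locally uniformly.\<close>

lemma qpoch_inf_holomorphic: "(\<lambda>x. qpoch_inf x p) holomorphic_on UNIV"
proof (rule holomorphic_uniform_sequence)
  show "(\<lambda>x. \<Prod>k<n. 1 - x * p ^ k) holomorphic_on UNIV" for n
    by (intro holomorphic_intros)
  fix x :: complex
  define K where "K = cball x 1"
  have K: "norm y \<le> norm x + 1" if "y \<in> K" for y
    using that norm_triangle_ineq4[of x "x - y"] by (simp add: K_def dist_norm)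
  have uc: "uniformly_convergent_on K (\<lambda>N y. \<Prod>n<N. 1 - y * p ^ n)"
  proof (rule uniformly_convergent_on_prod')
    show "compact K" by (simp add: K_def)
    show "continuous_on K (\<lambda>y. 1 - y * p ^ n)" for n
      by (intro continuous_intros)
    show "uniformly_convergent_on K (\<lambda>N y. \<Sum>n<N. norm (1 - y * p ^ n - 1))"
    proof (rule Weierstrass_m_test'_ev)
      show "\<forall>\<^sub>F n in sequentially. \<forall>y\<in>K. norm (norm (1 - y * p ^ n - 1)) \<le> (norm x + 1) * norm p ^ n"
        using K by (intro always_eventually) (auto simp: norm_mult norm_power intro!: mult_right_mono)
      show "summable (\<lambda>n. (norm x + 1) * norm p ^ n)"
        using p1 by (intro summable_mult summable_geometric) auto
    qed
  qed
  have "uniform_limit K (\<lambda>N y. \<Prod>n<N. 1 - y * p ^ n) (\<lambda>y. qpoch_inf y p) sequentially"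
  proof -
    obtain l where l: "uniform_limit K (\<lambda>N y. \<Prod>n<N. 1 - y * p ^ n) l sequentially"
      using uc by (auto simp: uniformly_convergent_on_def)
    have "l y = qpoch_inf y p" if "y \<in> K" for y
    proof -
      have "(\<lambda>N. \<Prod>n<N. 1 - y * p ^ n) \<longlonglongrightarrow> l y" using l that by (rule tendsto_uniform_limitI)
      moreover have "(\<lambda>N. \<Prod>n<N. 1 - y * p ^ n) \<longlonglongrightarrow> qpoch_inf y p"
        unfolding qpoch_inf_def LIMSEQ_lessThan_iff_atMost
        by (rule convergent_prod_LIMSEQ[OF convergent_prod_qpoch])
      ultimately show ?thesis by (rule LIMSEQ_unique)
    qed
    with l show ?thesis by (simp cong: uniform_limit_cong')
  qed
  then show "\<exists>d>0. cball x d \<subseteq> UNIV \<and>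
      uniform_limit (cball x d) (\<lambda>n x. \<Prod>k<n. 1 - x * p ^ k) (\<lambda>x. qpoch_inf x p) sequentially"
    unfolding K_def by (intro exI[of _ 1]) auto
qed auto

lemma qpoch_inf_p_nonzero: "qpoch_inf p p \<noteq> 0"
proof
  assume "qpoch_inf p p = 0"
  then obtain n where "p * p ^ n = 1" using qpoch_inf_eq_0D by blast
  then have "norm p ^ Suc n = 1" by (metis norm_one norm_power power_Suc)
  moreover have "norm p ^ Suc n < 1" using p0 p1 by (intro power_Suc_less_one) auto
  ultimately show False by simp
qed

lemma theta_eq_0D:
  assumes "theta p u = 0"
  shows "\<exists>b::int. exp u = p powi b"
proof -
  have "qpoch_inf (exp u) p = 0 \<or> qpoch_inf (p / exp u) p = 0"
    using assms qpoch_inf_p_nonzero by (simp add: theta_def Theta_def)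
  then show ?thesis
  proof
    assume "qpoch_inf (exp u) p = 0"
    then obtain n where "exp u * p ^ n = 1" using qpoch_inf_eq_0D by blast
    then have "exp u = p powi (- int n)"
      using p0 by (simp add: power_int_minus field_simps)
    then show ?thesis ..
  next
    assume "qpoch_inf (p / exp u) p = 0"
    then obtain n where "p / exp u * p ^ n = 1" using qpoch_inf_eq_0D by blast
    then have "exp u = p ^ Suc n" by (simp add: field_simps)
    then have "exp u = p powi int (Suc n)" by (simp only: power_int_of_nat)
    then show ?thesis ..
  qed
qed

text \<open>Passing from z to p * z removes the factor 1 - z from the first product and adds the
  factor 1 - 1/z to the second.\<close>

lemma Theta_p_mult:
  assumes "z \<noteq> 0"
  shows "Theta p (p * z) = - inverse z * Theta p z"
proof -
  have "Theta p z = (1 - z) * qpoch_inf (p * z) p * qpoch_inf (p / z) p * qpoch_inf p p"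
    unfolding Theta_def using qpoch_inf_rec[of z] by simp
  moreover have "Theta p (p * z) = qpoch_inf (p * z) p * ((1 - inverse z) * qpoch_inf (p / z) p) * qpoch_inf p p"
  proof -
    have "p / (p * z) = inverse z" using p0 by (simp add: divide_inverse)
    then show ?thesis unfolding Theta_def using qpoch_inf_rec[of "inverse z"] by (simp only: divide_inverse)
  qed
  moreover have "1 - inverse z = - inverse z * (1 - z)" using assms by (simp add: algebra_simps)
  ultimately show ?thesis by (simp only: mult_ac)
qed

text \<open>\<open>Theta p\<close> is invariant under z -> p/z, so its value at 1/z is the one at p
  * z, to which \<open>Theta_p_mult\<close> applies.\<close>

lemma Theta_inverse:
  assumes "z \<noteq> 0"
  shows "Theta p (inverse z) = - inverse z * Theta p z"
proof -
  have "p / (p * z) = inverse z" using p0 by (simp add: divide_inverse)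
  then show ?thesis
    using Theta_p_mult[OF assms] by (simp add: Theta_def) (simp add: divide_inverse mult_ac)
qed

lemma theta_odd: "theta p (- u) = - theta p u"
proof -
  have "theta p (- u) = exp (u / 2) * (inverse (exp u) * Theta p (exp u))"
    using Theta_inverse[of "exp u"] by (simp add: theta_def exp_minus)
  also have "\<dots> = (exp (u / 2) * exp (- u)) * Theta p (exp u)" by (simp add: exp_minus)
  also have "exp (u / 2) * exp (- u) = exp (- u / 2)"
    unfolding mult_exp_exp by (simp add: field_simps)
  finally show ?thesis by (simp add: theta_def)
qed

lemma theta_zero: "theta p 0 = 0"
  using theta_odd[of 0] by simp

lemma theta_holomorphic: "theta p holomorphic_on UNIV"
proof -
  have *: "(\<lambda>u. qpoch_inf (g u) p) holomorphic_on UNIV" if "g holomorphic_on UNIV" for g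
    using holomorphic_on_compose[OF that holomorphic_on_subset[OF qpoch_inf_holomorphic]]
    by (simp add: o_def)
  have "(\<lambda>u. - exp (- u / 2) * (qpoch_inf (exp u) p * qpoch_inf (p / exp u) p * qpoch_inf p p))
      holomorphic_on UNIV"
    by (intro holomorphic_intros *) auto
  then show ?thesis unfolding theta_def Theta_def .
qed

lemma theta_comp_holomorphic [holomorphic_intros]:
  "g holomorphic_on UNIV \<Longrightarrow> (\<lambda>u. theta p (g u)) holomorphic_on UNIV"
  using holomorphic_on_compose[OF _ holomorphic_on_subset[OF theta_holomorphic]]
  by (simp add: o_def)

lemma theta_2pi: "theta p (u + 2 * of_real pi * \<i>) = - theta p u"
proof -
  have "- (u + 2 * of_real pi * \<i>) / 2 = - u / 2 - of_real pi * \<i>" by (simp add: field_simps)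
  then have "exp (- (u + 2 * of_real pi * \<i>) / 2) = - exp (- u / 2)"
    by (simp only: exp_diff exp_pi_i) simp
  moreover have "exp (u + 2 * of_real pi * \<i>) = exp u"
    by (simp add: exp_add)
  ultimately show ?thesis by (simp add: theta_def)
qed

lemma theta_tau:
  assumes "exp \<tau> = p"
  shows "theta p (u + \<tau>) = - exp (- u - \<tau> / 2) * theta p u"
proof -
  have "theta p (u + \<tau>) = exp (- u / 2 - \<tau> / 2) * (inverse (exp u) * Theta p (exp u))"
  proof -
    have "- (u + \<tau>) / 2 = - u / 2 - \<tau> / 2" "exp (u + \<tau>) = p * exp u"
      using assms by (simp_all add: exp_add field_simps)
    then show ?thesis using Theta_p_mult[of "exp u"] by (simp only: theta_def) simp
  qed
  also have "\<dots> = (exp (- u / 2 - \<tau> / 2) * exp (- u)) * Theta p (exp u)" by (simp add: exp_minus)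
  also have "exp (- u / 2 - \<tau> / 2) * exp (- u) = exp (- u - \<tau> / 2) * exp (- u / 2)"
    unfolding mult_exp_exp by (rule arg_cong[where f = exp]) (simp add: field_simps)
  finally show ?thesis by (simp add: theta_def)
qed

text \<open>Phrased as a translation of \<open>u\<close> to 0 by periods, the form in which
  \<open>shift_int_induct\<close> transports properties along the lattice.\<close>

lemma theta_eq_0_lattice:
  assumes "exp \<tau> = p" "theta p u = 0"
  shows "\<exists>a b::int. u + of_int a * (2 * of_real pi * \<i>) + of_int b * \<tau> = 0"
proof -
  obtain b :: int where "exp u = p powi b" using theta_eq_0D assms by blast
  also have "\<dots> = exp (of_int b * \<tau>)" using exp_power_int[of \<tau> b] assms(1) by simp
  finally obtain n :: int where "u = of_int b * \<tau> + (of_int (2 * n) * pi) * \<i>"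
    by (auto simp: exp_eq)
  then have "u + of_int (- n) * (2 * of_real pi * \<i>) + of_int (- b) * \<tau> = 0"
    by (simp add: algebra_simps)
  then show ?thesis by blast
qed

text \<open>Both quasi-periods multiply \<open>theta p\<close> by a nowhere vanishing holomorphic
  function, so by the product rule a zero of order at least two would be repeated along the whole
  lattice. It would then occur at 0, where the derivative is computed directly.\<close>

lemma deriv_theta_nonzero:
  assumes "theta p u = 0"
  shows "deriv (theta p) u \<noteq> 0"
proof
  assume d: "deriv (theta p) u = 0"
  define R where "R z \<longleftrightarrow> theta p z = 0 \<and> deriv (theta p) z = 0" for z
  obtain \<tau> where tau: "exp \<tau> = p" using p0 exp_Ln by blast
  have diff: "(theta p has_field_derivative deriv (theta p) z) (at z)" for z
    using theta_holomorphic by (simp add: holomorphic_derivI)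
  have key: "R (z + w) \<longleftrightarrow> R z"
    if m: "\<And>z. theta p (z + w) = m z * theta p z" "\<And>z. m z \<noteq> 0" "m holomorphic_on UNIV" for w m z
  proof -
    have "((\<lambda>x. theta p (x + w)) has_field_derivative deriv (theta p) (z + w)) (at z)"
      using diff[of "z + w"] by (simp add: DERIV_shift)
    moreover have "((\<lambda>x. m x * theta p x) has_field_derivative
        deriv m z * theta p z + deriv (theta p) z * m z) (at z)"
      using that(3) by (intro DERIV_mult diff) (simp add: holomorphic_derivI)
    ultimately have "deriv (theta p) (z + w) = deriv m z * theta p z + deriv (theta p) z * m z"
      unfolding m(1) by (rule DERIV_unique)
    then show ?thesis using m by (auto simp: R_def)
  qed
  have P1: "R (z + 2 * of_real pi * \<i>) \<longleftrightarrow> R z" for z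
    by (rule key[of _ "\<lambda>_. - 1"]) (auto simp: theta_2pi)
  have P2: "R (z + \<tau>) \<longleftrightarrow> R z" for z
    by (rule key[of _ "\<lambda>z. - exp (- z - \<tau> / 2)"]) (auto simp: theta_tau[OF tau] intro!: holomorphic_intros)
  obtain a b :: int where "u + of_int a * (2 * of_real pi * \<i>) + of_int b * \<tau> = 0"
    using theta_eq_0_lattice[OF tau assms] by blast
  then have "R 0 \<longleftrightarrow> R u"
    using shift_int_induct[of R, OF P2, of "u + of_int a * (2 * of_real pi * \<i>)" b]
      shift_int_induct[of R, OF P1, of u a] by simp
  then have "deriv (theta p) 0 = 0" using d assms by (simp add: R_def)
  \<comment> \<open>Splitting off the factor 1 - exp u leaves \<open>g\<close>, whose value at 0 is
    minus the cube of \<open>qpoch_inf p p\<close>.\<close>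
  define g where "g = (\<lambda>u. - exp (- u / 2) * (qpoch_inf (p * exp u) p * qpoch_inf (p / exp u) p * qpoch_inf p p))"
  have eq: "theta p = (\<lambda>u. (1 - exp u) * g u)"
    by (rule ext) (simp add: theta_def Theta_def g_def qpoch_inf_rec[of "exp u" for u])
  have *: "(\<lambda>u. qpoch_inf (g u) p) holomorphic_on UNIV" if "g holomorphic_on UNIV" for g
    using holomorphic_on_compose[OF that holomorphic_on_subset[OF qpoch_inf_holomorphic]]
    by (simp add: o_def)
  have "g holomorphic_on UNIV"
    unfolding g_def by (intro holomorphic_intros *) auto
  then have "((\<lambda>u. (1 - exp u) * g u) has_field_derivative (0 - exp 0) * g 0 + deriv g 0 * (1 - exp 0)) (at 0)"
    by (intro DERIV_mult DERIV_diff DERIV_const DERIV_exp) (simp add: holomorphic_derivI)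
  then have "(theta p has_field_derivative - g 0) (at 0)" by (simp add: eq)
  then have "g 0 = 0" using \<open>deriv (theta p) 0 = 0\<close> by (simp add: DERIV_imp_deriv)
  then show False using qpoch_inf_p_nonzero by (simp add: g_def)
qed

text \<open>At a zero, exp u is an integral power of p, so Re u is an integral multiple of ln |p|.
  This reduces avoiding zeros to avoiding countably many real numbers.\<close>

lemma theta_nonzero_Re:
  assumes "\<And>k::int. Re u \<noteq> of_int k * ln (norm p)"
  shows "theta p u \<noteq> 0"
proof
  assume "theta p u = 0"
  then obtain b :: int where "exp u = p powi b" using theta_eq_0D by blast
  then have "norm (exp u) = norm p powi b" by (simp add: norm_power_int)
  also have "norm p powi b = exp (ln (norm p)) powi b" using p0 by simp
  also have "\<dots> = exp (of_int b * ln (norm p))" by (rule exp_power_int)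
  finally have "exp (Re u) = exp (of_int b * ln (norm p))" by simp
  then show False using assms[of b] by simp
qed

text \<open>
  As functions of \<open>x\<close>, both sides have the quasi-periods of \<open>\<theta>(x + y) \<theta>(x - y)\<close>, and the left-hand
  side vanishes at the (simple) zeros of that product, so their ratio is constant by Liouville.
\<close>

lemma theta_three_term_aux:
  assumes y: "theta p (2 * y) \<noteq> 0" and zy: "theta p (z + y) \<noteq> 0" "theta p (z - y) \<noteq> 0"
  shows "theta p (x + z) * theta p (x - z) * theta p (y + w) * theta p (y - w)
       - theta p (x + w) * theta p (x - w) * theta p (y + z) * theta p (y - z)
       = theta p (z + w) * theta p (z - w) * theta p (x + y) * theta p (x - y)"
proof -
  let ?t = "theta p"
  define g where "g = (\<lambda>x. ?t (x + z) * ?t (x - z) * ?t (y + w) * ?t (y - w)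
       - ?t (x + w) * ?t (x - w) * ?t (y + z) * ?t (y - z))"
  define D where "D = (\<lambda>x. ?t (x + y) * ?t (x - y))"
  have holg: "g holomorphic_on UNIV" and holD: "D holomorphic_on UNIV"
    unfolding g_def D_def by (intro holomorphic_intros)+
  obtain \<tau> where tau: "exp \<tau> = p" using p0 exp_Ln by blast
  have "exp (Re \<tau>) = norm p" using tau by (metis norm_exp_eq_Re)
  then have "Re \<tau> < 0" using p1 by (metis exp_less_one_iff)
  have odd2: "?t (a - b) = - ?t (b - a)" for a b using theta_odd[of "b - a"] by simp
  define R where "R x \<longleftrightarrow> (D x = 0 \<longrightarrow> g x = 0 \<and> deriv D x \<noteq> 0)" for x
  define m where "m = (\<lambda>x. exp (- 2 * x - \<tau>))"
  have prodtau: "?t (x + \<tau> + a) * ?t (x + \<tau> - a) = m x * (?t (x + a) * ?t (x - a))" for x a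
  proof -
    have "?t (x + \<tau> + a) * ?t (x + \<tau> - a) = (exp (- (x + a) - \<tau> / 2) * exp (- (x - a) - \<tau> / 2)) * (?t (x + a) * ?t (x - a))"
      using theta_tau[OF tau, of "x + a"] theta_tau[OF tau, of "x - a"]
      by (simp add: algebra_simps)
    also have "exp (- (x + a) - \<tau> / 2) * exp (- (x - a) - \<tau> / 2) = m x"
      unfolding m_def mult_exp_exp by (rule arg_cong[where f = exp]) (simp add: field_simps)
    finally show ?thesis .
  qed
  have prod2pi: "?t (x + 2 * of_real pi * \<i> + a) * ?t (x + 2 * of_real pi * \<i> - a) = ?t (x + a) * ?t (x - a)" for x a
    using theta_2pi[of "x + a"] theta_2pi[of "x - a"] by (simp add: algebra_simps)
  have gtau: "g (x + \<tau>) = m x * g x" and Dtau: "D (x + \<tau>) = m x * D x" for x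
    unfolding g_def D_def prodtau by (simp_all add: right_diff_distrib mult.assoc)
  have g2pi: "g (x + 2 * of_real pi * \<i>) = g x" and D2pi: "D (x + 2 * of_real pi * \<i>) = D x" for x
    unfolding g_def D_def prod2pi by simp_all
  have derivD: "deriv D x = deriv ?t (x + y) * ?t (x - y) + deriv ?t (x - y) * ?t (x + y)" for x
  proof (rule DERIV_imp_deriv)
    have diff: "(?t has_field_derivative deriv ?t z) (at z)" for z
      using theta_holomorphic by (simp add: holomorphic_derivI)
    have "((\<lambda>x. ?t (x + y)) has_field_derivative deriv ?t (x + y)) (at x)"
      using diff[of "x + y"] by (simp add: DERIV_shift)
    moreover have "((\<lambda>x. ?t (x - y)) has_field_derivative deriv ?t (x - y)) (at x)"
      using diff[of "x - y"] DERIV_shift[of ?t _ x "- y"] by simp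
    ultimately show "(D has_field_derivative deriv ?t (x + y) * ?t (x - y) + deriv ?t (x - y) * ?t (x + y)) (at x)"
      unfolding D_def by (rule DERIV_mult)
  qed
  \<comment> \<open>Modulo the period lattice the zeros of \<open>D\<close> are y and -y. The
    hypothesis on \<open>2 * y\<close> keeps the zeros of the two factors apart, so each of them is
    a simple zero of the product.\<close>
  have zeros: "g x = 0 \<and> deriv D x \<noteq> 0" if "D x = 0" for x
  proof -
    have reduce: "g x = 0 \<longleftrightarrow> g x' = 0"
      if "x' = x + of_int a * (2 * of_real pi * \<i>) + of_int b * \<tau>" for x' and a b :: int
      using shift_int_induct[of "\<lambda>x. g x = 0" "2 * of_real pi * \<i>" x a] g2pi
        shift_int_induct[of "\<lambda>x. g x = 0" \<tau> "x + of_int a * (2 * of_real pi * \<i>)" b] gtau that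
      by (simp add: m_def)
    have reduce_t: "?t (x - c) = 0 \<longleftrightarrow> ?t (x' - c) = 0"
      if "x' = x + of_int a * (2 * of_real pi * \<i>) + of_int b * \<tau>" for x' c and a b :: int
    proof -
      have "?t ((x - c) + of_int a * (2 * of_real pi * \<i>) + of_int b * \<tau>) = 0 \<longleftrightarrow> ?t (x - c) = 0"
        using shift_int_induct[of "\<lambda>x. ?t x = 0" "2 * of_real pi * \<i>" "x - c" a] theta_2pi
          shift_int_induct[of "\<lambda>x. ?t x = 0" \<tau> "(x - c) + of_int a * (2 * of_real pi * \<i>)" b] theta_tau[OF tau]
        by simp
      moreover have "(x - c) + of_int a * (2 * of_real pi * \<i>) + of_int b * \<tau> = x' - c"
        using that by simp
      ultimately show ?thesis by simp
    qed
    from that consider "?t (x + y) = 0" | "?t (x - y) = 0" by (auto simp: D_def)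
    then show ?thesis
    proof cases
      case 1
      then obtain a b :: int where "x + y + of_int a * (2 * of_real pi * \<i>) + of_int b * \<tau> = 0"
        using theta_eq_0_lattice[OF tau] by blast
      then have x': "- y = x + of_int a * (2 * of_real pi * \<i>) + of_int b * \<tau>"
        by (intro minus_unique) (simp add: add_ac)
      have "g (- y) = 0"
        using odd2[of "-y" z] odd2[of "-y" w] theta_odd[of "y - z"] theta_odd[of "y - w"]
        by (simp add: g_def algebra_simps)
      moreover have "?t (x - y) \<noteq> 0"
        using reduce_t[OF x', of y] y theta_odd[of "2 * y"] by simp
      ultimately show ?thesis
        using reduce[OF x'] 1 deriv_theta_nonzero by (simp add: derivD)
    next
      case 2
      then obtain a b :: int where "x - y + of_int a * (2 * of_real pi * \<i>) + of_int b * \<tau> = 0"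
        using theta_eq_0_lattice[OF tau] by blast
      then have x': "y = x + of_int a * (2 * of_real pi * \<i>) + of_int b * \<tau>"
        by (simp add: algebra_simps)
      have "g y = 0" by (simp add: g_def)
      moreover have "?t (x + y) \<noteq> 0"
        using reduce_t[OF x', of "- y"] y by simp
      ultimately show ?thesis
        using reduce[OF x'] 2 deriv_theta_nonzero by (simp add: derivD)
    qed
  qed
  obtain h where holh: "h holomorphic_on UNIV" and h: "\<And>x. g x = h x * D x"
    using holomorphic_quotient_simple_zeros[OF holg holD zeros] by blast
  have Dnz: "open {x. D x \<noteq> 0}" "z \<in> {x. D x \<noteq> 0}"
  proof -
    have "open (D -` (- {0}))"
      using holomorphic_on_imp_continuous_on[OF holD] by (intro open_vimage) auto
    moreover have "D -` (- {0}) = {x. D x \<noteq> 0}" by auto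
    ultimately show "open {x. D x \<noteq> 0}" by simp
    show "z \<in> {x. D x \<noteq> 0}" using zy by (simp add: D_def)
  qed
  \<comment> \<open>Off the zeros of \<open>D\<close> periodicity follows from the equal multipliers
    of \<open>g\<close> and \<open>D\<close>; analytic continuation from this nonempty open set
    gives it everywhere.\<close>
  have periodic: "h (x + \<omega>) = h x"
    if "\<And>x. D x \<noteq> 0 \<Longrightarrow> h (x + \<omega>) = h x" for \<omega> x
  proof (rule analytic_continuation_open[where s = "{x. D x \<noteq> 0}" and s' = UNIV and f = "\<lambda>x. h (x + \<omega>)"])
    have "(h \<circ> (\<lambda>x. x + \<omega>)) holomorphic_on UNIV"
      by (intro holomorphic_on_compose holomorphic_intros holomorphic_on_subset[OF holh]) auto
    then show "(\<lambda>x. h (x + \<omega>)) holomorphic_on UNIV" by (simp add: o_def)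
  qed (use Dnz holh that in auto)
  have h2pi: "h (x + 2 * of_real pi * \<i>) = h x" for x
  proof (rule periodic)
    fix x assume "D x \<noteq> 0"
    then show "h (x + 2 * of_real pi * \<i>) = h x"
      using h[of "x + 2 * of_real pi * \<i>"] h[of x] g2pi[of x] D2pi[of x] by simp
  qed
  have htau: "h (x + \<tau>) = h x" for x
  proof (rule periodic)
    fix x assume "D x \<noteq> 0"
    have "h (x + \<tau>) * (m x * D x) = m x * (h x * D x)"
      using h[of "x + \<tau>"] h[of x] gtau[of x] Dtau[of x] by auto
    then show "h (x + \<tau>) = h x" using \<open>D x \<noteq> 0\<close> by (simp add: m_def)
  qed
  define K where "K = cbox (Complex (Re \<tau>) 0) (Complex 0 (2 * pi))"
  have "\<exists>x'\<in>K. h x' = h x" for x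
  proof -
    \<comment> \<open>Reduction to the fundamental rectangle. The real part is reduced first, by
      multiples of \<tau>, since these also change the imaginary part, whereas the periods 2 \<pi> i
      leave the real part alone.\<close>
    define b where "b = - \<lfloor>Re x / Re \<tau>\<rfloor>"
    define x1 where "x1 = x + of_int b * \<tau>"
    define a where "a = - \<lfloor>Im x1 / (2 * pi)\<rfloor>"
    define x2 where "x2 = x1 + of_int a * (2 * of_real pi * \<i>)"
    have "h x2 = h x"
      using shift_int_induct[of "\<lambda>y. h y = h x" \<tau> x b] shift_int_induct[of "\<lambda>y. h y = h x" "2 * of_real pi * \<i>" x1 a]
        h2pi htau by (simp add: x2_def x1_def)
    moreover have "x2 \<in> K"
    proof -
      define r where "r = Re x / Re \<tau>"
      have "Re x2 = frac r * Re \<tau>"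
        using \<open>Re \<tau> < 0\<close> by (simp add: x2_def x1_def b_def r_def frac_def algebra_simps)
      moreover have "0 \<le> frac r" "frac r \<le> 1" using frac_lt_1[of r] by (auto simp: frac_ge_0)
      ultimately have "Re \<tau> \<le> Re x2" "Re x2 \<le> 0"
        using \<open>Re \<tau> < 0\<close> by (auto simp: mult_nonneg_nonpos)
      moreover
      define s where "s = Im x1 / (2 * pi)"
      have "Im x2 = frac s * (2 * pi)"
        by (simp add: x2_def a_def s_def frac_def field_simps)
      moreover have "0 \<le> frac s" "frac s \<le> 1" using frac_lt_1[of s] by (auto simp: frac_ge_0)
      ultimately show ?thesis
        by (simp add: K_def in_cbox_complex_iff)
    qed
    ultimately show ?thesis by blast
  qed
  then have "range h \<subseteq> h ` K" by (simp add: image_subset_iff image_iff) metis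
  moreover have "compact (h ` K)"
    unfolding K_def using holomorphic_on_imp_continuous_on[OF holh]
    by (intro compact_continuous_image compact_cbox) (auto intro: continuous_on_subset)
  ultimately have "bounded (range h)" using compact_imp_bounded bounded_subset by blast
  then obtain c where c: "\<And>x. h x = c"
    using Liouville_theorem[OF holh] by (auto simp: constant_on_def)
  \<comment> \<open>At x = z the first term of \<open>g\<close> contains \<open>theta p 0\<close>
    and vanishes, and \<open>D z\<close> is nonzero by assumption; this determines the constant
    ratio.\<close>
  have "g z = ?t (z + w) * ?t (z - w) * D z"
    using odd2[of y z] theta_zero by (simp add: g_def D_def add.commute mult_ac)
  then have "c = ?t (z + w) * ?t (z - w)"
    using h[of z] c Dnz(2) by simp
  then show ?thesis using h[of x] c by (simp add: g_def D_def mult_ac)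
qed

text \<open>Both sides are entire in y, and the auxiliary conditions on y hold on a nonempty open
  set, so analytic continuation applies. The set contains a real number because only countably many
  reals are forbidden.\<close>

lemma theta_three_term:
  "theta p (x + z) * theta p (x - z) * theta p (y + w) * theta p (y - w)
     - theta p (x + w) * theta p (x - w) * theta p (y + z) * theta p (y - z)
   = theta p (z + w) * theta p (z - w) * theta p (x + y) * theta p (x - y)" (is "?L y = ?R y")
proof -
  define S where "S = {y. theta p (2 * y) * theta p (z + y) * theta p (z - y) \<noteq> 0}"
  define l where "l = ln (norm p)"
  have "countable (range (\<lambda>k::int. k * l / 2) \<union> range (\<lambda>k::int. k * l - Re z) \<union> range (\<lambda>k::int. Re z - k * l))"
    by (intro countable_Un countable_image) auto
  then obtain r :: real where r: "r \<notin> range (\<lambda>k::int. k * l / 2) \<union> range (\<lambda>k::int. k * l - Re z) \<union> range (\<lambda>k::int. Re z - k * l)"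
    using uncountable_UNIV_real by (metis UNIV_eq_I)
  have "of_real r \<in> S"
  proof -
    have "theta p (2 * of_real r) \<noteq> 0" using r by (intro theta_nonzero_Re) (force simp: l_def image_iff field_simps)
    moreover have "theta p (z + of_real r) \<noteq> 0" using r by (intro theta_nonzero_Re) (force simp: l_def image_iff field_simps)
    moreover have "theta p (z - of_real r) \<noteq> 0" using r by (intro theta_nonzero_Re) (force simp: l_def image_iff field_simps)
    ultimately show ?thesis by (simp add: S_def)
  qed
  moreover have "open S"
  proof -
    have "(\<lambda>y. theta p (2 * y) * theta p (z + y) * theta p (z - y)) holomorphic_on UNIV"
      by (intro holomorphic_intros)
    then have "open ((\<lambda>y. theta p (2 * y) * theta p (z + y) * theta p (z - y)) -` (- {0}))"
      by (intro open_vimage holomorphic_on_imp_continuous_on) auto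
    then show ?thesis by (simp add: S_def vimage_def Compl_eq)
  qed
  moreover have "?L holomorphic_on UNIV" "?R holomorphic_on UNIV"
    by (intro holomorphic_intros)+
  moreover have "?L y = ?R y" if "y \<in> S" for y
    using that by (intro theta_three_term_aux) (auto simp: S_def)
  ultimately show ?thesis
    using analytic_continuation_open[of S UNIV ?L ?R y] by auto
qed

end

subsection \<open>The dynamical Yang--Baxter equation\<close>

lemma dshift_commute: "dshift a (dshift b P) = dshift b (dshift a P)"
  by (auto simp: dshift_def fun_eq_iff)

text \<open>With \<open>h = 2 * \<eta>\<close>, the product \<open>h * dgap P j k\<close> is
  \<open>log_Pi \<eta> P j k\<close>. The factor stays outside so that shifts of \<open>P\<close>
  change the gap by integers.\<close>

definition dgap :: "(nat \<Rightarrow> complex) \<Rightarrow> nat \<Rightarrow> nat \<Rightarrow> complex" where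
  "dgap P j k = P j - P k"

lemma dgap_dshift: "dgap (dshift a P) j k = dgap P j k + of_bool (j = a) - of_bool (k = a)"
  by (simp add: dgap_def dshift_def)

lemma dgap_dshift_cases [simp]:
  "j \<noteq> a \<Longrightarrow> k \<noteq> a \<Longrightarrow> dgap (dshift a P) j k = dgap P j k"
  "k \<noteq> j \<Longrightarrow> dgap (dshift j P) j k = dgap P j k + 1"
  "j \<noteq> k \<Longrightarrow> dgap (dshift k P) j k = dgap P j k - 1"
  by (simp_all add: dgap_dshift)

text \<open>In the application \<open>f\<close> is \<open>theta p\<close> and \<open>h\<close> is
  the logarithm of q^2.\<close>

locale theta_like =
  fixes f :: "complex \<Rightarrow> complex" and h :: complex
  assumes odd: "f (- u) = - f u"
    and three_term: "f (x + z) * f (x - z) * f (y + w) * f (y - w)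
       - f (x + w) * f (x - w) * f (y + z) * f (y - z)
       = f (z + w) * f (z - w) * f (x + y) * f (x - y)"
    and h_nonzero: "f h \<noteq> 0"
begin

lemma f_zero [simp]: "f 0 = 0"
  using odd[of 0] by simp

text \<open>Each use prescribes the theta arguments of the two left-hand products; then x, z are the
  half-sum and half-difference of A, B, and y, w those of C, D. The identity to be proved becomes,
  after clearing denominators, a polynomial consequence of such instances.\<close>

lemma three_term_args:
  assumes "A = x + z" "B = x - z" "C = y + w" "D = y - w"
    and "E1 = x + w" "E2 = x - w" "E3 = y + z" "E4 = y - z"
    and "F1 = z + w" "F2 = z - w" "F3 = x + y" "F4 = x - y"
  shows "f A * f B * f C * f D - f E1 * f E2 * f E3 * f E4 = f F1 * f F2 * f F3 * f F4"
  unfolding assms by (rule three_term)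

text \<open>The R-matrix is written in a gauge in which one of the two mixed diagonal entries
  carries the full dynamical factor and the other carries 1.\<close>

definition gauge :: "nat \<Rightarrow> nat \<Rightarrow> (nat \<Rightarrow> complex) \<Rightarrow> complex" where
  "gauge j k P = (if j < k then f (h + h * dgap P j k) * f (h * dgap P j k - h) / (f (h * dgap P j k))\<^sup>2 else 1)"

text \<open>The entries of \<open>Rmat\<close>, with labels in the same order: outgoing auxiliary,
  outgoing site, incoming auxiliary, incoming site. Since \<open>dgap P k j = - dgap P j k\<close>,
  one formula covers both off-diagonal entries.\<close>

definition rwt :: "complex \<Rightarrow> (nat \<Rightarrow> complex) \<Rightarrow> nat \<Rightarrow> nat \<Rightarrow> nat \<Rightarrow> nat \<Rightarrow> complex" where
  "rwt z P b \<beta> c \<gamma> =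
    (if b = c \<and> \<beta> = \<gamma> then (if b = \<beta> then f (h + z) else f z * gauge b \<beta> P)
     else if b = \<gamma> \<and> \<beta> = c then f h * f (z + h * dgap P b \<beta>) / f (h * dgap P b \<beta>)
     else 0)"

text \<open>All integral shifts of the argument are included so that the condition is stable under
  the shifts of \<open>P\<close> made by the L-operators.\<close>

definition generic :: "nat \<Rightarrow> (nat \<Rightarrow> complex) \<Rightarrow> bool" where
  "generic N P \<longleftrightarrow> (\<forall>j\<in>{1..N}. \<forall>k\<in>{1..N}. j \<noteq> k \<longrightarrow> (\<forall>m::int. f (h * of_int m + h * dgap P j k) \<noteq> 0))"

lemma generic_dshift [simp]: "generic N P \<Longrightarrow> generic N (dshift a P)"
proof -
  assume *: "generic N P"
  show ?thesis
    unfolding generic_def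
  proof safe
    fix j k :: nat and m :: int
    assume jk: "j \<in> {1..N}" "k \<in> {1..N}" "j \<noteq> k" and 0: "f (h * of_int m + h * dgap (dshift a P) j k) = 0"
    have "h * of_int m + h * dgap (dshift a P) j k = h * of_int (m + of_bool (j = a) - of_bool (k = a)) + h * dgap P j k"
      by (simp add: dgap_dshift algebra_simps)
    moreover have "f (h * of_int (m + of_bool (j = a) - of_bool (k = a)) + h * dgap P j k) \<noteq> 0"
      using * jk unfolding generic_def by blast
    ultimately show False using 0 by simp
  qed
qed

lemma genericD:
  assumes "generic N P" "j \<in> {1..N}" "k \<in> {1..N}" "j \<noteq> k"
  shows "f (h * dgap P j k) \<noteq> 0" "f (h + h * dgap P j k) \<noteq> 0" "f (h * dgap P j k + h * 2) \<noteq> 0"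
proof -
  have *: "f (h * of_int m + h * dgap P j k) \<noteq> 0" for m
    using assms unfolding generic_def by blast
  show "f (h * dgap P j k) \<noteq> 0" using *[of 0] by simp
  show "f (h + h * dgap P j k) \<noteq> 0" using *[of 1] by simp
  show "f (h * dgap P j k + h * 2) \<noteq> 0" using *[of 2] by (simp add: algebra_simps)
qed

text \<open>The ice rule (weight conservation). It collapses every sum over intermediate labels to
  at most two terms and makes the dynamical shifts before and after a vertex agree.\<close>

lemma rwt_nonzeroD: "rwt z P b \<beta> c \<gamma> \<noteq> 0 \<Longrightarrow> (b = c \<and> \<beta> = \<gamma>) \<or> (b = \<gamma> \<and> \<beta> = c)"
  by (auto simp: rwt_def split: if_splits)

definition cw :: "nat \<Rightarrow> nat \<Rightarrow> (nat \<Rightarrow> complex) \<Rightarrow> complex \<Rightarrow> complex" where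
  "cw j k P z = f h * f (z + h * dgap P j k) / f (h * dgap P j k)"

lemma sum_rwt_aux:
  assumes "c \<in> {1..N}" "a \<in> {1..N}"
  shows "(\<Sum>c'\<in>{1..N}. rwt z P c' b c a * g c') =
    (if c = a then if b = a then f (h + z) * g a else 0
     else if b = a then f z * gauge c a P * g c
     else if b = c then cw a c P z * g a else 0)"
proof -
  have "(\<Sum>c'\<in>{1..N}. rwt z P c' b c a * g c') = (\<Sum>c'\<in>{c, a}. rwt z P c' b c a * g c')"
    using assms by (intro sum.mono_neutral_right) (auto simp: rwt_def)
  then show ?thesis by (auto simp: rwt_def cw_def)
qed

lemma sum_rwt_in:
  assumes "c1 \<in> {1..N}" "c2 \<in> {1..N}"
  shows "(\<Sum>a1\<in>{1..N}. \<Sum>a2\<in>{1..N}. rwt v P a2 a1 c1 c2 * F a1 a2) =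
    (if c1 = c2 then f (h + v) * F c1 c1
     else cw c2 c1 P v * F c1 c2 + f v * gauge c1 c2 P * F c2 c1)"
proof -
  have "(\<Sum>a1\<in>{1..N}. \<Sum>a2\<in>{1..N}. rwt v P a2 a1 c1 c2 * F a1 a2) =
      (\<Sum>(a1, a2)\<in>{1..N} \<times> {1..N}. rwt v P a2 a1 c1 c2 * F a1 a2)"
    by (simp add: sum.cartesian_product)
  also have "\<dots> = (\<Sum>(a1, a2)\<in>{(c1, c2), (c2, c1)}. rwt v P a2 a1 c1 c2 * F a1 a2)"
    using assms by (intro sum.mono_neutral_right) (auto dest!: rwt_nonzeroD)
  finally show ?thesis by (auto simp: rwt_def cw_def)
qed

lemma sum_rwt_out:
  assumes "b1 \<in> {1..N}" "b2 \<in> {1..N}"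
  shows "(\<Sum>a1\<in>{1..N}. \<Sum>a2\<in>{1..N}. rwt v P b2 b1 a1 a2 * F a1 a2) =
    (if b1 = b2 then f (h + v) * F b1 b1
     else cw b2 b1 P v * F b1 b2 + f v * gauge b2 b1 P * F b2 b1)"
proof -
  have "(\<Sum>a1\<in>{1..N}. \<Sum>a2\<in>{1..N}. rwt v P b2 b1 a1 a2 * F a1 a2) =
      (\<Sum>(a1, a2)\<in>{1..N} \<times> {1..N}. rwt v P b2 b1 a1 a2 * F a1 a2)"
    by (simp add: sum.cartesian_product)
  also have "\<dots> = (\<Sum>(a1, a2)\<in>{(b1, b2), (b2, b1)}. rwt v P b2 b1 a1 a2 * F a1 a2)"
    using assms by (intro sum.mono_neutral_right) (auto dest!: rwt_nonzeroD)
  finally show ?thesis by (auto simp: rwt_def cw_def)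
qed

section \<open>Three-term identities behind the entries of the Yang-Baxter equation\<close>

lemma ybe_A1:
  assumes "y = x - h" and "f x \<noteq> 0" and "f y \<noteq> 0" and "g1 * g2 = f (h + y) * f (y - h) / (f y)\<^sup>2"
  shows "f h * f (t - s + y) * (f (h + t) * (f h * f (s + y))) / (f y * f y) + f (t - s) * g1 * (f h * f (t + x) * (f s * g2)) / f x = f (h + (t - s)) * (f (h + s) * (f h * f (t + y))) / f y"
proof -
  have key: "f (h) * f (t - s + y) * f (h + t) * f (s + y) - f (h + (t - s)) * f (y) * f (h + s) * f (t + y) = f (- (y - h)) * f (- (t - s)) * f (t + x) * f (- (s))"
    by (rule three_term_args[where x = "- s / 2 + t / 2 + x / 2" and z = "h + s / 2 - t / 2 - x / 2" and y = "s / 2 + t / 2 + x / 2" and w = "h - s / 2 + t / 2 - x / 2"])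
      (simp_all add: assms field_simps)
  note key = key[unfolded odd]
  have "g1 * g2 * (f y)\<^sup>2 = f (h + y) * f (y - h)"
    using assms(2) assms(3) assms(4) by (simp add: field_simps)
  note g1 = this
  have "h + y = x" using assms by simp
  note g1 = g1[unfolded this]
  show ?thesis
    using assms(2) assms(3) key g1
    apply (simp add: divide_simps power2_eq_square)
    by algebra
qed

lemma ybe_A2:
  assumes "y = x - h" and "u = - y" and "f x \<noteq> 0" and "f y \<noteq> 0"
  shows "f h * f (t - s + y) * (f (h + t) * (f s * g)) / f y + f (t - s) * g * (f h * f (t + x) * (f h * f (s + u))) / (f x * f u) = f h * f (t - s + x) * (f (h + s) * (f t * g)) / f x"
proof -
  have key: "f (t - s + y) * f (h + t) * f (s) * f (x) - f (t) * f (t - s + x) * f (y) * f (h + s) = f (- (h)) * f (- (s + u)) * f (t + x) * f (t - s)"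
    by (rule three_term_args[where x = "- s / 2 + t + x / 2" and z = "- h - s / 2 + x / 2" and y = "s / 2 + x / 2" and w = "s / 2 - x / 2"])
      (simp_all add: assms field_simps)
  note key = key[unfolded odd]
  have odd_u: "f u = - f y" unfolding assms(2) by (rule odd)
  show ?thesis
    using assms(3) assms(4) key unfolding odd_u
    apply (simp add: divide_simps power2_eq_square)
    by algebra
qed

lemma ybe_B1:
  assumes "y = x + h" and "u = - x" and "v = - y" and "f x \<noteq> 0" and "f y \<noteq> 0"
  shows "f h * f (t - s + y) * (f h * f (t + u) * (f s * g)) / (f y * f u) + f (t - s) * g * (f (h + t) * (f h * f (s + v))) / f v = f (h + (t - s)) * (f h * f (s + u) * (f t * g)) / f u"
proof -
  have key: "f (t - s + y) * f (h) * f (t + u) * f (s) - f (h + (t - s)) * f (y) * f (t) * f (s + u) = f (t - s) * f (x) * f (h + t) * f (- (s + v))"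
    by (rule three_term_args[where x = "h - s / 2 + t / 2 + x / 2" and z = "- s / 2 + t / 2 + x / 2" and y = "s / 2 + t / 2 - x / 2" and w = "- s / 2 + t / 2 - x / 2"])
      (simp_all add: assms field_simps)
  note key = key[unfolded odd]
  have odd_u: "f u = - f x" unfolding assms(2) by (rule odd)
  have odd_v: "f v = - f y" unfolding assms(3) by (rule odd)
  show ?thesis
    using assms(4) assms(5) key unfolding odd_u odd_v
    apply (simp add: divide_simps power2_eq_square)
    by algebra
qed

lemma ybe_B3:
  assumes "y = x + h" and "u = - x" and "f x \<noteq> 0" and "f y \<noteq> 0"
  shows "f h * f (t - s + y) * (f t * g * f (h + s)) / f y = f h * f (t - s + x) * (f s * g * f (h + t)) / f x + f (t - s) * g * (f h * f (s + u) * (f h * f (t + y))) / (f u * f y)"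
proof -
  have key: "f (t - s + y) * f (t) * f (h + s) * f (x) - f (h + t) * f (t - s + x) * f (y) * f (s) = f (h) * f (- (s + u)) * f (t + y) * f (t - s)"
    by (rule three_term_args[where x = "h / 2 - s / 2 + t + x / 2" and z = "h / 2 - s / 2 + x / 2" and y = "h / 2 + s / 2 + x / 2" and w = "h / 2 + s / 2 - x / 2"])
      (simp_all add: assms field_simps)
  note key = key[unfolded odd]
  have odd_u: "f u = - f x" unfolding assms(2) by (rule odd)
  show ?thesis
    using assms(3) assms(4) key unfolding odd_u
    apply (simp add: divide_simps power2_eq_square)
    by algebra
qed

lemma ybe_C1:
  assumes "y = x + h" and "f x \<noteq> 0" and "f y \<noteq> 0" and "g1 * g2 = f (h + x) * f (x - h) / (f x)\<^sup>2"
  shows "f (h + (t - s)) * (f h * f (t + x) * f (h + s)) / f x = f h * f (t - s + x) * (f h * f (s + x) * f (h + t)) / (f x * f x) + f (t - s) * g1 * (f s * g2 * (f h * f (t + y))) / f y"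
proof -
  have key: "f (h + (t - s)) * f (t + x) * f (h + s) * f (x) - f (h + t) * f (t - s + x) * f (h) * f (s + x) = f (- (x - h)) * f (- (s)) * f (t + y) * f (t - s)"
    by (rule three_term_args[where x = "h / 2 - s / 2 + t + x / 2" and z = "h / 2 - s / 2 - x / 2" and y = "h / 2 + s / 2 + x / 2" and w = "h / 2 + s / 2 - x / 2"])
      (simp_all add: assms field_simps)
  note key = key[unfolded odd]
  have "g1 * g2 * (f x)\<^sup>2 = f (h + x) * f (x - h)"
    using assms(2) assms(3) assms(4) by (simp add: field_simps)
  note g1 = this
  have "h + x = y" using assms by simp
  note g1 = g1[unfolded this]
  show ?thesis
    using assms(2) assms(3) key g1
    apply (simp add: divide_simps power2_eq_square)
    by algebra
qed

lemma ybe_C2: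
  assumes "y = x + h" and "u = - x" and "f x \<noteq> 0" and "f y \<noteq> 0"
  shows "f (h + (t - s)) * (f t * g * (f h * f (s + y))) / f y = f h * f (t - s + u) * (f s * g * (f h * f (t + y))) / (f u * f y) + f (t - s) * g * (f h * f (s + x) * f (h + t)) / f x"
proof -
  have key: "f (h + (t - s)) * f (t) * f (s + y) * f (x) - f (h + t) * f (t - s) * f (y) * f (s + x) = f (h) * f (- (s)) * f (t + y) * f (t - s + u)"
    by (rule three_term_args[where x = "h / 2 - s / 2 + t" and z = "h / 2 - s / 2" and y = "h / 2 + s / 2 + x" and w = "h / 2 + s / 2"])
      (simp_all add: assms field_simps)
  note key = key[unfolded odd]
  have odd_u: "f u = - f x" unfolding assms(2) by (rule odd)
  show ?thesis
    using assms(3) assms(4) key unfolding odd_u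
    apply (simp add: divide_simps power2_eq_square)
    by algebra
qed

lemma ybe_D1:
  assumes "e = a - b" and "u = - e" and "f a \<noteq> 0" and "f b \<noteq> 0" and "f e \<noteq> 0"
  shows "f h * f (t - s + a) * (f t * g * (f h * f (s + b))) / (f a * f b) = f h * f (t - s + e) * (f s * g * (f h * f (t + b))) / (f e * f b) + f (t - s) * g * (f h * f (s + u) * (f h * f (t + a))) / (f u * f a)"
proof -
  have key: "f (t - s + a) * f (t) * f (s + b) * f (e) - f (t + b) * f (t - s + e) * f (a) * f (s) = f (b) * f (- (s + u)) * f (t + a) * f (t - s)"
    by (rule three_term_args[where x = "a / 2 - s / 2 + t" and z = "a / 2 - s / 2" and y = "a / 2 + s / 2" and w = "- a / 2 + b + s / 2"])
      (simp_all add: assms field_simps)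
  note key = key[unfolded odd]
  have odd_u: "f u = - f e" unfolding assms(2) by (rule odd)
  show ?thesis
    using assms(3) assms(4) assms(5) key unfolding odd_u
    apply (simp add: divide_simps power2_eq_square)
    by algebra
qed

lemma ybe_D3:
  assumes "b = a + k" and "u = - a" and "f a \<noteq> 0" and "f b \<noteq> 0" and "f k \<noteq> 0"
  shows "f h * f (t - s + a) * (f h * f (t + k) * (f s * g)) / (f a * f k) + f (t - s) * g * (f h * f (t + b) * (f h * f (s + u))) / (f b * f u) = f h * f (t - s + b) * (f h * f (s + k) * (f t * g)) / (f b * f k)"
proof -
  have key: "f (t - s + a) * f (t + k) * f (s) * f (b) - f (t) * f (t - s + b) * f (a) * f (s + k) = f (- (k)) * f (- (s + u)) * f (t + b) * f (t - s)"
    by (rule three_term_args[where x = "a / 2 + k / 2 - s / 2 + t" and z = "a / 2 - k / 2 - s / 2" and y = "a / 2 + k / 2 + s / 2" and w = "- a / 2 - k / 2 + s / 2"])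
      (simp_all add: assms field_simps)
  note key = key[unfolded odd]
  have odd_u: "f u = - f a" unfolding assms(2) by (rule odd)
  show ?thesis
    using assms(3) assms(4) assms(5) key unfolding odd_u
    apply (simp add: divide_simps power2_eq_square)
    by algebra
qed

text \<open>Two different gauge products meet here. The instance \<open>key2\<close>, with w = 0,
  expresses how they differ, and \<open>key\<close> matches this difference with the remaining
  terms.\<close>

lemma ybe_D2:
  assumes "b = a + k" and "f a \<noteq> 0" and "f b \<noteq> 0" and "f k \<noteq> 0" and "g1 * g2 = f (h + a) * f (a - h) / (f a)\<^sup>2" and "g3 * g4 = f (h + k) * f (k - h) / (f k)\<^sup>2"
  shows "f h * f (t - s + a) * (f h * f (t + k) * (f h * f (s + a))) / (f a * (f k * f a)) + f (t - s) * g1 * (f h * f (t + b) * (f s * g2)) / f b = f h * f (t - s + k) * (f h * f (s + k) * (f h * f (t + a))) / (f k * (f k * f a)) + f (t - s) * g3 * (f s * g4 * (f h * f (t + b))) / f b"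
proof -
  have key: "f (t - s + a) * f (t + k) * f (s + a) * f (k) - f (t + a) * f (t - s + k) * f (a) * f (s + k) = f (a - k) * f (- (s)) * f (t + b) * f (t - s)"
    by (rule three_term_args[where x = "a / 2 + k / 2 - s / 2 + t" and z = "a / 2 - k / 2 - s / 2" and y = "a / 2 + k / 2 + s / 2" and w = "a / 2 - k / 2 + s / 2"])
      (simp_all add: assms field_simps)
  have key2: "f (h + a) * f (a - h) * f (k) * f (k) - f (a) * f (a) * f (h + k) * f (k - h) = f (h) * f (h) * f (b) * f (a - k)"
    by (rule three_term_args[where x = "a" and z = "h" and y = "k" and w = "0"])
      (simp_all add: assms field_simps)
  note key = key[unfolded odd]
  note key2 = key2[unfolded odd]
  have "g1 * g2 * (f a)\<^sup>2 = f (h + a) * f (a - h)"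
    using assms(2) assms(3) assms(4) assms(5) by (simp add: field_simps)
  note g1 = this
  have "g3 * g4 * (f k)\<^sup>2 = f (h + k) * f (k - h)"
    using assms(2) assms(3) assms(4) assms(6) by (simp add: field_simps)
  note g3 = this
  show ?thesis
    using assms(2) assms(3) assms(4) key key2 g1 g3
    apply (simp add: divide_simps power2_eq_square)
    by algebra
qed

text \<open>By oddness the product does not see which index is smaller. Therefore the identities
  above in which both gauge factors meet are stated for arbitrary factors with this product.\<close>

lemma gauge_mult:
  assumes "j \<noteq> k"
  shows "gauge j k P * gauge k j P = f (h + h * dgap P j k) * f (h * dgap P j k - h) / (f (h * dgap P j k))\<^sup>2"
proof (cases "j < k")
  case True
  then show ?thesis by (simp add: gauge_def)
next
  case False
  have *: "dgap P k j = - dgap P j k" by (simp add: dgap_def)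
  have "f (h + h * dgap P k j) = - f (h * dgap P j k - h)" "f (h * dgap P k j - h) = - f (h + h * dgap P j k)"
    "f (h * dgap P k j) = - f (h * dgap P j k)"
    using odd[of "h * dgap P j k - h"] odd[of "h + h * dgap P j k"] odd[of "h * dgap P j k"]
    by (simp_all add: * minus_diff_commute)
  with False assms show ?thesis by (simp add: gauge_def mult.commute)
qed

lemma gauge_mult':
  "j \<noteq> k \<Longrightarrow> gauge j k P * gauge k j P = f (h + h * dgap P k j) * f (h * dgap P k j - h) / (f (h * dgap P k j))\<^sup>2"
  using gauge_mult[of k j P] by (simp add: mult.commute)

lemma gauge_dshift [simp]: "a \<noteq> j \<Longrightarrow> a \<noteq> k \<Longrightarrow> gauge j k (dshift a P) = gauge j k P"
  by (simp add: gauge_def)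

text \<open>The dynamical Yang-Baxter equation, entry by entry. Nonzero entries need the outgoing
  labels \<open>b1\<close>, \<open>b2\<close>, \<open>d\<close> to rearrange the incoming ones
  \<open>c\<close>, \<open>c1\<close>, \<open>c2\<close>. The coincidences among the incoming labels
  give the families A (\<open>c = c1\<close>), B (\<open>c = c2\<close>), C (\<open>c1 = c2\<close>)
  and D (all distinct); everything else is trivial.\<close>

lemma local_ybe:
  assumes "generic N P" "c \<in> {1..N}" "c1 \<in> {1..N}" "c2 \<in> {1..N}" "d \<in> {1..N}" "b1 \<in> {1..N}" "b2 \<in> {1..N}"
  shows "(\<Sum>a1\<in>{1..N}. \<Sum>a2\<in>{1..N}. rwt (t - s) (dshift c P) a2 a1 c1 c2 *
            (\<Sum>c'\<in>{1..N}. rwt t P c' b1 c a1 * rwt s (dshift b1 P) d b2 c' a2)) =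
         (\<Sum>e1\<in>{1..N}. \<Sum>e2\<in>{1..N}. rwt (t - s) P b2 b1 e1 e2 *
            (\<Sum>c'\<in>{1..N}. rwt s P c' e1 c c1 * rwt t (dshift e1 P) d e2 c' c2))"
proof -
  note red = sum_rwt_in[OF assms(3,4)] sum_rwt_out[OF assms(6,7)]
  note red2 = sum_rwt_aux[OF assms(2,3)] sum_rwt_aux[OF assms(2,4)]
  have neg: "dgap P j k = - dgap P k j" for j k by (simp add: dgap_def)
  have nz: "f (h * (dgap P j k + of_int m)) \<noteq> 0" if "j \<noteq> k" "j \<in> {1..N}" "k \<in> {1..N}" for j k m
  proof -
    have "h * (dgap P j k + of_int m) = h * of_int m + h * dgap P j k" by (simp add: algebra_simps)
    then show ?thesis using assms(1) that unfolding generic_def by metis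
  qed
  have nz': "f (h * dgap P j k) \<noteq> 0" "f (h * (dgap P j k + 1)) \<noteq> 0" "f (h * (dgap P j k - 1)) \<noteq> 0"
    if "j \<noteq> k" "j \<in> {1..N}" "k \<in> {1..N}" for j k
    using nz[OF that, of 0] nz[OF that, of 1] nz[OF that, of "- 1"] by simp_all
  note fin = assms(2-)
  have shift: "gauge c1 c2 (dshift c1 P) * gauge c2 c1 (dshift c1 P) =
      f (h + h * (dgap P c2 c1 - 1)) * f (h * (dgap P c2 c1 - 1) - h) / (f (h * (dgap P c2 c1 - 1)))\<^sup>2"
    if "c1 \<noteq> c2" for c1 c2
    using gauge_mult[of c2 c1 "dshift c1 P"] that by (simp add: mult.commute)
  have shift': "gauge c1 c2 (dshift c2 P) * gauge c2 c1 (dshift c2 P) =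
      f (h + h * (dgap P c2 c1 + 1)) * f (h * (dgap P c2 c1 + 1) - h) / (f (h * (dgap P c2 c1 + 1)))\<^sup>2"
    if "c1 \<noteq> c2" for c1 c2
    using gauge_mult[of c2 c1 "dshift c2 P"] that by (simp add: mult.commute)
  consider "c = c1" "c1 = c2" | "c = c1" "c \<noteq> c2" | "c = c2" "c \<noteq> c1" | "c1 = c2" "c \<noteq> c1" | "c \<noteq> c1" "c \<noteq> c2" "c1 \<noteq> c2"
    by blast
  then show ?thesis
  proof cases
    case 1
    then show ?thesis unfolding red unfolding red2
      by (cases "b1 = c2"; cases "b2 = c2"; cases "d = c2"; simp add: rwt_def)
  next
    case 2
    show ?thesis unfolding red unfolding red2
      apply (cases "b1 = c"; cases "b1 = c2"; cases "b2 = c"; cases "b2 = c2"; cases "d = c"; cases "d = c2")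
      using 2 apply (simp_all add: rwt_def cw_def)
      subgoal using fin by (intro ybe_A1 shift nz') (simp_all add: nz' algebra_simps)
      subgoal using fin by (intro ybe_A2 nz') (simp_all add: nz' neg[of c1 c2] algebra_simps)
      done
  next
    case 3
    show ?thesis unfolding red unfolding red2
      apply (cases "b1 = c"; cases "b1 = c1"; cases "b2 = c"; cases "b2 = c1"; cases "d = c"; cases "d = c1")
      using 3 apply (simp_all add: rwt_def cw_def)
      subgoal using fin by (intro ybe_B1[where x = "h * dgap P c2 c1"] nz') (simp_all add: nz' neg[of c1 c2] algebra_simps)
      subgoal premises prems
      proof -
        \<comment> \<open>This entry with two letters is a degenerate case of \<open>ybe_D2\<close>:
          the two dynamical arguments add up to \<open>h\<close>, so \<open>h_nonzero\<close>
          supplies the missing nonvanishing condition.\<close>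
        define A B where "A = h * (dgap P c2 c1 + 1)" and "B = h * dgap P c1 c2"
        have AB: "A + B = h" by (simp add: A_def B_def neg[of c1 c2] algebra_simps)
        have nzAB: "f A \<noteq> 0" "f B \<noteq> 0" using fin prems nz' by (auto simp: A_def B_def)
        show ?thesis
          using ybe_D2[OF AB[symmetric] nzAB(1) h_nonzero nzAB(2) shift'[of c1 c2, folded A_def] gauge_mult[of c1 c2 P, folded B_def], of t s] prems h_nonzero
          unfolding A_def[symmetric] B_def[symmetric]
          by (simp add: mult_ac add.commute)
      qed
      subgoal using fin by (intro ybe_B3 nz') (simp_all add: nz' neg[of c1 c2] algebra_simps)
      done
  next
    case 4
    show ?thesis unfolding red unfolding red2
      apply (cases "b1 = c"; cases "b1 = c2"; cases "b2 = c"; cases "b2 = c2"; cases "d = c"; cases "d = c2")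
      using 4 apply (simp_all add: rwt_def cw_def)
      subgoal using fin by (intro ybe_C1 nz' gauge_mult) (simp_all add: nz' algebra_simps)
      subgoal using fin by (intro ybe_C2 nz') (simp_all add: nz' neg[of c c2] algebra_simps)
      done
  next
    case 5
    consider "b1 = c" | "b1 = c1" | "b1 = c2" | "b1 \<noteq> c" "b1 \<noteq> c1" "b1 \<noteq> c2" by blast
    then show ?thesis
    proof cases
      case b1: 1
      show ?thesis unfolding red unfolding red2
        apply (cases "b2 = c1"; cases "b2 = c2"; cases "d = c1"; cases "d = c2")
        using 5 b1 apply (simp_all add: rwt_def cw_def)
        subgoal using fin by (intro ybe_D2 nz' gauge_mult'[of c1 c2] gauge_mult[of c1 c]) (simp_all add: dgap_def algebra_simps)
        subgoal using fin by (intro ybe_D3 nz') (simp_all add: nz' dgap_def algebra_simps)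
        done
    next
      case b1: 2
      show ?thesis unfolding red unfolding red2
        apply (cases "b2 = c"; cases "b2 = c2"; cases "d = c"; cases "d = c2")
        using 5 b1 apply (simp_all add: rwt_def cw_def)
        subgoal using fin by (intro ybe_D1 nz') (simp_all add: nz' dgap_def algebra_simps)
        done
    next
      case b1: 3
      show ?thesis unfolding red unfolding red2
        apply (cases "b2 = c"; cases "b2 = c1"; cases "d = c"; cases "d = c1")
        using 5 b1 by (simp_all add: rwt_def cw_def)
    next
      case 4
      with 5 show ?thesis unfolding red unfolding red2 by (simp add: rwt_def)
    qed
  qed
qed

end

subsection \<open>Exchange relation for products of L-operators\<close>

text \<open>Words as lists, so that two adjacent sites are singled out by the pattern
  \<open>A @ a # b # B\<close>.\<close>

definition lwords :: "nat \<Rightarrow> nat \<Rightarrow> nat list set" where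
  "lwords N n = {\<alpha>. length \<alpha> = n \<and> set \<alpha> \<subseteq> {1..N}}"

lemma finite_lwords [simp]: "finite (lwords N n)"
  using finite_lists_length_eq[of "{1..N}" n] by (simp add: lwords_def conj_commute)

lemma sum_lwords_split2:
  "(\<Sum>\<alpha>\<in>lwords N (i + 2 + m). g \<alpha>) =
     (\<Sum>A\<in>lwords N i. \<Sum>B\<in>lwords N m. \<Sum>a\<in>{1..N}. \<Sum>b\<in>{1..N}. g (A @ a # b # B))"
proof -
  have "(\<Sum>\<alpha>\<in>lwords N (i + 2 + m). g \<alpha>) =
      (\<Sum>(A, B, a, b)\<in>lwords N i \<times> lwords N m \<times> {1..N} \<times> {1..N}. g (A @ a # b # B))"
  proof (rule sum.reindex_bij_witness[of _
        "\<lambda>(A, B, a, b). A @ a # b # B" "\<lambda>\<alpha>. (take i \<alpha>, drop (i + 2) \<alpha>, \<alpha> ! i, \<alpha> ! (i + 1))"], goal_cases)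
    case (1 \<alpha>)
    then have "i < length \<alpha>" "Suc i < length \<alpha>" by (auto simp: lwords_def)
    then show ?case by (simp add: Cons_nth_drop_Suc)
  next
    case (2 \<alpha>)
    then have "set \<alpha> \<subseteq> {1..N}" "i < length \<alpha>" "Suc i < length \<alpha>" by (auto simp: lwords_def)
    then have "\<alpha> ! i \<in> {1..N}" "\<alpha> ! Suc i \<in> {1..N}" using nth_mem by blast+
    with 2 show ?case by (auto simp: lwords_def dest!: in_set_takeD in_set_dropD)
  next
    case (5 \<alpha>)
    then have "i < length \<alpha>" "Suc i < length \<alpha>" by (auto simp: lwords_def)
    then show ?case by (simp add: Cons_nth_drop_Suc)
  qed (auto simp: lwords_def nth_append)
  then show ?thesis by (simp add: sum.cartesian_product)
qed

lemma sum_pull1: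
  fixes r :: "_ \<Rightarrow> 'a :: comm_semiring_0"
  shows "(\<Sum>a\<in>A. k a * (\<Sum>c\<in>C. t a c * r c)) = (\<Sum>c\<in>C. r c * (\<Sum>a\<in>A. k a * t a c))"
  by (simp add: sum_distrib_left sum.swap[of _ A C] mult_ac)

lemma sum_pull2:
  fixes r :: "_ \<Rightarrow> 'a :: comm_semiring_0"
  shows "(\<Sum>a\<in>A. \<Sum>b\<in>B. k a b * (\<Sum>c\<in>C. r c * t a b c)) =
    (\<Sum>c\<in>C. r c * (\<Sum>a\<in>A. \<Sum>b\<in>B. k a b * t a b c))"
  by (simp add: sum_distrib_left sum.swap[of _ A C] sum.swap[of _ B C] mult_ac)

lemma sum_pull4:
  fixes x :: "_ \<Rightarrow> _ \<Rightarrow> 'a :: comm_semiring_0"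
  shows "(\<Sum>a\<in>A. \<Sum>b\<in>B. (\<Sum>c\<in>C. \<Sum>d\<in>D. r a b c d * x c d) * t a b) =
    (\<Sum>c\<in>C. \<Sum>d\<in>D. x c d * (\<Sum>a\<in>A. \<Sum>b\<in>B. r a b c d * t a b))"
  by (simp add: sum_distrib_left sum_distrib_right sum.swap[of _ A C] sum.swap[of _ B C]
      sum.swap[of _ A D] sum.swap[of _ B D] mult_ac)

lemma sum_pull6:
  fixes r :: "_ \<Rightarrow> _ \<Rightarrow> 'a :: comm_semiring_0"
  shows "(\<Sum>v\<in>V. \<Sum>u\<in>U. \<Sum>a\<in>A. \<Sum>b\<in>B. x v u a b * (\<Sum>c\<in>C. \<Sum>d\<in>D. r c d * t v u a b c d)) =
    (\<Sum>c\<in>C. \<Sum>d\<in>D. r c d * (\<Sum>v\<in>V. \<Sum>u\<in>U. \<Sum>a\<in>A. \<Sum>b\<in>B. x v u a b * t v u a b c d))"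
  by (simp add: sum_distrib_left sum.swap[of _ A C] sum.swap[of _ B C] sum.swap[of _ V C] sum.swap[of _ U C]
      sum.swap[of _ A D] sum.swap[of _ B D] sum.swap[of _ V D] sum.swap[of _ U D] mult_ac)

context theta_like
begin

lemma generic_fold_dshift [simp]: "generic N P \<Longrightarrow> generic N (fold dshift A P)"
  by (induction A arbitrary: P) simp_all

text \<open>One row of the lattice: \<alpha> below, \<beta> above, auxiliary label \<open>c\<close>
  entering at the first site and \<open>d\<close> leaving at the last. The parameter is shifted by
  the letters of \<beta>, because an R-matrix acts after those of the preceding sites and sees their
  outgoing letters.\<close>

primrec tmat :: "nat \<Rightarrow> complex \<Rightarrow> complex list \<Rightarrow> (nat \<Rightarrow> complex) \<Rightarrow> nat list \<Rightarrow> nat list \<Rightarrow>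
    nat \<Rightarrow> nat \<Rightarrow> complex" where
  "tmat N z [] P \<alpha> \<beta> c d = of_bool (c = d)"
| "tmat N z (y # ys) P \<alpha> \<beta> c d =
     (\<Sum>c'\<in>{1..N}. rwt (z - y) P c' (hd \<beta>) c (hd \<alpha>) * tmat N z ys (dshift (hd \<beta>) P) (tl \<alpha>) (tl \<beta>) c' d)"

lemma rwt_dshift:
  assumes "rwt z P b \<beta> c \<gamma> \<noteq> 0"
  shows "dshift c (dshift \<gamma> Q) = dshift b (dshift \<beta> Q)"
  using rwt_nonzeroD[OF assms] by (auto simp: dshift_commute)

text \<open>An R-matrix exchanging two adjacent sites is pulled through the row. At the pair itself
  this is \<open>local_ybe\<close>; the sites in front of the pair only change the dynamical
  parameter, and by weight conservation they change it consistently on both sides.\<close>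

lemma tmat_exchange:
  assumes "generic N P" "c \<in> {1..N}" "c1 \<in> {1..N}" "c2 \<in> {1..N}" "b1 \<in> {1..N}" "b2 \<in> {1..N}"
    and "length A = length Y" "length B = length Y"
  shows "(\<Sum>a1\<in>{1..N}. \<Sum>a2\<in>{1..N}. rwt (y1 - y2) (fold dshift A (dshift c P)) a2 a1 c1 c2 *
            tmat N z (Y @ y2 # y1 # ys) P (A @ a1 # a2 # \<alpha>) (B @ b1 # b2 # \<beta>) c d) =
         (\<Sum>e1\<in>{1..N}. \<Sum>e2\<in>{1..N}. rwt (y1 - y2) (fold dshift B P) b2 b1 e1 e2 *
            tmat N z (Y @ y1 # y2 # ys) P (A @ c1 # c2 # \<alpha>) (B @ e1 # e2 # \<beta>) c d)"
  using assms
proof (induction Y arbitrary: A B P c)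
  case Nil
  \<comment> \<open>The sites behind the pair see its outgoing letters only through the commuting
    shifts, which are the same for both orders of the letters.\<close>
  define tail where "tail = (\<lambda>c''. tmat N z ys (dshift b2 (dshift b1 P)) \<alpha> \<beta> c'' d)"
  have "(\<Sum>a1\<in>{1..N}. \<Sum>a2\<in>{1..N}. rwt (y1 - y2) (dshift c P) a2 a1 c1 c2 *
          (\<Sum>c'\<in>{1..N}. rwt (z - y2) P c' b1 c a1 *
             (\<Sum>c''\<in>{1..N}. rwt (z - y1) (dshift b1 P) c'' b2 c' a2 * tail c''))) =
      (\<Sum>c''\<in>{1..N}. tail c'' * (\<Sum>a1\<in>{1..N}. \<Sum>a2\<in>{1..N}. rwt ((z - y2) - (z - y1)) (dshift c P) a2 a1 c1 c2 *
          (\<Sum>c'\<in>{1..N}. rwt (z - y2) P c' b1 c a1 * rwt (z - y1) (dshift b1 P) c'' b2 c' a2)))"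
    (is "?L = _")
    by (simp add: sum_pull1 sum_pull2 del: One_nat_def)
  also have "\<dots> = (\<Sum>c''\<in>{1..N}. tail c'' * (\<Sum>e1\<in>{1..N}. \<Sum>e2\<in>{1..N}. rwt ((z - y2) - (z - y1)) P b2 b1 e1 e2 *
          (\<Sum>c'\<in>{1..N}. rwt (z - y1) P c' e1 c c1 * rwt (z - y2) (dshift e1 P) c'' e2 c' c2)))"
    using Nil.prems by (intro sum.cong refl arg_cong2[where f = "(*)"] local_ybe) auto
  also have "\<dots> = (\<Sum>e1\<in>{1..N}. \<Sum>e2\<in>{1..N}. rwt (y1 - y2) P b2 b1 e1 e2 *
          (\<Sum>c'\<in>{1..N}. rwt (z - y1) P c' e1 c c1 *
             (\<Sum>c''\<in>{1..N}. rwt (z - y2) (dshift e1 P) c'' e2 c' c2 * tail c'')))"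
    by (simp add: sum_pull1 sum_pull2 del: One_nat_def)
  also have "\<dots> = (\<Sum>e1\<in>{1..N}. \<Sum>e2\<in>{1..N}. rwt (y1 - y2) P b2 b1 e1 e2 *
          (\<Sum>c'\<in>{1..N}. rwt (z - y1) P c' e1 c c1 *
             (\<Sum>c''\<in>{1..N}. rwt (z - y2) (dshift e1 P) c'' e2 c' c2 *
                tmat N z ys (dshift e2 (dshift e1 P)) \<alpha> \<beta> c'' d)))"
  proof (intro sum.cong refl)
    fix e1 e2
    show "rwt (y1 - y2) P b2 b1 e1 e2 * (\<Sum>c'\<in>{1..N}. rwt (z - y1) P c' e1 c c1 *
             (\<Sum>c''\<in>{1..N}. rwt (z - y2) (dshift e1 P) c'' e2 c' c2 * tail c'')) =
        rwt (y1 - y2) P b2 b1 e1 e2 * (\<Sum>c'\<in>{1..N}. rwt (z - y1) P c' e1 c c1 *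
             (\<Sum>c''\<in>{1..N}. rwt (z - y2) (dshift e1 P) c'' e2 c' c2 *
                tmat N z ys (dshift e2 (dshift e1 P)) \<alpha> \<beta> c'' d))"
      using rwt_dshift[of "y1 - y2" P b2 b1 e1 e2 P]
      by (cases "rwt (y1 - y2) P b2 b1 e1 e2 = 0") (simp_all add: tail_def dshift_commute)
  qed
  finally show ?case using Nil.prems by (simp add: tail_def)
next
  case (Cons y Y)
  obtain a A' b B' where A: "A = a # A'" and B: "B = b # B'"
    using Cons.prems by (metis length_Suc_conv)
  \<comment> \<open>A nonzero weight at the first site gives equal shifts by c, a and by c', b, so
    the parameter of the R-matrix is the one required by the induction hypothesis with c'
    entering.\<close>
  have IH: "(\<Sum>a1\<in>{1..N}. \<Sum>a2\<in>{1..N}. rwt (y1 - y2) (fold dshift A' (dshift a (dshift c P))) a2 a1 c1 c2 *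
            tmat N z (Y @ y2 # y1 # ys) (dshift b P) (A' @ a1 # a2 # \<alpha>) (B' @ b1 # b2 # \<beta>) c' d) =
         (\<Sum>e1\<in>{1..N}. \<Sum>e2\<in>{1..N}. rwt (y1 - y2) (fold dshift B' (dshift b P)) b2 b1 e1 e2 *
            tmat N z (Y @ y1 # y2 # ys) (dshift b P) (A' @ c1 # c2 # \<alpha>) (B' @ e1 # e2 # \<beta>) c' d)"
    if "c' \<in> {1..N}" "rwt (z - y) P c' b c a \<noteq> 0" for c'
    using Cons.IH[of "dshift b P" c' A' B'] that Cons.prems A B rwt_dshift[OF that(2), of P]
    by (simp add: dshift_commute)
  have "(\<Sum>a1\<in>{1..N}. \<Sum>a2\<in>{1..N}. rwt (y1 - y2) (fold dshift A (dshift c P)) a2 a1 c1 c2 *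
            tmat N z ((y # Y) @ y2 # y1 # ys) P (A @ a1 # a2 # \<alpha>) (B @ b1 # b2 # \<beta>) c d) =
      (\<Sum>c'\<in>{1..N}. rwt (z - y) P c' b c a *
        (\<Sum>a1\<in>{1..N}. \<Sum>a2\<in>{1..N}. rwt (y1 - y2) (fold dshift A' (dshift a (dshift c P))) a2 a1 c1 c2 *
            tmat N z (Y @ y2 # y1 # ys) (dshift b P) (A' @ a1 # a2 # \<alpha>) (B' @ b1 # b2 # \<beta>) c' d))"
    by (simp add: A B sum_pull2 del: One_nat_def)
  also have "\<dots> = (\<Sum>c'\<in>{1..N}. rwt (z - y) P c' b c a *
        (\<Sum>e1\<in>{1..N}. \<Sum>e2\<in>{1..N}. rwt (y1 - y2) (fold dshift B' (dshift b P)) b2 b1 e1 e2 *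
            tmat N z (Y @ y1 # y2 # ys) (dshift b P) (A' @ c1 # c2 # \<alpha>) (B' @ e1 # e2 # \<beta>) c' d))"
  proof (intro sum.cong refl)
    fix c' assume "c' \<in> {1..N}"
    then show "rwt (z - y) P c' b c a * (\<Sum>a1\<in>{1..N}. \<Sum>a2\<in>{1..N}.
          rwt (y1 - y2) (fold dshift A' (dshift a (dshift c P))) a2 a1 c1 c2 *
            tmat N z (Y @ y2 # y1 # ys) (dshift b P) (A' @ a1 # a2 # \<alpha>) (B' @ b1 # b2 # \<beta>) c' d) =
        rwt (z - y) P c' b c a * (\<Sum>e1\<in>{1..N}. \<Sum>e2\<in>{1..N}. rwt (y1 - y2) (fold dshift B' (dshift b P)) b2 b1 e1 e2 *
            tmat N z (Y @ y1 # y2 # ys) (dshift b P) (A' @ c1 # c2 # \<alpha>) (B' @ e1 # e2 # \<beta>) c' d)"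
      using IH[of c'] by (cases "rwt (z - y) P c' b c a = 0") simp_all
  qed
  also have "\<dots> = (\<Sum>e1\<in>{1..N}. \<Sum>e2\<in>{1..N}. rwt (y1 - y2) (fold dshift B P) b2 b1 e1 e2 *
            tmat N z ((y # Y) @ y1 # y2 # ys) P (A @ c1 # c2 # \<alpha>) (B @ e1 # e2 # \<beta>) c d)"
    by (simp add: A B sum_pull2 del: One_nat_def)
  finally show ?case .
qed

definition lop :: "nat \<Rightarrow> complex list \<Rightarrow> nat \<Rightarrow> nat \<Rightarrow> complex \<Rightarrow>
    (nat list \<Rightarrow> (nat \<Rightarrow> complex) \<Rightarrow> complex) \<Rightarrow> nat list \<Rightarrow> (nat \<Rightarrow> complex) \<Rightarrow> complex" where
  "lop N ys k l z X = (\<lambda>\<beta> P. \<Sum>\<alpha>\<in>lwords N (length ys). X \<alpha> (dshift l P) * tmat N z ys P \<alpha> \<beta> l k)"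

text \<open>\<open>X\<close> belongs to the site order y1, y2 and \<open>X'\<close> to y2, y1, with
  v = y1 - y2. The reversed labels \<open>b2 b1\<close> contain the flip of the two factors, and the
  prefactor clears the denominator of the normalised R-matrix.\<close>

definition exchanged :: "nat \<Rightarrow> nat \<Rightarrow> nat \<Rightarrow> complex \<Rightarrow> (nat list \<Rightarrow> (nat \<Rightarrow> complex) \<Rightarrow> complex) \<Rightarrow>
    (nat list \<Rightarrow> (nat \<Rightarrow> complex) \<Rightarrow> complex) \<Rightarrow> bool" where
  "exchanged N i m v X' X \<longleftrightarrow>
     (\<forall>A\<in>lwords N i. \<forall>B\<in>lwords N m. \<forall>b1\<in>{1..N}. \<forall>b2\<in>{1..N}. \<forall>P. generic N P \<longrightarrow>
        f (h + v) * X' (A @ b1 # b2 # B) P =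
        (\<Sum>e1\<in>{1..N}. \<Sum>e2\<in>{1..N}. rwt v (fold dshift A P) b2 b1 e1 e2 * X (A @ e1 # e2 # B) P))"

text \<open>The hypothesis at the shifted point \<open>dshift l P\<close> creates an R-matrix below
  the row; \<open>tmat_exchange\<close> moves it above the row, where it carries the unshifted
  \<open>P\<close> again.\<close>

lemma exchanged_lop:
  assumes X: "exchanged N (length Y) (length ys) (y1 - y2) X' X" and kl: "k \<in> {1..N}" "l \<in> {1..N}"
  shows "exchanged N (length Y) (length ys) (y1 - y2)
    (lop N (Y @ y2 # y1 # ys) k l z X') (lop N (Y @ y1 # y2 # ys) k l z X)"
  unfolding exchanged_def
proof (intro ballI allI impI)
  fix Ab Bb b1 b2 P
  assume ass: "Ab \<in> lwords N (length Y)" "Bb \<in> lwords N (length ys)" "b1 \<in> {1..N}" "b2 \<in> {1..N}" "generic N P"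
  let ?A = "lwords N (length Y)" and ?B = "lwords N (length ys)"
  define T' where "T' = (\<lambda>A B a1 a2. tmat N z (Y @ y2 # y1 # ys) P (A @ a1 # a2 # B) (Ab @ b1 # b2 # Bb) l k)"
  define T where "T = (\<lambda>A B a1 a2 e1 e2. tmat N z (Y @ y1 # y2 # ys) P (A @ a1 # a2 # B) (Ab @ e1 # e2 # Bb) l k)"
  have len: "length (Y @ y2 # y1 # ys) = length Y + 2 + length ys" "length (Y @ y1 # y2 # ys) = length Y + 2 + length ys"
    by simp_all
  have "f (h + (y1 - y2)) * lop N (Y @ y2 # y1 # ys) k l z X' (Ab @ b1 # b2 # Bb) P =
      (\<Sum>A\<in>?A. \<Sum>B\<in>?B. \<Sum>a1\<in>{1..N}. \<Sum>a2\<in>{1..N}. (f (h + (y1 - y2)) * X' (A @ a1 # a2 # B) (dshift l P)) * T' A B a1 a2)"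
    unfolding lop_def len sum_lwords_split2 T'_def sum_distrib_left by (simp only: mult_ac)
  also have "\<dots> = (\<Sum>A\<in>?A. \<Sum>B\<in>?B. \<Sum>a1\<in>{1..N}. \<Sum>a2\<in>{1..N}. (\<Sum>e1\<in>{1..N}. \<Sum>e2\<in>{1..N}.
        rwt (y1 - y2) (fold dshift A (dshift l P)) a2 a1 e1 e2 * X (A @ e1 # e2 # B) (dshift l P)) * T' A B a1 a2)"
    using X ass unfolding exchanged_def by (intro sum.cong refl arg_cong2[where f = "(*)"]) auto
  also have "\<dots> = (\<Sum>A\<in>?A. \<Sum>B\<in>?B. \<Sum>e1\<in>{1..N}. \<Sum>e2\<in>{1..N}. X (A @ e1 # e2 # B) (dshift l P) *
        (\<Sum>a1\<in>{1..N}. \<Sum>a2\<in>{1..N}. rwt (y1 - y2) (fold dshift A (dshift l P)) a2 a1 e1 e2 * T' A B a1 a2))"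
    by (simp only: sum_pull4)
  also have "\<dots> = (\<Sum>A\<in>?A. \<Sum>B\<in>?B. \<Sum>e1\<in>{1..N}. \<Sum>e2\<in>{1..N}. X (A @ e1 # e2 # B) (dshift l P) *
        (\<Sum>g1\<in>{1..N}. \<Sum>g2\<in>{1..N}. rwt (y1 - y2) (fold dshift Ab P) b2 b1 g1 g2 * T A B e1 e2 g1 g2))"
  proof ((rule sum.cong[OF refl])+, rule arg_cong2[where f = "(*)", OF refl])
    fix A B e1 e2 assume "A \<in> ?A" "B \<in> ?B" "e1 \<in> {1..N}" "e2 \<in> {1..N}"
    then show "(\<Sum>a1\<in>{1..N}. \<Sum>a2\<in>{1..N}. rwt (y1 - y2) (fold dshift A (dshift l P)) a2 a1 e1 e2 * T' A B a1 a2) =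
        (\<Sum>g1\<in>{1..N}. \<Sum>g2\<in>{1..N}. rwt (y1 - y2) (fold dshift Ab P) b2 b1 g1 g2 * T A B e1 e2 g1 g2)"
      unfolding T_def T'_def using ass kl by (intro tmat_exchange) (auto simp:  lwords_def)
  qed
  also have "\<dots> = (\<Sum>g1\<in>{1..N}. \<Sum>g2\<in>{1..N}. rwt (y1 - y2) (fold dshift Ab P) b2 b1 g1 g2 *
        (\<Sum>A\<in>?A. \<Sum>B\<in>?B. \<Sum>e1\<in>{1..N}. \<Sum>e2\<in>{1..N}. X (A @ e1 # e2 # B) (dshift l P) * T A B e1 e2 g1 g2))"
    by (simp only: sum_pull6)
  also have "\<dots> = (\<Sum>g1\<in>{1..N}. \<Sum>g2\<in>{1..N}. rwt (y1 - y2) (fold dshift Ab P) b2 b1 g1 g2 *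
        lop N (Y @ y1 # y2 # ys) k l z X (Ab @ g1 # g2 # Bb) P)"
    by (simp only: lop_def len sum_lwords_split2 T_def)
  finally show "f (h + (y1 - y2)) * lop N (Y @ y2 # y1 # ys) k l z X' (Ab @ b1 # b2 # Bb) P =
      (\<Sum>e1\<in>{1..N}. \<Sum>e2\<in>{1..N}. rwt (y1 - y2) (fold dshift Ab P) b2 b1 e1 e2 *
        lop N (Y @ y1 # y2 # ys) k l z X (Ab @ e1 # e2 # Bb) P)" .
qed

end

subsection \<open>Exchange relation for weight functions\<close>

context theta_like
begin

text \<open>The three kinds of factors in U_J: \<open>phi\<close> where a site is shared by levels l
  and l + 1, \<open>psi\<close> for later variables of level l + 1, \<open>kap\<close> between two
  variables of level l.\<close>

definition phi :: "complex \<Rightarrow> complex \<Rightarrow> complex" where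
  "phi x z = f (x + z) * f h / (f (h + z) * f x)"

definition psi :: "complex \<Rightarrow> complex" where
  "psi z = f z / f (h + z)"

definition kap :: "complex \<Rightarrow> complex" where
  "kap z = f (z - h) / f z"

section \<open>Three-term identities for the factors of the weight function\<close>

lemma wt_ao:
  assumes "m = a + h" and "u = - a" and "f a \<noteq> 0" and "f m \<noteq> 0" and "f (h + (p - r)) \<noteq> 0" and "f (h + (q - r)) \<noteq> 0"
  shows "f (h + (p - q)) * (phi m (q - r) * psi (p - r)) = f h * f (p - q + u) / f u * (phi m (p - r) * psi (q - r)) + f (p - q) * phi a (q - r)"
proof -
  have key: "f (a) * f (p - r) * f (m + (q - r)) * f (h + (p - q)) - f (a + (q - r)) * f (p - q) * f (m) * f (h + (p - r)) = f (- (p - q + u)) * f (- (q - r)) * f (m + (p - r)) * f (- (h))"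
    by (rule three_term_args[where x = "a / 2 + p / 2 - r / 2" and z = "a / 2 - p / 2 + r / 2" and y = "a / 2 + h + p / 2 - r / 2" and w = "a / 2 - p / 2 + q - r / 2"])
      (simp_all add: assms field_simps)
  note key = key[unfolded odd]
  have odd_u: "f u = - f a" unfolding assms(2) by (rule odd)
  show ?thesis
    using assms(3-6) key unfolding odd_u phi_def psi_def
    apply (simp add: divide_simps)
    by algebra
qed

text \<open>In these names \<open>o\<close> marks the letter \<open>Suc l\<close>, which owns no
  variable of level l, and \<open>a\<close> a smaller letter. In this order the whole gauge factor
  appears, in \<open>wt_ao\<close> none.\<close>

lemma wt_oa:
  assumes "m = a + h" and "f a \<noteq> 0" and "f m \<noteq> 0" and "f (h + (p - r)) \<noteq> 0" and "f (h + (q - r)) \<noteq> 0"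
  shows "f (h + (p - q)) * phi a (p - r) = f h * f (p - q + a) / f a * phi a (q - r) + f (p - q) * (f (h + a) * f (a - h) / (f a)\<^sup>2) * (phi m (p - r) * psi (q - r))"
proof -
  have key: "f (a) * f (a + (p - r)) * f (h + (q - r)) * f (h + (p - q)) - f (a + (q - r)) * f (p - q + a) * f (h) * f (h + (p - r)) = f (- (p - q)) * f (- (q - r)) * f (m + (p - r)) * f (a - h)"
    by (rule three_term_args[where x = "a + p / 2 - r / 2" and z = "- p / 2 + r / 2" and y = "h + p / 2 - r / 2" and w = "- p / 2 + q - r / 2"])
      (simp_all add: assms field_simps)
  note key = key[unfolded odd]
  have ha: "h + a = m" using assms by simp
  show ?thesis
    using assms(2-5) key unfolding ha phi_def psi_def
    apply (simp add: divide_simps power2_eq_square)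
    by algebra
qed

text \<open>Pair the terms that share a \<open>kap\<close> and differ by exchanging p and q. Each
  difference factors by one three-term instance, and the two results cancel because their
  denominators \<open>f (r - k)\<close> and \<open>f (k - r)\<close> have opposite signs.\<close>

lemma wt_same:
  assumes "m = a + h" and "l = m + h" and "f m \<noteq> 0" and "f l \<noteq> 0" and "f (r - k) \<noteq> 0" and "f (h + (p - r)) \<noteq> 0" and "f (h + (q - r)) \<noteq> 0" and "f (h + (p - k)) \<noteq> 0" and "f (h + (q - k)) \<noteq> 0"
  shows "phi m (p - r) * psi (q - r) * phi l (q - k) * kap (r - k) + phi m (p - k) * psi (q - k) * phi l (q - r) * kap (k - r) = phi m (q - r) * psi (p - r) * phi l (p - k) * kap (r - k) + phi m (q - k) * psi (p - k) * phi l (p - r) * kap (k - r)"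
proof -
  have key1: "f (q - k) * f (h + (p - r)) * f (m + (p - k)) * f (l + (q - r)) - f (p - k) * f (h + (q - r)) * f (m + (q - k)) * f (l + (p - r)) = f (r - k - h) * f (- (p - q)) * f (l + (p + q - r - k)) * f (- (m))"
    by (rule three_term_args[where x = "h / 2 - k / 2 + p / 2 + q / 2 - r / 2" and z = "- h / 2 - k / 2 - p / 2 + q / 2 + r / 2" and y = "a + 3 * h / 2 - k / 2 + p / 2 + q / 2 - r / 2" and w = "- h / 2 - k / 2 + p / 2 - q / 2 + r / 2"])
      (simp_all add: assms field_simps)
  have key2: "f (q - r) * f (m + (p - r)) * f (h + (p - k)) * f (l + (q - k)) - f (p - r) * f (m + (q - r)) * f (h + (q - k)) * f (l + (p - k)) = f (- (m)) * f (- (p - q)) * f (l + (p + q - r - k)) * f (k - r - h)"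
    by (rule three_term_args[where x = "a / 2 + h / 2 + p / 2 + q / 2 - r" and z = "- a / 2 - h / 2 - p / 2 + q / 2" and y = "a / 2 + 3 * h / 2 - k + p / 2 + q / 2" and w = "- a / 2 - h / 2 + p / 2 - q / 2"])
      (simp_all add: assms field_simps)
  note key = key1[unfolded odd] key2[unfolded odd]
  have odd_kr: "f (k - r) = - f (r - k)" using odd[of "r - k"] by simp
  show ?thesis
    using assms(3-) key unfolding odd_kr phi_def psi_def kap_def
    apply (simp add: divide_simps)
    by algebra
qed

text \<open>For two different letters the exchange of p, q produces the exchange coefficients of the
  level variables r, k as well; the factor \<open>f (r - k)\<close> clears their common
  denominator.\<close>

lemma wt_ab:
  assumes "m = a + h" and "n = b + h" and "e = a - b" and "u = - e" and "f m \<noteq> 0" and "f n \<noteq> 0" and "f e \<noteq> 0" and "f (r - k) \<noteq> 0" and "f (h + (p - r)) \<noteq> 0" and "f (h + (q - r)) \<noteq> 0" and "f (h + (p - k)) \<noteq> 0" and "f (h + (q - k)) \<noteq> 0"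
  shows "f (h + (p - q)) * (phi m (q - k) * psi (p - k) * phi n (p - r) * kap (k - r)) * f (r - k) = f h * f (p - q + u) / f u * (phi m (p - k) * psi (q - k) * phi n (q - r) * kap (k - r)) * f (r - k) + f (p - q) * (f (h + (r - k)) * (phi n (p - r) * psi (q - r) * phi m (q - k) * kap (r - k)) + f h * f (r - k + e) / f e * (phi n (p - k) * psi (q - k) * phi m (q - r) * kap (k - r)))"
proof -
  have key1: "f (r - k) * f (p - q + u) * f (n + (q - r)) * f (m + (p - k)) - f (- (e)) * f (p - q + (r - k)) * f (m + (q - k)) * f (n + (p - r)) = f (- (p - q)) * f (r - k + e) * f (n + (p - k)) * f (- (m + (q - r)))"
    by (rule three_term_args[where x = "- a / 2 + b / 2 - k / 2 + p / 2 - q / 2 + r / 2" and z = "a / 2 - b / 2 - k / 2 - p / 2 + q / 2 + r / 2" and y = "a / 2 + b / 2 + h - k / 2 + p / 2 + q / 2 - r / 2" and w = "- a / 2 + b / 2 + k / 2 - p / 2 + q / 2 - r / 2"])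
      (simp_all add: assms field_simps)
  have key2: "f (r - k) * f (p - k) * f (h + (q - r)) * f (h + (p - q)) - f (q - k) * f (p - q + (r - k)) * f (h) * f (h + (p - r)) = f (- (p - q)) * f (- (q - r)) * f (h + (p - k)) * f (r - k - h)"
    by (rule three_term_args[where x = "- k + p / 2 + r / 2" and z = "- p / 2 + r / 2" and y = "h + p / 2 - r / 2" and w = "- p / 2 + q - r / 2"])
      (simp_all add: assms field_simps)
  note key = key1[unfolded odd] key2[unfolded odd]
  have odd_u: "f u = - f e" unfolding assms(4) by (rule odd)
  have kap_kr: "kap (k - r) = f (h + (r - k)) / f (r - k)" and kap_rk: "kap (r - k) = f (r - k - h) / f (r - k)"
    using odd[of "r - k"] odd[of "h + (r - k)"] by (simp_all add: kap_def algebra_simps)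
  show ?thesis
    using assms(5-) key unfolding odd_u phi_def psi_def kap_kr kap_rk
    apply (simp add: divide_simps)
    by algebra
qed

text \<open>
  \<open>lev l w ys ts P\<close> is the factor of level \<open>l\<close> in \<open>U\<^sub>J\<close>, read along the word \<open>w\<close>: \<open>ys\<close> are the variables
  of level \<open>l + 1\<close>, \<open>ts\<close> those of level \<open>l\<close>.  Accumulating the shifts from the left, starting at \<open>P\<close>,
  absorbs both the numbers \<open>C\<^sub>\<mu>(s)\<close> and the total weight shift of the theorem.
\<close>

primrec lev :: "nat \<Rightarrow> nat list \<Rightarrow> complex list \<Rightarrow> complex list \<Rightarrow> (nat \<Rightarrow> complex) \<Rightarrow> complex" where
  "lev l [] ys ts P = 1"
| "lev l (c # w) ys ts P =
     (if c \<le> l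
      then phi (h * dgap (dshift c P) c (Suc l)) (hd ys - hd ts) * (\<Prod>y\<in>#mset (tl ys). psi (y - hd ts)) *
        (\<Prod>t\<in>#mset (tl ts). kap (hd ts - t)) * lev l w (tl ys) (tl ts) (dshift c P)
      else lev l w (tl ys) ts (dshift c P))"

text \<open>Symmetrization written as a sum over all lists with a given multiset. For pairwise
  distinct variables this is the sum over permutations, and only the multisets of the lower levels
  matter. A lower level reads the word with the larger letters deleted.\<close>

primrec wsum :: "(nat \<Rightarrow> complex list) \<Rightarrow> nat \<Rightarrow> nat list \<Rightarrow> complex list \<Rightarrow> (nat \<Rightarrow> complex) \<Rightarrow> complex" where
  "wsum tt 0 w ys P = 1"
| "wsum tt (Suc l) w ys P =
     (\<Sum>ts | mset ts = mset (tt l). lev l w ys ts P * wsum tt l (filter (\<lambda>c. c \<le> l) w) ts P)"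

text \<open>The factors of a prefix involve the variables behind it only through products over
  multisets, so one constant serves all orders of the two variables to be exchanged.\<close>

lemma lev_append:
  assumes "length Y = length A" "length Ts = length (filter (\<lambda>c. c \<le> l) A)"
  shows "\<exists>K. \<forall>w ys' ts'. mset ys' = mset ys \<longrightarrow> mset ts' = mset ts \<longrightarrow>
    lev l (A @ w) (Y @ ys') (Ts @ ts') P = K * lev l w ys' ts' (fold dshift A P)"
  using assms
proof (induction A arbitrary: Y Ts P)
  case Nil
  then show ?case by (intro exI[of _ 1]) auto
next
  case (Cons c A)
  then obtain y Y' where Y: "Y = y # Y'" by (metis length_Suc_conv)
  show ?case
  proof (cases "c \<le> l")
    case True
    with Cons.prems obtain t Ts' where Ts: "Ts = t # Ts'" by (auto simp: length_Suc_conv)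
    obtain K where K: "\<And>w ys' ts'. mset ys' = mset ys \<Longrightarrow> mset ts' = mset ts \<Longrightarrow>
        lev l (A @ w) (Y' @ ys') (Ts' @ ts') (dshift c P) = K * lev l w ys' ts' (fold dshift A (dshift c P))"
      using Cons.IH[of Y' Ts' "dshift c P"] Cons.prems Y Ts True by auto
    show ?thesis
      by (rule exI[of _ "phi (h * dgap (dshift c P) c (Suc l)) (y - t) * (\<Prod>y\<in>#mset (Y' @ ys). psi (y - t)) *
        (\<Prod>t'\<in>#mset (Ts' @ ts). kap (t - t')) * K"])
        (use True in \<open>simp add: Y Ts K\<close>)
  next
    case False
    obtain K where K: "\<And>w ys' ts'. mset ys' = mset ys \<Longrightarrow> mset ts' = mset ts \<Longrightarrow>
        lev l (A @ w) (Y' @ ys') (Ts @ ts') (dshift c P) = K * lev l w ys' ts' (fold dshift A (dshift c P))"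
      using Cons.IH[of Y' Ts "dshift c P"] Cons.prems Y False by auto
    show ?thesis by (rule exI[of _ K]) (use False in \<open>simp add: Y K\<close>)
  qed
qed

definition gen_set :: "complex set \<Rightarrow> bool" where
  "gen_set U \<longleftrightarrow> (\<forall>a\<in>U. \<forall>b\<in>U. f (h + (a - b)) \<noteq> 0 \<and> (a \<noteq> b \<longrightarrow> f (a - b) \<noteq> 0))"

lemma gen_setD:
  "gen_set U \<Longrightarrow> a \<in> U \<Longrightarrow> b \<in> U \<Longrightarrow> f (h + (a - b)) \<noteq> 0"
  "gen_set U \<Longrightarrow> a \<in> U \<Longrightarrow> b \<in> U \<Longrightarrow> a \<noteq> b \<Longrightarrow> f (a - b) \<noteq> 0"
  by (auto simp: gen_set_def)

text \<open>Two successive exchanges with opposite spectral parameter are scalar. This is the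
  three-term identity with w = 0.\<close>

lemma unitarity:
  assumes "f x \<noteq> 0"
  shows "f (h + v) * f (h - v) = f v * f v * (f (h + x) * f (x - h) / (f x)\<^sup>2) * - 1
    + (f h * f (v + x) / f x) * (f h * f (v - x) / f (- x))"
proof -
  have "f (h + x) * f (x - h) * f v * f v - f x * f x * f (v + h) * f (v - h) = f h * f h * f (x + v) * f (x - v)"
    using three_term[of x h v 0] by (simp add: add.commute)
  moreover have "f (h - v) = - f (v - h)" "f (v - x) = - f (x - v)"
    using odd[of "v - h"] odd[of "x - v"] by simp_all
  ultimately show ?thesis
    using assms by (simp add: odd add.commute) (simp add: divide_simps power2_eq_square, algebra)
qed

text \<open>The double sum in \<open>exchanged\<close> after the ice rule has left at most two
  terms.\<close>

definition exch :: "nat \<Rightarrow> nat \<Rightarrow> (nat \<Rightarrow> complex) \<Rightarrow> complex \<Rightarrow> (nat \<Rightarrow> nat \<Rightarrow> complex) \<Rightarrow> complex" where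
  "exch b1 b2 P v F = (if b1 = b2 then f (h + v) * F b1 b1
     else cw b2 b1 P v * F b1 b2 + f v * gauge b2 b1 P * F b2 b1)"

lemma exch_mult: "exch b1 b2 P v (\<lambda>a b. K * F a b) = K * exch b1 b2 P v F"
  by (simp add: exch_def algebra_simps)

lemma exch_sum: "exch b1 b2 P v (\<lambda>a b. \<Sum>t\<in>T. F t a b) = (\<Sum>t\<in>T. exch b1 b2 P v (F t))"
  by (simp add: exch_def sum_distrib_left sum.distrib)

text \<open>Only one of the two letters owns a variable of level l, so no exchange on that level is
  involved.\<close>

lemma lev_exchange_top:
  assumes P: "generic N P" and ab: "a \<in> {1..l}" "l < N"
    and nz: "f (h + (y1 - t)) \<noteq> 0" "f (h + (y2 - t)) \<noteq> 0"
  shows "f (h + (y1 - y2)) * lev l (a # Suc l # B) (y2 # y1 # ys) (t # ts) P =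
      exch a (Suc l) P (y1 - y2) (\<lambda>e1 e2. lev l (e1 # e2 # B) (y1 # y2 # ys) (t # ts) P)"
    and "f (h + (y1 - y2)) * lev l (Suc l # a # B) (y2 # y1 # ys) (t # ts) P =
      exch (Suc l) a P (y1 - y2) (\<lambda>e1 e2. lev l (e1 # e2 # B) (y1 # y2 # ys) (t # ts) P)"
proof -
  define x where "x = h * dgap P a (Suc l)"
  define R where "R = (\<Prod>y\<in>#mset ys. psi (y - t)) * (\<Prod>t'\<in>#mset ts. kap (t - t')) * lev l B ys ts (dshift a (dshift (Suc l) P))"
  have a: "a \<noteq> Suc l" "a \<le> l" using ab by auto
  have x1: "h * dgap (dshift a P) a (Suc l) = x + h" using a by (simp add: x_def algebra_simps)
  have x0: "h * dgap (dshift a (dshift (Suc l) P)) a (Suc l) = x" using a by (simp add: x_def)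
  have u: "h * dgap P (Suc l) a = - x" by (simp add: x_def dgap_def algebra_simps)
  have nzx: "f x \<noteq> 0" "f (x + h) \<noteq> 0"
    using genericD(1,2)[OF P, of a "Suc l"] ab by (auto simp: x_def add.commute)
  have "gauge (Suc l) a P = 1" "gauge a (Suc l) P = f (h + x) * f (x - h) / (f x)\<^sup>2"
    using a by (auto simp: gauge_def x_def)
  note g = this
  have e1: "lev l (a # Suc l # B) (y # y' # ys) (t # ts) P = phi (x + h) (y - t) * psi (y' - t) * R" for y y'
    using a by (simp add: x1 R_def dshift_commute mult_ac del: dgap_dshift_cases)
  have e2: "lev l (Suc l # a # B) (y # y' # ys) (t # ts) P = phi x (y' - t) * R" for y y'
    using a by (simp add: x0 R_def dshift_commute mult_ac del: dgap_dshift_cases)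
  have "f (h + (y1 - y2)) * (phi (x + h) (y2 - t) * psi (y1 - t) * R) =
      (f h * f (y1 - y2 + - x) / f (- x) * (phi (x + h) (y1 - t) * psi (y2 - t)) + f (y1 - y2) * phi x (y2 - t)) * R"
    using wt_ao[OF refl refl nzx nz] by (metis mult.assoc)
  then show "f (h + (y1 - y2)) * lev l (a # Suc l # B) (y2 # y1 # ys) (t # ts) P =
      exch a (Suc l) P (y1 - y2) (\<lambda>e1 e2. lev l (e1 # e2 # B) (y1 # y2 # ys) (t # ts) P)"
    unfolding e1 e2 exch_def using a by (simp add: g cw_def u algebra_simps)
  have "f (h + (y1 - y2)) * (phi x (y1 - t) * R) =
      (f h * f (y1 - y2 + x) / f x * phi x (y2 - t) + f (y1 - y2) * (f (h + x) * f (x - h) / (f x)\<^sup>2) * (phi (x + h) (y1 - t) * psi (y2 - t))) * R"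
    using wt_oa[OF refl nzx nz] by (metis mult.assoc)
  then show "f (h + (y1 - y2)) * lev l (Suc l # a # B) (y2 # y1 # ys) (t # ts) P =
      exch (Suc l) a P (y1 - y2) (\<lambda>e1 e2. lev l (e1 # e2 # B) (y1 # y2 # ys) (t # ts) P)"
    unfolding e1 e2 exch_def using a by (simp add: g cw_def x_def[symmetric] algebra_simps)
qed

text \<open>
  The coordinates \<open>F\<close> of the lower level are assumed to satisfy the exchange relation in the level
  variables \<open>t1, t2\<close>; both sides are the contribution of the two orders of these variables.
\<close>

lemma lev_exchange_pair:
  assumes P: "generic N P" and ab: "a \<in> {1..l}" "b \<in> {1..l}" "l < N"
    and U: "gen_set U" "{y1, y2, t1, t2} \<subseteq> U" "y1 \<noteq> y2" "t1 \<noteq> t2"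
    and F: "\<And>c d. (c, d) \<in> {(a, b), (b, a)} \<Longrightarrow> f (h + (t1 - t2)) * F' c d = exch c d P (t1 - t2) F"
  shows "f (h + (y1 - y2)) * (lev l (a # b # B) (y2 # y1 # ys) (t1 # t2 # ts) P * F a b
           + lev l (a # b # B) (y2 # y1 # ys) (t2 # t1 # ts) P * F' a b) =
      exch a b P (y1 - y2) (\<lambda>c d. lev l (c # d # B) (y1 # y2 # ys) (t1 # t2 # ts) P * F c d
           + lev l (c # d # B) (y1 # y2 # ys) (t2 # t1 # ts) P * F' c d)"
proof -
  define R where "R = (\<Prod>y\<in>#mset ys. psi (y - t1)) * (\<Prod>y\<in>#mset ys. psi (y - t2)) *
      (\<Prod>t'\<in>#mset ts. kap (t1 - t')) * (\<Prod>t'\<in>#mset ts. kap (t2 - t')) * lev l B ys ts (dshift a (dshift b P))"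
  note nzU = gen_setD[OF U(1)]
  have nz: "f (h + (y1 - t1)) \<noteq> 0" "f (h + (y2 - t1)) \<noteq> 0" "f (h + (y1 - t2)) \<noteq> 0" "f (h + (y2 - t2)) \<noteq> 0"
    "f (t1 - t2) \<noteq> 0" "f (y1 - y2) \<noteq> 0" "f (h + (t1 - t2)) \<noteq> 0" "f (t2 - t1) \<noteq> 0"
    using U nzU by auto
  define x z where "x = h * dgap P a (Suc l)" and "z = h * dgap P b (Suc l)"
  have ab': "a \<le> l" "b \<le> l" "a \<noteq> Suc l" "b \<noteq> Suc l" using ab by auto
  show ?thesis
  proof (cases "a = b")
    case True
    have x1: "h * dgap (dshift a P) a (Suc l) = x + h" "h * dgap (dshift a (dshift a P)) a (Suc l) = x + h + h"
      using ab' by (simp_all add: x_def algebra_simps dgap_dshift)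
    have nzx: "f (x + h) \<noteq> 0" "f (x + h + h) \<noteq> 0"
      using genericD(2,3)[OF P, of a "Suc l"] ab by (auto simp: x_def algebra_simps)
    have Rb: "R = (\<Prod>y\<in>#mset ys. psi (y - t1)) * (\<Prod>y\<in>#mset ys. psi (y - t2)) *
      (\<Prod>t'\<in>#mset ts. kap (t1 - t')) * (\<Prod>t'\<in>#mset ts. kap (t2 - t')) * lev l B ys ts (dshift a (dshift a P))"
      by (simp add: R_def True)
    have e: "lev l (a # a # B) (y # y' # ys) (t # t' # ts) P =
        phi (x + h) (y - t) * psi (y' - t) * phi (x + h + h) (y' - t') * kap (t - t') * R"
      if "{t, t'} = {t1, t2}" for y y' t t'
      using that ab'(1,3) by (auto simp: x1 Rb mult_ac doubleton_eq_iff simp del: dgap_dshift_cases)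
    \<comment> \<open>For equal letters the exchange relation of the lower level just says that its
      coordinate is symmetric, and \<open>wt_same\<close> finishes.\<close>
    have "F' a a = F a a" using F[of a a] True nz by (simp add: exch_def)
    have comm: "{t2, t1} = {t1, t2}" by auto
    have "f (h + (y1 - y2)) * (lev l (a # a # B) (y2 # y1 # ys) (t1 # t2 # ts) P * F a a
           + lev l (a # a # B) (y2 # y1 # ys) (t2 # t1 # ts) P * F' a a) =
      exch a a P (y1 - y2) (\<lambda>c d. lev l (c # d # B) (y1 # y2 # ys) (t1 # t2 # ts) P * F c d
           + lev l (c # d # B) (y1 # y2 # ys) (t2 # t1 # ts) P * F' c d)"
      unfolding exch_def e[OF refl] e[OF comm] \<open>F' a a = F a a\<close>
      using arg_cong[OF wt_same[OF refl refl nzx nz(5,1,2,3,4)], of "\<lambda>u. f (h + (y1 - y2)) * (u * R * F a a)"]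
      by (simp only: if_True refl) (simp only: algebra_simps)
    then show ?thesis unfolding True .
  next
    case False
    define w v where "w = t1 - t2" and "v = y1 - y2"
    define \<Phi> where "\<Phi> = (\<lambda>x z y y' t t'. phi (x + h) (y - t) * psi (y' - t) * phi (z + h) (y' - t') * kap (t - t'))"
    have x1: "h * dgap (dshift a P) a (Suc l) = x + h" "h * dgap (dshift a (dshift b P)) b (Suc l) = z + h"
      "h * dgap (dshift b P) b (Suc l) = z + h" "h * dgap (dshift a (dshift b P)) a (Suc l) = x + h"
      using ab' False by (simp_all add: x_def z_def algebra_simps dgap_dshift)
    have nzx: "f (x + h) \<noteq> 0" "f (z + h) \<noteq> 0" "f (x - z) \<noteq> 0" "f (z - x) \<noteq> 0"
      using genericD(2)[OF P, of a "Suc l"] genericD(2)[OF P, of b "Suc l"]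
        genericD(1)[OF P, of a b] genericD(1)[OF P, of b a] ab False
      by (auto simp: x_def z_def algebra_simps dgap_def)
    have eab: "lev l (a # b # B) (y # y' # ys) (t # t' # ts) P = \<Phi> x z y y' t t' * R"
      and eba: "lev l (b # a # B) (y # y' # ys) (t # t' # ts) P = \<Phi> z x y y' t t' * R"
      if "{t, t'} = {t1, t2}" for y y' t t'
      using that ab' by (auto simp: x1 R_def \<Phi>_def mult_ac doubleton_eq_iff dshift_commute[of b a] simp del: dgap_dshift_cases)
    define ca cb where "ca = (\<lambda>v. f h * f (v + (x - z)) / f (x - z))" and "cb = (\<lambda>v. f h * f (v + (z - x)) / f (z - x))"
    have cwab: "cw a b P = ca" "cw b a P = cb"
      by (auto simp: cw_def ca_def cb_def x_def z_def dgap_def algebra_simps fun_eq_iff)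
    define g where "g = gauge a b P * gauge b a P"
    have g: "g = f (h + (x - z)) * f ((x - z) - h) / (f (x - z))\<^sup>2"
      using gauge_mult[OF False, of P] by (simp add: g_def x_def z_def dgap_def algebra_simps)
    have M: "f (h + v') * \<Phi> x z q p t2 t1 * f w = cb v' * \<Phi> x z p q t2 t1 * f w +
        f v' * (f (h + w) * \<Phi> z x p q t1 t2 + ca w * \<Phi> z x p q t2 t1)"
      and M': "f (h + v') * \<Phi> z x q p t2 t1 * f w = ca v' * \<Phi> z x p q t2 t1 * f w +
        f v' * (f (h + w) * \<Phi> x z p q t1 t2 + cb w * \<Phi> x z p q t2 t1)"
      if "(p, q, v') \<in> {(y1, y2, v), (y2, y1, - v)}" for p q v'
      using that wt_ab[of "x + h" x "z + h" z "x - z" "z - x" t1 t2 p q] wt_ab[of "z + h" z "x + h" x "z - x" "x - z" t1 t2 p q] nz nzx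
      by (auto simp: \<Phi>_def ca_def cb_def v_def w_def)
    note M1 = M[of y1 y2 v, simplified] and M2 = M'[of y1 y2 v, simplified] and M3 = M'[of y2 y1 "- v", simplified]
    \<comment> \<open>The coefficient of \<open>F a b\<close> once \<open>F'\<close> has been
      eliminated by the exchange relation of the lower level.\<close>
    define E where "E = (\<lambda>p q. f (h + w) * \<Phi> x z p q t1 t2 + cb w * \<Phi> x z p q t2 t1)"
    have cneg: "ca (- v) = cb v"
      using odd[of "v + (z - x)"] odd[of "z - x"] by (simp add: ca_def cb_def)
    have uni: "f (h + v) * f (h - v) = cb v * ca v - f v * f v * g"
    proof -
      have "f (v - (x - z)) = f (v + (z - x))" by (simp add: algebra_simps)
      then show ?thesis using unitarity[OF nzx(3), of v] by (simp add: g ca_def cb_def mult.commute)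
    qed
    \<comment> \<open>M3 is M2 with y1 and y2 exchanged and expresses \<open>E y2 y1\<close>.
      Inserting M2, unitarity turns the leftover coefficient into \<open>f v * f v * g\<close>, and
      the common factor \<open>f v\<close> cancels since y1 and y2 differ.\<close>
    have "f v * (f (h + v) * E y2 y1) = f v * (cb v * E y1 y2 + f v * f w * g * \<Phi> z x y1 y2 t2 t1)"
      using M2 M3 uni cneg unfolding E_def odd by (simp add: algebra_simps) algebra
    then have M4: "f (h + v) * E y2 y1 = cb v * E y1 y2 + f v * f w * g * \<Phi> z x y1 y2 t2 t1"
      using nz(6) by (simp add: v_def)
    have F1: "f (h + w) * F' a b = cb w * F a b + f w * gauge b a P * F b a"
      and F2: "f (h + w) * F' b a = ca w * F b a + f w * gauge a b P * F a b"
      using F[of a b] F[of b a] False by (auto simp: exch_def cwab w_def)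
    \<comment> \<open>Multiplying by \<open>f (h + w)\<close> allows both values of
      \<open>F'\<close> to be eliminated. M1 then gives the coefficient of \<open>F b a\<close> and
      M4 that of \<open>F a b\<close>.\<close>
    have "f (h + w) * (f (h + v) * (\<Phi> x z y2 y1 t1 t2 * F a b + \<Phi> x z y2 y1 t2 t1 * F' a b)) =
        f (h + w) * (cb v * (\<Phi> x z y1 y2 t1 t2 * F a b + \<Phi> x z y1 y2 t2 t1 * F' a b)
          + f v * gauge b a P * (\<Phi> z x y1 y2 t1 t2 * F b a + \<Phi> z x y1 y2 t2 t1 * F' b a))"
      using F1 F2 M1 M4 unfolding E_def g_def by algebra
    then have main: "f (h + v) * (\<Phi> x z y2 y1 t1 t2 * F a b + \<Phi> x z y2 y1 t2 t1 * F' a b) =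
        cb v * (\<Phi> x z y1 y2 t1 t2 * F a b + \<Phi> x z y1 y2 t2 t1 * F' a b)
          + f v * gauge b a P * (\<Phi> z x y1 y2 t1 t2 * F b a + \<Phi> z x y1 y2 t2 t1 * F' b a)"
      using nz(7) by (simp add: w_def)
    have comm: "{t2, t1} = {t1, t2}" by auto
    show ?thesis
      unfolding exch_def if_not_P[OF False] eab[OF refl] eba[OF refl] eab[OF comm] eba[OF comm] cwab v_def[symmetric]
      using arg_cong[OF main, of "\<lambda>u. u * R"] by (simp only: algebra_simps)
  qed
qed

end

lemma fold_dshift_apply: "fold dshift A P i = P i + of_nat (count_list A i)"
  by (induction A arbitrary: P) (auto simp: dshift_def)

text \<open>Lower levels see a filtered word but the same \<open>P\<close>. Deleting letters other
  than c and d does not affect their gap, so the exchange coefficients of all levels agree.\<close>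

lemma dgap_fold_dshift_filter:
  "R c \<Longrightarrow> R d \<Longrightarrow> dgap (fold dshift (filter R A) P) c d = dgap (fold dshift A P) c d"
proof -
  have "count_list (filter R A) c = count_list A c" if "R c" for c
    using that by (induction A) auto
  then show "R c \<Longrightarrow> R d \<Longrightarrow> ?thesis" by (simp add: dgap_def fold_dshift_apply)
qed

context theta_like
begin

lemma exch_cong:
  assumes "dgap P c d = dgap Q c d"
  shows "exch c d P v F = exch c d Q v F"
proof -
  have "dgap P d c = dgap Q d c" using assms by (simp add: dgap_def) (metis minus_diff_eq)
  then show ?thesis by (simp add: exch_def cw_def gauge_def)
qed

definition swap_at :: "nat \<Rightarrow> 'a list \<Rightarrow> 'a list" where
  "swap_at i ts = take i ts @ ts ! Suc i # ts ! i # drop (Suc (Suc i)) ts"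

lemma swap_at_append [simp]: "length Ts = i \<Longrightarrow> swap_at i (Ts @ t1 # t2 # ts) = Ts @ t2 # t1 # ts"
  by (auto simp: swap_at_def nth_append)

lemma list_split2:
  assumes "Suc i < length ts"
  obtains Ts t1 t2 ts' where "ts = Ts @ t1 # t2 # ts'" "length Ts = i"
proof
  show "ts = take i ts @ ts ! i # ts ! Suc i # drop (Suc (Suc i)) ts"
    using assms by (simp add: Cons_nth_drop_Suc)
  show "length (take i ts) = i" using assms by simp
qed

lemma list_split1:
  assumes "i < length ts"
  obtains Ts t ts' where "ts = Ts @ t # ts'" "length Ts = i"
proof
  show "ts = take i ts @ ts ! i # drop (Suc i) ts"
    using assms by (simp add: Cons_nth_drop_Suc)
  show "length (take i ts) = i" using assms by simp
qed

lemma finite_mset_eq: "finite {ts. mset ts = M}"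
proof -
  obtain xs where "mset xs = M" using ex_mset by blast
  then show ?thesis using mset_eq_finite[of xs] by simp
qed

lemma sum_swap_at:
  assumes "Suc i < size M"
  shows "(\<Sum>ts | mset ts = M. g (swap_at i ts)) = (\<Sum>ts | mset ts = M. g ts)"
proof -
  have *: "swap_at i (swap_at i ts) = ts \<and> mset (swap_at i ts) = M" if "mset ts = M" for ts
  proof -
    have "Suc i < length ts" using assms that by (metis size_mset)
    then obtain Ts t1 t2 ts' where "ts = Ts @ t1 # t2 # ts'" "length Ts = i" by (rule list_split2)
    then show ?thesis using that by auto
  qed
  show ?thesis
    by (rule sum.reindex_bij_witness[of _ "swap_at i" "swap_at i"]) (auto simp: *)
qed

text \<open>Induction on the level, according to how many of the two letters survive to the next
  lower level. The relation of that lower level is needed only when both do, with its variables t1,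
  t2 in the role of y1, y2.\<close>

lemma wsum_exchange:
  assumes "gen_set U" "generic N P" "l \<le> N"
    and "length Y = length A" "set (A @ b1 # b2 # B) \<subseteq> {1..l}" "y1 \<in> U" "y2 \<in> U" "y1 \<noteq> y2"
    and "\<And>k. k < l \<Longrightarrow> length (tt k) = length (filter (\<lambda>c. c \<le> k) (A @ b1 # b2 # B))"
    and "\<And>k. k < l \<Longrightarrow> set (tt k) \<subseteq> U \<and> distinct (tt k)"
  shows "f (h + (y1 - y2)) * wsum tt l (A @ b1 # b2 # B) (Y @ y2 # y1 # ys) P =
    exch b1 b2 (fold dshift A P) (y1 - y2) (\<lambda>e1 e2. wsum tt l (A @ e1 # e2 # B) (Y @ y1 # y2 # ys) P)"
  using assms(3-)
proof (induction l arbitrary: A b1 b2 B Y ys y1 y2)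
  case 0
  then show ?case by simp
next
  case (Suc l)
  define Q where "Q = fold dshift A P"
  have Q: "generic N Q" using assms(2) by (simp add: Q_def)
  define A' B' where "A' = filter (\<lambda>c. c \<le> l) A" and "B' = filter (\<lambda>c. c \<le> l) B"
  have lenl: "length (tt l) = length (filter (\<lambda>c. c \<le> l) (A @ b1 # b2 # B))"
    and ttU: "set (tt l) \<subseteq> U" "distinct (tt l)"
    using Suc.prems(7,8)[of l] by auto
  define TS where "TS = {ts. mset ts = mset (tt l)}"
  have TS: "set ts \<subseteq> U" "distinct ts" "length ts = length (tt l)" if "ts \<in> TS" for ts
  proof -
    have "mset ts = mset (tt l)" using that by (simp add: TS_def)
    then show "set ts \<subseteq> U" "distinct ts" "length ts = length (tt l)"
      using ttU mset_eq_setD mset_eq_imp_distinct_iff mset_eq_length by blast+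
  qed
  note nzU = gen_setD[OF assms(1)]
  have bs: "b1 \<in> {1..Suc l}" "b2 \<in> {1..Suc l}" using Suc.prems by auto
  have lA: "length Y = length A" by fact
  have factor: "\<exists>K. \<forall>e1 e2 p q ts'. mset [p, q] = mset [y1, y2] \<longrightarrow> mset ts' = mset ts \<longrightarrow>
      lev l (A @ e1 # e2 # B) (Y @ p # q # ys) (Ts @ ts') P = K * lev l (e1 # e2 # B) (p # q # ys) ts' Q"
    if "length Ts = length A'" for Ts ts
  proof -
    have "length Ts = length (filter (\<lambda>c. c \<le> l) A)" using that by (simp add: A'_def)
    from lev_append[OF lA this, of "y1 # y2 # ys" ts P]
    obtain K where K: "\<forall>w ys' ts'. mset ys' = mset (y1 # y2 # ys) \<longrightarrow> mset ts' = mset ts \<longrightarrow>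
        lev l (A @ w) (Y @ ys') (Ts @ ts') P = K * lev l w ys' ts' Q"
      unfolding Q_def by (elim exE)
    have "mset (p # q # ys) = mset (y1 # y2 # ys)" if "mset [p, q] = mset [y1, y2]" for p q
      using arg_cong[OF that, of "\<lambda>M. M + mset ys"] by simp
    with K show ?thesis by (intro exI[of _ K]) blast
  qed
  have single: ?case
    if one: "\<And>ts. ts \<in> TS \<Longrightarrow> f (h + (y1 - y2)) * (lev l (A @ b1 # b2 # B) (Y @ y2 # y1 # ys) ts P *
          wsum tt l (filter (\<lambda>c. c \<le> l) (A @ b1 # b2 # B)) ts P) =
        exch b1 b2 Q (y1 - y2) (\<lambda>e1 e2. lev l (A @ e1 # e2 # B) (Y @ y1 # y2 # ys) ts P *
          wsum tt l (filter (\<lambda>c. c \<le> l) (A @ e1 # e2 # B)) ts P)"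
    unfolding wsum.simps exch_sum Q_def[symmetric]
    by (subst sum_distrib_left, rule sum.cong[OF refl]) (rule one, simp add: TS_def)
  consider "b1 = Suc l" "b2 = Suc l"
    | "b1 \<in> {1..l} \<and> b2 = Suc l \<or> b1 = Suc l \<and> b2 \<in> {1..l}"
    | "b1 \<in> {1..l}" "b2 \<in> {1..l}"
    using bs by fastforce
  then show ?case
  proof cases
    \<comment> \<open>No letter survives: the pair owns no variable of this level, and the lower
      word does not change.\<close>
    case 1
    show ?thesis
    proof (rule single)
      fix ts assume ts: "ts \<in> TS"
      have len: "length (take (length A') ts) = length A'"
        using TS(3)[OF ts] lenl by (simp add: A'_def)
      obtain K where K: "\<And>e1 e2 p q. mset [p, q] = mset [y1, y2] \<Longrightarrow>
          lev l (A @ e1 # e2 # B) (Y @ p # q # ys) ts P = K * lev l (e1 # e2 # B) (p # q # ys) (drop (length A') ts) Q"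
        using factor[OF len, of "drop (length A') ts"] by (metis append_take_drop_id)
      have "mset [y2, y1] = mset [y1, y2]" by simp
      note K1 = K[OF this] and K2 = K[OF refl]
      show "f (h + (y1 - y2)) * (lev l (A @ b1 # b2 # B) (Y @ y2 # y1 # ys) ts P *
          wsum tt l (filter (\<lambda>c. c \<le> l) (A @ b1 # b2 # B)) ts P) =
        exch b1 b2 Q (y1 - y2) (\<lambda>e1 e2. lev l (A @ e1 # e2 # B) (Y @ y1 # y2 # ys) ts P *
          wsum tt l (filter (\<lambda>c. c \<le> l) (A @ e1 # e2 # B)) ts P)"
        unfolding K1 K2 using 1 by (simp add: exch_def)
    qed
  next
    \<comment> \<open>One letter survives, so both orders of the pair give the same filtered word
      and the lower levels form a common factor \<open>V\<close>.\<close>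
    case 2
    show ?thesis
    proof (rule single)
      fix ts assume ts: "ts \<in> TS"
      have "length A' < length ts" using TS(3)[OF ts] lenl 2 by (auto simp: A'_def)
      then obtain Ts t ts' where tse: "ts = Ts @ t # ts'" "length Ts = length A'" by (rule list_split1)
      obtain K where K: "\<And>e1 e2 p q. mset [p, q] = mset [y1, y2] \<Longrightarrow>
          lev l (A @ e1 # e2 # B) (Y @ p # q # ys) ts P = K * lev l (e1 # e2 # B) (p # q # ys) (t # ts') Q"
        using factor[OF tse(2), of "t # ts'"] unfolding tse(1) by blast
      have "mset [y2, y1] = mset [y1, y2]" by simp
      note K1 = K[OF this] and K2 = K[OF refl]
      define V where "V = wsum tt l (A' @ (if b1 \<le> l then b1 else b2) # B') ts P"
      have V: "exch b1 b2 Q v (\<lambda>e1 e2. G e1 e2 * wsum tt l (filter (\<lambda>c. c \<le> l) (A @ e1 # e2 # B)) ts P) =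
          exch b1 b2 Q v (\<lambda>e1 e2. V * G e1 e2)" for v G
        using 2 by (auto simp: exch_def V_def A'_def B'_def mult.commute)
      have V': "wsum tt l (filter (\<lambda>c. c \<le> l) (A @ b1 # b2 # B)) ts P = V"
        using 2 by (auto simp: V_def A'_def B'_def)
      have "t \<in> U" using TS(1)[OF ts] tse by auto
      then have "f (h + (y1 - y2)) * lev l (b1 # b2 # B) (y2 # y1 # ys) (t # ts') Q =
          exch b1 b2 Q (y1 - y2) (\<lambda>e1 e2. lev l (e1 # e2 # B) (y1 # y2 # ys) (t # ts') Q)"
        using 2 lev_exchange_top[OF Q, of b1] lev_exchange_top[OF Q, of b2] Suc.prems nzU by auto
      then show "f (h + (y1 - y2)) * (lev l (A @ b1 # b2 # B) (Y @ y2 # y1 # ys) ts P *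
          wsum tt l (filter (\<lambda>c. c \<le> l) (A @ b1 # b2 # B)) ts P) =
        exch b1 b2 Q (y1 - y2) (\<lambda>e1 e2. lev l (A @ e1 # e2 # B) (Y @ y1 # y2 # ys) ts P *
          wsum tt l (filter (\<lambda>c. c \<le> l) (A @ e1 # e2 # B)) ts P)"
        unfolding V V' K1 K2 exch_mult by (simp only: mult_ac)
    qed
  next
    \<comment> \<open>Both survive: an ordering of the level variables is grouped with the one in
      which the two variables owned by the pair are interchanged.\<close>
    case 3
    define i where "i = length A'"
    have size: "Suc i < size (mset (tt l))"
      using lenl 3 by (simp add: i_def A'_def)
    define g' where "g' = (\<lambda>ts. lev l (A @ b1 # b2 # B) (Y @ y2 # y1 # ys) ts P *
          wsum tt l (filter (\<lambda>c. c \<le> l) (A @ b1 # b2 # B)) ts P)"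
    define g where "g = (\<lambda>ts e1 e2. lev l (A @ e1 # e2 # B) (Y @ y1 # y2 # ys) ts P *
          wsum tt l (filter (\<lambda>c. c \<le> l) (A @ e1 # e2 # B)) ts P)"
    have pair: "f (h + (y1 - y2)) * (g' ts + g' (swap_at i ts)) =
        exch b1 b2 Q (y1 - y2) (\<lambda>e1 e2. g ts e1 e2 + g (swap_at i ts) e1 e2)" if ts: "ts \<in> TS" for ts
    proof -
      have "Suc i < length ts" using size TS(3)[OF ts] by simp
      then obtain Ts t1 t2 ts' where tse: "ts = Ts @ t1 # t2 # ts'" "length Ts = i" by (rule list_split2)
      obtain K where K: "\<And>e1 e2 p q ts''. mset [p, q] = mset [y1, y2] \<Longrightarrow> mset ts'' = mset (t1 # t2 # ts') \<Longrightarrow>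
          lev l (A @ e1 # e2 # B) (Y @ p # q # ys) (Ts @ ts'') P = K * lev l (e1 # e2 # B) (p # q # ys) ts'' Q"
        using factor[of Ts "t1 # t2 # ts'"] tse(2) unfolding i_def by blast
      have ms: "mset [y2, y1] = mset [y1, y2]" "mset (t2 # t1 # ts') = mset (t1 # t2 # ts')" by simp_all
      note KK = K[OF ms(1) refl] K[OF ms] K[OF refl refl] K[OF refl ms(2)]
      have t: "t1 \<in> U" "t2 \<in> U" "t1 \<noteq> t2" using TS[OF ts] tse by auto
      define F where "F = (\<lambda>c d. wsum tt l (A' @ c # d # B') (Ts @ t1 # t2 # ts') P)"
      define F' where "F' = (\<lambda>c d. wsum tt l (A' @ c # d # B') (Ts @ t2 # t1 # ts') P)"
      have FF: "wsum tt l (filter (\<lambda>c. c \<le> l) (A @ c # d # B)) (Ts @ t1 # t2 # ts') P = F c d"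
        "wsum tt l (filter (\<lambda>c. c \<le> l) (A @ c # d # B)) (Ts @ t2 # t1 # ts') P = F' c d"
        if "c \<le> l" "d \<le> l" for c d using that by (simp_all add: F_def F'_def A'_def B'_def)
      have b: "b1 \<le> l" "b2 \<le> l" using 3 by auto
      have ge: "g (Ts @ t1 # t2 # ts') c d + g (Ts @ t2 # t1 # ts') c d =
          K * (lev l (c # d # B) (y1 # y2 # ys) (t1 # t2 # ts') Q * F c d
             + lev l (c # d # B) (y1 # y2 # ys) (t2 # t1 # ts') Q * F' c d)" if "c \<le> l" "d \<le> l" for c d
        unfolding g_def KK FF[OF that] by (simp only: algebra_simps)
      have g'e: "g' (Ts @ t1 # t2 # ts') + g' (Ts @ t2 # t1 # ts') =
          K * (lev l (b1 # b2 # B) (y2 # y1 # ys) (t1 # t2 # ts') Q * F b1 b2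
             + lev l (b1 # b2 # B) (y2 # y1 # ys) (t2 # t1 # ts') Q * F' b1 b2)"
        unfolding g'_def KK FF[OF b] by (simp only: algebra_simps)
      have F: "f (h + (t1 - t2)) * F' c d = exch c d Q (t1 - t2) F"
        if cd: "(c, d) \<in> {(b1, b2), (b2, b1)}" for c d
      proof -
        have cd': "c \<in> {1..l}" "d \<in> {1..l}" using cd 3 by auto
        have "f (h + (t1 - t2)) * wsum tt l (A' @ c # d # B') (Ts @ t2 # t1 # ts') P =
          exch c d (fold dshift A' P) (t1 - t2) (\<lambda>e1 e2. wsum tt l (A' @ e1 # e2 # B') (Ts @ t1 # t2 # ts') P)"
        proof (rule Suc.IH)
          show "set (A' @ c # d # B') \<subseteq> {1..l}"
            using Suc.prems(3) cd' by (auto simp: A'_def B'_def)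
          show "length (tt k) = length (filter (\<lambda>c. c \<le> k) (A' @ c # d # B'))" if "k < l" for k
          proof -
            have eq: "filter (\<lambda>c. c \<le> k) (filter (\<lambda>c. c \<le> l) xs) = filter (\<lambda>c. c \<le> k) xs" for xs
              using that by (auto intro!: filter_cong)
            show ?thesis
              using Suc.prems(7)[of k] that cd by (auto simp: A'_def B'_def eq simp del: filter_filter)
          qed
          show "set (tt k) \<subseteq> U \<and> distinct (tt k)" if "k < l" for k
            using Suc.prems(8)[of k] that by auto
        qed (use Suc.prems t tse in \<open>auto simp: i_def\<close>)
        moreover have "dgap (fold dshift A' P) c d = dgap Q c d"
          unfolding A'_def Q_def using cd' by (intro dgap_fold_dshift_filter) auto
        note exch_cong[OF this]
        ultimately show ?thesis unfolding F_def F'_def by (rule trans)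
      qed
      have main: "f (h + (y1 - y2)) * (lev l (b1 # b2 # B) (y2 # y1 # ys) (t1 # t2 # ts') Q * F b1 b2
           + lev l (b1 # b2 # B) (y2 # y1 # ys) (t2 # t1 # ts') Q * F' b1 b2) =
        exch b1 b2 Q (y1 - y2) (\<lambda>c d. lev l (c # d # B) (y1 # y2 # ys) (t1 # t2 # ts') Q * F c d
           + lev l (c # d # B) (y1 # y2 # ys) (t2 # t1 # ts') Q * F' c d)"
        using Suc.prems t by (intro lev_exchange_pair[OF Q 3 _ assms(1)] F) auto
      have "exch b1 b2 Q (y1 - y2) (\<lambda>e1 e2. g ts e1 e2 + g (swap_at i ts) e1 e2) =
          exch b1 b2 Q (y1 - y2) (\<lambda>c d. K * (lev l (c # d # B) (y1 # y2 # ys) (t1 # t2 # ts') Q * F c d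
             + lev l (c # d # B) (y1 # y2 # ys) (t2 # t1 # ts') Q * F' c d))"
        unfolding tse(1) swap_at_append[OF tse(2)]
        by (simp only: exch_def ge[OF b] ge[OF b(2,1)] ge[OF b(1) b(1)])
      then show ?thesis
        unfolding exch_mult main[symmetric] unfolding tse(1) swap_at_append[OF tse(2)] g'e by simp
    qed
    \<comment> \<open>Summing the paired relation over all orderings counts each ordering twice,
      once as itself and once as the partner of another.\<close>
    have "2 * (f (h + (y1 - y2)) * (\<Sum>ts\<in>TS. g' ts)) =
        (\<Sum>ts\<in>TS. f (h + (y1 - y2)) * (g' ts + g' (swap_at i ts)))"
      using sum_swap_at[OF size, of g'] by (simp add: TS_def sum.distrib flip: sum_distrib_left)
    also have "\<dots> = (\<Sum>ts\<in>TS. exch b1 b2 Q (y1 - y2) (\<lambda>e1 e2. g ts e1 e2 + g (swap_at i ts) e1 e2))"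
      using pair by (rule sum.cong[OF refl])
    also have "\<dots> = exch b1 b2 Q (y1 - y2) (\<lambda>e1 e2. \<Sum>ts\<in>TS. g ts e1 e2 + g (swap_at i ts) e1 e2)"
      by (rule exch_sum[symmetric])
    also have "\<dots> = exch b1 b2 Q (y1 - y2) (\<lambda>e1 e2. 2 * (\<Sum>ts\<in>TS. g ts e1 e2))"
      using sum_swap_at[OF size, of "\<lambda>ts. g ts e1 e2" for e1 e2] by (simp add: TS_def sum.distrib)
    also have "\<dots> = 2 * exch b1 b2 Q (y1 - y2) (\<lambda>e1 e2. \<Sum>ts\<in>TS. g ts e1 e2)"
      by (rule exch_mult)
    finally show ?thesis
      by (simp add: g_def g'_def TS_def Q_def)
  qed
qed

end

subsection \<open>The reference order of the sites\<close>

text \<open>The word of the reference order, largest letters first. \<Lambda> l is the number of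
  letters that are at most l.\<close>

primrec wmin :: "(nat \<Rightarrow> nat) \<Rightarrow> nat \<Rightarrow> nat list" where
  "wmin \<Lambda> 0 = []"
| "wmin \<Lambda> (Suc l) = replicate (\<Lambda> (Suc l) - \<Lambda> l) (Suc l) @ wmin \<Lambda> l"

lemma set_wmin: "set (wmin \<Lambda> l) \<subseteq> {1..l}"
  by (induction l) auto

lemma length_wmin: "mono \<Lambda> \<Longrightarrow> \<Lambda> 0 = 0 \<Longrightarrow> length (wmin \<Lambda> l) = \<Lambda> l"
  by (induction l) (auto simp: mono_iff_le_Suc)

section \<open>Support of the weight functions in the reference order\<close>

context theta_like
begin

lemma phi_0: "f x \<noteq> 0 \<Longrightarrow> phi x 0 = 1"
  using h_nonzero by (simp add: phi_def)

lemma psi_0 [simp]: "psi 0 = 0"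
  by (simp add: psi_def)

text \<open>Because \<open>psi 0 = 0\<close>, a level variable must not equal a parameter behind its
  own site. The level variables are the last k parameters, so as soon as a letter at most l occurs,
  its variable must be the parameter of its own site and only sites of that kind remain.\<close>

lemma lev_nonzeroD:
  assumes "lev l w ys ts P \<noteq> 0" "distinct ys" "length w = length ys" "set w \<subseteq> {1..Suc l}"
    and "k = length (filter (\<lambda>c. c \<le> l) w)" "mset ts = mset (drop (length ys - k) ys)"
  shows "w = replicate (length ys - k) (Suc l) @ filter (\<lambda>c. c \<le> l) w \<and> ts = drop (length ys - k) ys"
  using assms
proof (induction w arbitrary: ys ts P k)
  case Nil
  then show ?case by simp
next
  case (Cons c w)
  then obtain y ys' where ys: "ys = y # ys'" by (metis length_Suc_conv)
  define k' where "k' = length (filter (\<lambda>c. c \<le> l) w)"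
  have k': "k' \<le> length ys'" using Cons.prems(3) length_filter_le[of _ w] by (simp add: k'_def ys)
  show ?case
  proof (cases "c \<le> l")
    case True
    have k: "k = Suc k'" using Cons.prems(5) True by (simp add: k'_def)
    have "size (mset ts) = k" using Cons.prems(6) k' by (simp add: ys k)
    then obtain t ts' where ts: "ts = t # ts'" by (metis k size_mset length_Suc_conv)
    have nz: "(\<Prod>y\<in>#mset ys'. psi (y - t)) \<noteq> 0" "lev l w ys' ts' (dshift c P) \<noteq> 0"
      using Cons.prems(1) True by (auto simp: ys ts)
    have "t \<notin> set ys'" using nz(1) by force
    moreover have "t \<in> set (drop (length ys - k) ys)"
      using Cons.prems(6) by (metis ts list.set_intros(1) mset_eq_setD)
    ultimately have "t = y" "length ys - k = 0"
      by (cases "length ys - k"; auto simp: ys dest: in_set_dropD)+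
    then have full: "k' = length ys'" using k k' by (simp add: ys)
    have "w = replicate (length ys' - k') (Suc l) @ filter (\<lambda>c. c \<le> l) w \<and> ts' = drop (length ys' - k') ys'"
    proof (rule Cons.IH[OF nz(2)])
      show "mset ts' = mset (drop (length ys' - k') ys')"
        using Cons.prems(6) \<open>t = y\<close> full by (simp add: ys ts k)
      show "distinct ys'" "length w = length ys'" "set w \<subseteq> {1..Suc l}"
        using Cons.prems(2-4) by (simp_all add: ys)
    qed (simp only: k'_def)
    then have "filter (\<lambda>c. c \<le> l) w = w" "ts' = ys'" using full by simp_all
    then show ?thesis using full True \<open>t = y\<close> by (simp add: ys ts k)
  next
    case False
    then have c: "c = Suc l" and k: "k = k'" using Cons.prems(4,5) by (auto simp: k'_def)
    have d: "drop (length ys - k) ys = drop (length ys' - k) ys'"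
      using k k' by (simp add: ys Suc_diff_le)
    have IH: "w = replicate (length ys' - k) (Suc l) @ filter (\<lambda>c. c \<le> l) w \<and> ts = drop (length ys' - k) ys'"
    proof (rule Cons.IH)
      show "lev l w ys' ts (dshift c P) \<noteq> 0" using Cons.prems(1) False by (simp add: ys)
      show "mset ts = mset (drop (length ys' - k) ys')" using Cons.prems(6) d by simp
      show "distinct ys'" "length w = length ys'" "set w \<subseteq> {1..Suc l}"
        using Cons.prems(2-4) by (simp_all add: ys)
      show "k = length (filter (\<lambda>c. c \<le> l) w)" using k by (simp only: k'_def)
    qed
    define F where "F = filter (\<lambda>c. c \<le> l) w"
    have F: "filter (\<lambda>c. c \<le> l) (c # w) = F" using False by (simp add: F_def)
    have r: "replicate (length ys - k) (Suc l) = Suc l # replicate (length ys' - k) (Suc l)"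
      using k k' by (simp add: ys Suc_diff_le)
    show ?thesis
      unfolding F r d using IH[folded F_def] c by simp
  qed
qed

text \<open>When each variable equals the parameter of its own site, every \<open>phi\<close> is 1,
  so the dynamical variables drop out; the remaining \<open>psi\<close> and \<open>kap\<close> are
  nonzero by genericity. Leading letters \<open>Suc l\<close> contribute no factor.\<close>

lemma lev_diagonal:
  assumes "gen_set U" "set zs \<subseteq> U" "distinct zs" "Suc l \<le> N"
  shows "\<exists>K. K \<noteq> 0 \<and> (\<forall>P w m Y. generic N P \<longrightarrow> set w \<subseteq> {1..l} \<longrightarrow> length w = length zs \<longrightarrow> length Y = m \<longrightarrow>
    lev l (replicate m (Suc l) @ w) (Y @ zs) zs P = K)"
proof -
  have "\<exists>K. K \<noteq> 0 \<and> (\<forall>P w. generic N P \<longrightarrow> set w \<subseteq> {1..l} \<longrightarrow> length w = length zs \<longrightarrow> lev l w zs zs P = K)"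
    using assms(2,3)
  proof (induction zs)
    case Nil
    then show ?case by (intro exI[of _ 1]) auto
  next
    case (Cons z zs)
    then obtain K where K: "K \<noteq> 0" "\<And>P w. generic N P \<Longrightarrow> set w \<subseteq> {1..l} \<Longrightarrow> length w = length zs \<Longrightarrow> lev l w zs zs P = K"
      by auto
    define C where "C = (\<Prod>y\<in>#mset zs. psi (y - z)) * (\<Prod>t\<in>#mset zs. kap (z - t))"
    have nz: "psi (y - z) \<noteq> 0" "kap (z - y) \<noteq> 0" if "y \<in> set zs" for y
    proof -
      have yz: "y \<in> U" "z \<in> U" "y \<noteq> z" using that Cons.prems by auto
      have "f (z - y - h) = - f (h + (y - z))" using odd[of "h + (y - z)"] by (simp add: algebra_simps)
      then show "psi (y - z) \<noteq> 0" "kap (z - y) \<noteq> 0"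
        using gen_setD[OF assms(1)] yz by (auto simp: psi_def kap_def)
    qed
    have "C \<noteq> 0" using nz by (auto simp: C_def)
    have "lev l w (z # zs) (z # zs) P = C * K"
      if P: "generic N P" and w: "set w \<subseteq> {1..l}" "length w = length (z # zs)" for P w
    proof -
      obtain c w' where c: "w = c # w'" using w by (metis length_Suc_conv)
      have "c \<in> {1..l}" using w c by auto
      then have "f (h * dgap (dshift c P) c (Suc l)) \<noteq> 0"
        using assms(4) P by (intro genericD(1)[of N]) auto
      then show ?thesis
        using w c P K(2)[of "dshift c P" w'] by (auto simp: phi_0 C_def simp del: dgap_dshift_cases)
    qed
    with \<open>C \<noteq> 0\<close> K(1) show ?case by (intro exI[of _ "C * K"]) auto
  qed
  then obtain K where K: "K \<noteq> 0" "\<And>P w. generic N P \<Longrightarrow> set w \<subseteq> {1..l} \<Longrightarrow> length w = length zs \<Longrightarrow> lev l w zs zs P = K"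
    by auto
  have "lev l (replicate m (Suc l) @ w) (Y @ zs) zs P = K"
    if "generic N P" "set w \<subseteq> {1..l}" "length w = length zs" "length Y = m" for P w m Y
    using that
  proof (induction m arbitrary: Y P)
    case (Suc m)
    then obtain y Y' where "Y = y # Y'" by (metis length_Suc_conv)
    then show ?case using Suc by simp
  qed (use K in auto)
  with K(1) show ?thesis by blast
qed

text \<open>On every level a single ordering survives, and it forces the largest letters to the
  front. The nonzero value is what later allows the proportionality constant to be defined by
  division.\<close>

lemma wsum_wmin:
  assumes "gen_set U" "mono \<Lambda>" "\<Lambda> 0 = 0" "l \<le> N" "length ys = \<Lambda> l" "distinct ys" "set ys \<subseteq> U"
    and "\<And>k. k < l \<Longrightarrow> mset (tt k) = mset (drop (\<Lambda> l - \<Lambda> k) ys)"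
  shows "\<exists>K. K \<noteq> 0 \<and> (\<forall>P w. generic N P \<longrightarrow> set w \<subseteq> {1..l} \<longrightarrow> (\<forall>k\<le>l. length (filter (\<lambda>c. c \<le> k) w) = \<Lambda> k) \<longrightarrow>
    wsum tt l w ys P = (if w = wmin \<Lambda> l then K else 0))"
  using assms(4-)
proof (induction l arbitrary: ys)
  case 0
  then show ?case by (intro exI[of _ 1]) (use assms(3) in auto)
next
  case (Suc l)
  define m where "m = \<Lambda> (Suc l) - \<Lambda> l"
  define zs where "zs = drop m ys"
  have mono: "\<Lambda> j \<le> \<Lambda> k" if "j \<le> k" for j k using assms(2) that by (simp add: monoD)
  have len: "length zs = \<Lambda> l" using Suc.prems mono[of l "Suc l"] by (simp add: zs_def m_def)
  have ys: "ys = take m ys @ zs" and lm: "length (take m ys) = m" by (simp_all add: zs_def m_def Suc.prems)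
  have zs: "distinct zs" "set zs \<subseteq> U"
    using Suc.prems by (auto simp: zs_def dest: in_set_dropD)
  have "\<exists>K. K \<noteq> 0 \<and> (\<forall>P w. generic N P \<longrightarrow> set w \<subseteq> {1..l} \<longrightarrow> (\<forall>k\<le>l. length (filter (\<lambda>c. c \<le> k) w) = \<Lambda> k) \<longrightarrow>
    wsum tt l w zs P = (if w = wmin \<Lambda> l then K else 0))"
  proof (rule Suc.IH)
    fix k assume "k < l"
    then have "drop (\<Lambda> (Suc l) - \<Lambda> k) ys = drop (\<Lambda> l - \<Lambda> k) zs"
      using mono[of k l] mono[of l "Suc l"] by (simp add: zs_def m_def)
    then show "mset (tt k) = mset (drop (\<Lambda> l - \<Lambda> k) zs)" using Suc.prems(5)[of k] \<open>k < l\<close> by simp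
  qed (use Suc.prems zs len in auto)
  then obtain K where K: "K \<noteq> 0" "\<And>P w. generic N P \<Longrightarrow> set w \<subseteq> {1..l} \<Longrightarrow> (\<forall>k\<le>l. length (filter (\<lambda>c. c \<le> k) w) = \<Lambda> k) \<Longrightarrow>
    wsum tt l w zs P = (if w = wmin \<Lambda> l then K else 0)"
    by auto
  obtain C where C: "C \<noteq> 0" "\<And>P w m Y. generic N P \<Longrightarrow> set w \<subseteq> {1..l} \<Longrightarrow> length w = length zs \<Longrightarrow> length Y = m \<Longrightarrow>
    lev l (replicate m (Suc l) @ w) (Y @ zs) zs P = C"
    using lev_diagonal[OF assms(1) zs(2,1) Suc.prems(1)] by metis
  have "wsum tt (Suc l) w ys P = (if w = wmin \<Lambda> (Suc l) then C * K else 0)"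
    if P: "generic N P" and w: "set w \<subseteq> {1..Suc l}" "\<forall>k\<le>Suc l. length (filter (\<lambda>c. c \<le> k) w) = \<Lambda> k" for P w
  proof -
    define w' where "w' = filter (\<lambda>c. c \<le> l) w"
    have "filter (\<lambda>c. c \<le> Suc l) w = w" using w(1) by (auto simp: filter_id_conv)
    then have lw: "length w = length ys" using w(2) Suc.prems(2) by (metis order_refl)
    have lw': "length w' = \<Lambda> l" using w(2) by (simp add: w'_def)
    have cnt: "\<forall>k\<le>l. length (filter (\<lambda>c. c \<le> k) w') = \<Lambda> k"
    proof (intro allI impI)
      fix k assume "k \<le> l"
      then have "filter (\<lambda>c. c \<le> k) w' = filter (\<lambda>c. c \<le> k) w"
        by (auto simp: w'_def intro!: filter_cong)
      then show "length (filter (\<lambda>c. c \<le> k) w') = \<Lambda> k" using w(2) \<open>k \<le> l\<close> by simp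
    qed
    have sw': "set w' \<subseteq> {1..l}" using w(1) by (auto simp: w'_def)
    have mt: "mset (tt l) = mset zs" using Suc.prems(5)[of l] by (simp add: zs_def m_def)
    have only: "lev l w ys ts P = 0" if "mset ts = mset zs" "ts \<noteq> zs \<or> w \<noteq> replicate m (Suc l) @ w'" for ts
    proof (rule ccontr)
      assume "lev l w ys ts P \<noteq> 0"
      moreover have "length ys - \<Lambda> l = m" using Suc.prems(2) by (simp add: m_def)
      ultimately show False
        using lev_nonzeroD[of l w ys ts P "\<Lambda> l"] that Suc.prems w lw lw' by (auto simp: w'_def zs_def)
    qed
    have "wsum tt (Suc l) w ys P = (\<Sum>ts\<in>{zs}. lev l w ys ts P * wsum tt l w' ts P)"
      unfolding wsum.simps mt w'_def[symmetric] using only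
      by (intro sum.mono_neutral_right finite_mset_eq) auto
    then have eq: "wsum tt (Suc l) w ys P = lev l w ys zs P * (if w' = wmin \<Lambda> l then K else 0)"
      using K(2)[OF P sw' cnt] by simp
    show ?thesis
    proof (cases "w = wmin \<Lambda> (Suc l)")
      case True
      then have "w' = wmin \<Lambda> l"
        using set_wmin[of \<Lambda> l] by (auto simp: w'_def intro!: filter_True)
      moreover have "lev l w ys zs P = C"
        using C(2)[OF P sw' _ lm] True ys len lw' \<open>w' = wmin \<Lambda> l\<close> by (simp add: m_def)
      ultimately show ?thesis using eq True by simp
    next
      case False
      then have "w' \<noteq> wmin \<Lambda> l \<or> w \<noteq> replicate m (Suc l) @ w'" by (auto simp: m_def)
      then show ?thesis using eq only[of zs] False by auto
    qed
  qed
  with K(1) C(1) show ?case by (intro exI[of _ "C * K"]) auto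
qed

end

text \<open>The required head is moved to the front by adjacent transpositions, then the tail is
  treated recursively. Each swap may assume the multiset of the initial list, which keeps the
  swapped entries distinct and generic.\<close>

lemma swap_induct_mset:
  assumes "mset xs = mset ys" "R xs"
    and "\<And>A x y B. mset (A @ x # y # B) = mset xs \<Longrightarrow> R (A @ x # y # B) \<Longrightarrow> R (A @ y # x # B)"
  shows "R ys"
  using assms
proof (induction ys arbitrary: xs R)
  case Nil
  then show ?case by simp
next
  case (Cons y ys)
  then have "y \<in> set xs" by (metis list.set_intros(1) mset_eq_setD)
  then obtain U V where xs: "xs = U @ y # V" by (meson split_list)
  have front: "R (U1 @ y # U2 @ V)" if "U = U1 @ U2" for U1 U2
    using that
  proof (induction U2 arbitrary: U1)
    case Nil
    then show ?case using Cons.prems(2) xs by simp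
  next
    case (Cons u U2)
    then have "R ((U1 @ [u]) @ y # U2 @ V)" by simp
    then have "R (U1 @ u # y # U2 @ V)" by simp
    moreover have "mset (U1 @ u # y # U2 @ V) = mset xs" using Cons.prems xs by simp
    ultimately show ?case using Cons.prems(1) \<open>\<And>A x y B. mset (A @ x # y # B) = mset xs \<Longrightarrow> R (A @ x # y # B) \<Longrightarrow> R (A @ y # x # B)\<close> by simp
  qed
  have "R (y # U @ V)" using front[of "[]" U] by simp
  show ?case
  proof (rule Cons.IH[of "U @ V" "\<lambda>zs. R (y # zs)"])
    show "mset (U @ V) = mset ys" using Cons.prems(1) xs by simp
    show "R (y # U @ V)" by fact
    fix A x z B
    assume "mset (A @ x # z # B) = mset (U @ V)" "R (y # A @ x # z # B)"
    then show "R (y # A @ z # x # B)" using Cons.prems(3)[of "y # A" x z B] xs by simp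
  qed
qed

lemma replicate_split2: "replicate (Suc (Suc (a + b))) x = replicate a x @ x # x # replicate b x"
  by (induction a) auto

section \<open>Support of the products of L-operators in the reference order\<close>

context theta_like
begin

lemma exchangedD:
  assumes "exchanged N i m v X' X" "A \<in> lwords N i" "B \<in> lwords N m" "b1 \<in> {1..N}" "b2 \<in> {1..N}" "generic N P"
  shows "f (h + v) * X' (A @ b1 # b2 # B) P = exch b1 b2 (fold dshift A P) v (\<lambda>e1 e2. X (A @ e1 # e2 # B) P)"
  using assms sum_rwt_out[OF assms(4,5), of v "fold dshift A P" "\<lambda>e1 e2. X (A @ e1 # e2 # B) P"]
  unfolding exchanged_def exch_def by simp

text \<open>The vector after k blocks of rows: block k applies L with indices k, k + 1 and row
  parameters \<open>rs k\<close>. The site parameters \<open>ys\<close> may be permuted while the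
  rows stay fixed.\<close>

primrec xst :: "nat \<Rightarrow> complex list \<Rightarrow> (nat \<Rightarrow> complex list) \<Rightarrow> nat \<Rightarrow> nat list \<Rightarrow> (nat \<Rightarrow> complex) \<Rightarrow> complex" where
  "xst N ys rs 0 = (\<lambda>\<beta> P. of_bool (\<beta> = replicate (length ys) 1))"
| "xst N ys rs (Suc k) = fold (lop N ys (Suc k) (Suc (Suc k))) (rs (Suc k)) (xst N ys rs k)"

lemma exchanged_fold_lop:
  assumes "k \<in> {1..N}" "l \<in> {1..N}" "exchanged N (length Y) (length ys) (y1 - y2) X' X"
  shows "exchanged N (length Y) (length ys) (y1 - y2)
    (fold (lop N (Y @ y2 # y1 # ys) k l) zs X') (fold (lop N (Y @ y1 # y2 # ys) k l) zs X)"
  using assms(3)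
proof (induction zs arbitrary: X X')
  case (Cons z zs)
  show ?case using Cons.IH[OF exchanged_lop[OF Cons.prems assms(1,2)]] by simp
qed simp

text \<open>On two letters 1 the R-matrix acts by \<open>f (h + v)\<close>, exactly the prefactor in
  \<open>exchanged\<close>, so the initial vector has the same form in every site order. Each row
  preserves the relation.\<close>

lemma xst_exchange:
  assumes "k < N"
  shows "exchanged N (length Y) (length ys) (y1 - y2)
    (xst N (Y @ y2 # y1 # ys) rs k) (xst N (Y @ y1 # y2 # ys) rs k)"
  using assms
proof (induction k)
  case 0
  show ?case
    unfolding exchanged_def
  proof (intro ballI allI impI)
    fix A B b1 b2 P
    assume ass: "A \<in> lwords N (length Y)" "B \<in> lwords N (length ys)" "b1 \<in> {1..N}" "b2 \<in> {1..N}"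
    have rep: "A @ e1 # e2 # B = replicate (Suc (Suc (length Y + length ys))) 1 \<longleftrightarrow>
        A = replicate (length Y) 1 \<and> e1 = 1 \<and> e2 = 1 \<and> B = replicate (length ys) 1" for e1 e2
      unfolding replicate_split2 using ass by (auto simp: lwords_def)
    have X0: "xst N (Y @ p # q # ys) rs 0 (A @ e1 # e2 # B) P =
        of_bool (A = replicate (length Y) 1 \<and> e1 = 1 \<and> e2 = 1 \<and> B = replicate (length ys) 1)" for p q e1 e2
      using rep[of e1 e2] by (simp del: replicate.simps One_nat_def)
    show "f (h + (y1 - y2)) * xst N (Y @ y2 # y1 # ys) rs 0 (A @ b1 # b2 # B) P =
        (\<Sum>e1\<in>{1..N}. \<Sum>e2\<in>{1..N}. rwt (y1 - y2) (fold dshift A P) b2 b1 e1 e2 *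
          xst N (Y @ y1 # y2 # ys) rs 0 (A @ e1 # e2 # B) P)"
      unfolding sum_rwt_out[OF ass(3,4)] X0 by auto
  qed
next
  case (Suc k)
  then show ?case by (simp add: exchanged_fold_lop)
qed

text \<open>The coefficient must not depend on \<open>P\<close>, since L-operators shift
  \<open>P\<close> and the final scalar is to be free of it.\<close>

definition is_multiple :: "nat \<Rightarrow> nat list \<Rightarrow> (nat list \<Rightarrow> (nat \<Rightarrow> complex) \<Rightarrow> complex) \<Rightarrow> bool" where
  "is_multiple N w X \<longleftrightarrow> (\<exists>K. \<forall>P. generic N P \<longrightarrow> (\<forall>\<beta>\<in>lwords N (length w). X \<beta> P = (if \<beta> = w then K else 0)))"

text \<open>Two equal letters form a one-dimensional weight space on which the exchange is
  multiplication by \<open>f (h + v)\<close>; hence the sites carrying them can be swapped without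
  changing the coefficient.\<close>

lemma is_multiple_exchange:
  assumes ex: "exchanged N (length A) (length B) v X' X" and v: "f (h + v) \<noteq> 0"
    and X: "is_multiple N (A @ b # b # B) X"
  shows "is_multiple N (A @ b # b # B) X'"
proof -
  obtain K where K: "\<And>P \<beta>. generic N P \<Longrightarrow> \<beta> \<in> lwords N (length (A @ b # b # B)) \<Longrightarrow> X \<beta> P = (if \<beta> = A @ b # b # B then K else 0)"
    using X unfolding is_multiple_def by blast
  have "X' \<beta> P = (if \<beta> = A @ b # b # B then K else 0)"
    if P: "generic N P" and \<beta>: "\<beta> \<in> lwords N (length (A @ b # b # B))" for P \<beta>
  proof -
    have "Suc (length A) < length \<beta>" using \<beta> by (simp add: lwords_def)
    then obtain A' b1 b2 B' where \<beta>e: "\<beta> = A' @ b1 # b2 # B'" "length A' = length A" by (rule list_split2)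
    then have mem: "A' \<in> lwords N (length A)" "B' \<in> lwords N (length B)" "b1 \<in> {1..N}" "b2 \<in> {1..N}"
      using \<beta> by (auto simp: lwords_def)
    have K': "X (A' @ e1 # e2 # B') P = (if A' @ e1 # e2 # B' = A @ b # b # B then K else 0)"
      if "{e1, e2} = {b1, b2}" for e1 e2
    proof (rule K[OF P])
      have "e1 \<in> {1..N}" "e2 \<in> {1..N}" using mem that by (auto simp: doubleton_eq_iff)
      then show "A' @ e1 # e2 # B' \<in> lwords N (length (A @ b # b # B))"
        using mem by (auto simp: lwords_def)
    qed
    have "f (h + v) * X' (A' @ b1 # b2 # B') P = f (h + v) * (if A' @ b1 # b2 # B' = A @ b # b # B then K else 0)"
      unfolding exchangedD[OF ex mem P] exch_def
      using K'[of b1 b2] K'[of b2 b1] \<beta>e(2) by (auto simp: insert_commute)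
    then show ?thesis using v \<beta>e by simp
  qed
  then show ?thesis unfolding is_multiple_def by blast
qed

text \<open>If auxiliary label and site label agree, the ice rule leaves only the diagonal entry,
  which is free of dynamical variables. The constant is the product of these entries.\<close>

lemma tmat_replicate:
  assumes "d \<in> {1..N}"
  shows "\<exists>K. \<forall>P ys \<alpha> \<beta> e. length \<beta> \<ge> length Y \<longrightarrow>
    tmat N z (Y @ ys) P (replicate (length Y) d @ \<alpha>) \<beta> d e =
    (if take (length Y) \<beta> = replicate (length Y) d
     then K * tmat N z ys (fold dshift (replicate (length Y) d) P) \<alpha> (drop (length Y) \<beta>) d e else 0)"
proof (induction Y)
  case Nil
  then show ?case by (intro exI[of _ 1]) auto
next
  case (Cons y Y)
  then obtain K where K: "\<And>P ys \<alpha> \<beta> e. length \<beta> \<ge> length Y \<Longrightarrow>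
    tmat N z (Y @ ys) P (replicate (length Y) d @ \<alpha>) \<beta> d e =
    (if take (length Y) \<beta> = replicate (length Y) d
     then K * tmat N z ys (fold dshift (replicate (length Y) d) P) \<alpha> (drop (length Y) \<beta>) d e else 0)"
    by blast
  show ?case
  proof (intro exI[of _ "f (h + (z - y)) * K"] allI impI)
    fix P ys \<alpha> e and \<beta> :: "nat list"
    assume len: "length (y # Y) \<le> length \<beta>"
    then obtain b \<beta>' where \<beta>: "\<beta> = b # \<beta>'" by (cases \<beta>) auto
    show "tmat N z ((y # Y) @ ys) P (replicate (length (y # Y)) d @ \<alpha>) \<beta> d e =
      (if take (length (y # Y)) \<beta> = replicate (length (y # Y)) d
       then f (h + (z - y)) * K * tmat N z ys (fold dshift (replicate (length (y # Y)) d) P) \<alpha> (drop (length (y # Y)) \<beta>) d e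
       else 0)"
      using len by (simp add: \<beta> sum_rwt_aux[OF assms assms, simplified] K)
  qed
qed

text \<open>By weight conservation a row cannot emit a label that is neither on its sites nor on its
  incoming edge.\<close>

lemma tmat_absent:
  assumes "d \<notin> set \<alpha>" "c \<noteq> d" "length \<alpha> = length ys"
  shows "tmat N z ys P \<alpha> \<beta> c d = 0"
  using assms
proof (induction ys arbitrary: P \<alpha> \<beta> c)
  case Nil
  then show ?case by simp
next
  case (Cons y ys)
  then obtain a \<alpha>' where \<alpha>: "\<alpha> = a # \<alpha>'" by (metis length_Suc_conv)
  have "rwt (z - y) P c' (hd \<beta>) c a * tmat N z ys (dshift (hd \<beta>) P) \<alpha>' (tl \<beta>) c' d = 0" for c'
  proof (cases "rwt (z - y) P c' (hd \<beta>) c a = 0")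
    case False
    then have "c' \<noteq> d" using rwt_nonzeroD Cons.prems \<alpha> by fastforce
    then show ?thesis using Cons.IH[of \<alpha>' c'] Cons.prems \<alpha> by simp
  qed simp
  then show ?case unfolding tmat.simps \<alpha> list.sel by (intro sum.neutral ballI) simp
qed

text \<open>If the row deposited \<open>c\<close> on a site, it could not recover \<open>c\<close>
  afterwards, by \<open>tmat_absent\<close>. So only diagonal entries contribute, and since
  \<open>c\<close> is the larger label their gauge factor is 1.\<close>

lemma tmat_below:
  assumes "c \<in> {1..N}" "set \<alpha> \<subseteq> {1..<c}" "length \<alpha> = length ys"
  shows "\<exists>K. \<forall>P \<beta>. length \<beta> = length ys \<longrightarrow> tmat N z ys P \<alpha> \<beta> c c = (if \<beta> = \<alpha> then K else 0)"
  using assms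
proof (induction ys arbitrary: \<alpha>)
  case Nil
  then show ?case by (intro exI[of _ 1]) auto
next
  case (Cons y ys)
  then obtain a \<alpha>' where \<alpha>: "\<alpha> = a # \<alpha>'" by (metis length_Suc_conv)
  obtain K where K: "\<And>P \<beta>. length \<beta> = length ys \<Longrightarrow> tmat N z ys P \<alpha>' \<beta> c c = (if \<beta> = \<alpha>' then K else 0)"
    using Cons.IH[of \<alpha>'] Cons.prems \<alpha> by auto
  have a: "a \<in> {1..N}" "a < c" using Cons.prems \<alpha> by auto
  have absent: "tmat N z ys P \<alpha>' \<beta> a c = 0" for P \<beta>
    using Cons.prems \<alpha> by (intro tmat_absent) auto
  show ?case
  proof (intro exI[of _ "f (z - y) * K"] allI impI)
    fix P and \<beta> :: "nat list"
    assume "length \<beta> = length (y # ys)"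
    then obtain b \<beta>' where \<beta>: "\<beta> = b # \<beta>'" "length \<beta>' = length ys" by (metis length_Suc_conv)
    have "gauge c a P = 1" using a by (simp add: gauge_def)
    then show "tmat N z (y # ys) P \<alpha> \<beta> c c = (if \<beta> = \<alpha> then f (z - y) * K else 0)"
      using a Cons.prems(3) sum_rwt_aux[OF assms(1) a(1), of "z - y" P b "\<lambda>c'. tmat N z ys (dshift b P) \<alpha>' \<beta>' c' c"]
      by (auto simp: \<alpha> \<beta> K absent)
  qed
qed

text \<open>At the site whose parameter equals that of the row, the weight is that of a permutation.\<close>

lemma tmat_row:
  assumes "Suc c \<le> N" "1 \<le> c" "set w \<subseteq> {1..<c}" "length ys = b + length w"
  shows "\<exists>K. \<forall>P. generic N P \<longrightarrow> (\<forall>\<beta>. length \<beta> = length (Y @ z # ys) \<longrightarrow>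
    tmat N z (Y @ z # ys) P (replicate (length Y) (Suc c) @ c # replicate b c @ w) \<beta> (Suc c) c =
    (if \<beta> = replicate (length Y) (Suc c) @ Suc c # replicate b c @ w then K else 0))"
proof -
  have c: "c \<in> {1..N}" "Suc c \<in> {1..N}" using assms by auto
  obtain K1 where K1: "\<And>P ys \<alpha> \<beta> e. length \<beta> \<ge> length Y \<Longrightarrow>
    tmat N z (Y @ ys) P (replicate (length Y) (Suc c) @ \<alpha>) \<beta> (Suc c) e =
    (if take (length Y) \<beta> = replicate (length Y) (Suc c)
     then K1 * tmat N z ys (fold dshift (replicate (length Y) (Suc c)) P) \<alpha> (drop (length Y) \<beta>) (Suc c) e else 0)"
    using tmat_replicate[OF c(2), of Y z] by blast
  define V V' where "V = take b ys" and "V' = drop b ys"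
  have ys: "ys = V @ V'" and lV: "length V = b" "length V' = length w" using assms(4) by (simp_all add: V_def V'_def)
  obtain K2 where K2: "\<And>P ys \<alpha> \<beta> e. length \<beta> \<ge> length V \<Longrightarrow>
    tmat N z (V @ ys) P (replicate (length V) c @ \<alpha>) \<beta> c e =
    (if take (length V) \<beta> = replicate (length V) c
     then K2 * tmat N z ys (fold dshift (replicate (length V) c) P) \<alpha> (drop (length V) \<beta>) c e else 0)"
    using tmat_replicate[OF c(1), of V z] by blast
  obtain K3 where K3: "\<And>P \<beta>. length \<beta> = length V' \<Longrightarrow> tmat N z V' P w \<beta> c c = (if \<beta> = w then K3 else 0)"
    using tmat_below[OF c(1) assms(3) lV(2)[symmetric]] by blast
  show ?thesis
  \<comment> \<open>The factors come from the sites already raised, from the matched site, from the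
    sites still carrying c and from the smaller letters. At the matched site the diagonal entry
    contains \<open>f 0 = 0\<close>, and the off-diagonal one reduces to \<open>f h\<close>.\<close>
  proof (intro exI[of _ "K1 * (f h * (K2 * K3))"] allI impI)
    fix P and \<beta> :: "nat list"
    assume P: "generic N P" and len: "length \<beta> = length (Y @ z # ys)"
    define \<beta>1 where "\<beta>1 = take (length Y) \<beta>"
    have "drop (length Y) \<beta> \<noteq> []" using len by auto
    then obtain x \<beta>2 where d: "drop (length Y) \<beta> = x # \<beta>2" by (cases "drop (length Y) \<beta>") auto
    have \<beta>: "\<beta> = \<beta>1 @ x # \<beta>2" using append_take_drop_id[of "length Y" \<beta>] d by (simp add: \<beta>1_def)
    have l1: "length \<beta>1 = length Y" using len by (simp add: \<beta>1_def)
    have l2: "length \<beta>2 = b + length w" using len \<beta> l1 assms(4) by simp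
    define Q where "Q = fold dshift (replicate (length Y) (Suc c)) P"
    have "generic N Q" unfolding Q_def using P by (rule generic_fold_dshift)
    then have "f (h * dgap Q c (Suc c)) \<noteq> 0" using c by (intro genericD(1)) auto
    then have cw0: "cw c (Suc c) Q 0 = f h" by (simp add: cw_def)
    have "tmat N z (z # ys) Q (c # replicate b c @ w) (x # \<beta>2) (Suc c) c =
        (if x = Suc c then f h * tmat N z ys (dshift x Q) (replicate b c @ w) \<beta>2 c c else 0)"
      using sum_rwt_aux[OF c(2,1), of 0 Q x "\<lambda>c'. tmat N z ys (dshift x Q) (replicate b c @ w) \<beta>2 c' c"]
      by (auto simp: cw0)
    moreover have "tmat N z ys (dshift x Q) (replicate b c @ w) \<beta>2 c c =
        (if \<beta>2 = replicate b c @ w then K2 * K3 else 0)"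
    proof -
      have "\<beta>2 = replicate b c @ w \<longleftrightarrow> take b \<beta>2 = replicate b c \<and> drop b \<beta>2 = w"
        using l2 by (metis append_eq_conv_conj length_replicate append_take_drop_id)
      then show ?thesis
        using K2[of \<beta>2 V' "dshift x Q" w c] K3 l2 lV by (auto simp: ys)
    qed
    ultimately show "tmat N z (Y @ z # ys) P (replicate (length Y) (Suc c) @ c # replicate b c @ w) \<beta> (Suc c) c =
        (if \<beta> = replicate (length Y) (Suc c) @ Suc c # replicate b c @ w then K1 * (f h * (K2 * K3)) else 0)"
      using K1[of \<beta> "z # ys" P "c # replicate b c @ w" c] l1 len d
      by (auto simp: \<beta> Q_def simp del: tmat.simps)
  qed
qed

lemma is_multiple_row:
  assumes "Suc c \<le> N" "1 \<le> c" "set w \<subseteq> {1..<c}" "length ys = b + length w"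
    and "is_multiple N (replicate (length Y) (Suc c) @ c # replicate b c @ w) X"
  shows "is_multiple N (replicate (length Y) (Suc c) @ Suc c # replicate b c @ w)
    (lop N (Y @ z # ys) c (Suc c) z X)"
proof -
  let ?u = "replicate (length Y) (Suc c) @ c # replicate b c @ w"
  have lu: "length ?u = length (Y @ z # ys)" using assms(4) by simp
  have u: "?u \<in> lwords N (length (Y @ z # ys))" using lu assms(1-3) by (auto simp: lwords_def)
  obtain K where K: "\<And>P \<beta>. generic N P \<Longrightarrow> \<beta> \<in> lwords N (length (Y @ z # ys)) \<Longrightarrow> X \<beta> P = (if \<beta> = ?u then K else 0)"
    using assms(5) unfolding is_multiple_def lu by blast
  obtain K' where K': "\<And>P \<beta>. generic N P \<Longrightarrow> length \<beta> = length (Y @ z # ys) \<Longrightarrow>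
    tmat N z (Y @ z # ys) P ?u \<beta> (Suc c) c =
    (if \<beta> = replicate (length Y) (Suc c) @ Suc c # replicate b c @ w then K' else 0)"
    using tmat_row[OF assms(1-4), of Y z] by blast
  have "lop N (Y @ z # ys) c (Suc c) z X \<beta> P = (if \<beta> = replicate (length Y) (Suc c) @ Suc c # replicate b c @ w then K * K' else 0)"
    if "generic N P" "\<beta> \<in> lwords N (length (Y @ z # ys))" for P \<beta>
  proof -
    have "lop N (Y @ z # ys) c (Suc c) z X \<beta> P =
        (\<Sum>\<alpha>\<in>{?u}. X \<alpha> (dshift (Suc c) P) * tmat N z (Y @ z # ys) P \<alpha> \<beta> (Suc c) c)"
      unfolding lop_def using u K that by (intro sum.mono_neutral_right) auto
    then show ?thesis using K[OF generic_dshift[OF that(1)] u] K'[OF that(1), of \<beta>] that(2)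
      by (simp add: lwords_def del: tmat.simps)
  qed
  moreover have "length (replicate (length Y) (Suc c) @ Suc c # replicate b c @ w) = length (Y @ z # ys)"
    using assms(4) by simp
  ultimately show ?thesis unfolding is_multiple_def by metis
qed

text \<open>Here the sites are listed in the order of the rows. Row j finds the first j sites
  already raised to \<open>Suc c\<close> and raises exactly the next one, whose parameter is its
  own.\<close>

lemma is_multiple_rows:
  assumes "Suc c \<le> N" "1 \<le> c" "set w \<subseteq> {1..<c}" "length r + length rest = L + length w" "length r \<le> L"
    and "is_multiple N (replicate L c @ w) X" "j \<le> length r"
  shows "is_multiple N (replicate j (Suc c) @ replicate (L - j) c @ w)
    (fold (lop N (r @ rest) c (Suc c)) (take j r) X)"
  using assms(7)
proof (induction j)
  case 0
  then show ?case using assms(6) by simp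
next
  case (Suc j)
  define Y z ys where "Y = take j r" and "z = r ! j" and "ys = drop (Suc j) r @ rest"
  have split: "r @ rest = Y @ z # ys" using Suc.prems by (simp add: Y_def z_def ys_def Cons_nth_drop_Suc)
  have lY: "length Y = j" using Suc.prems by (simp add: Y_def)
  have L: "L - j = Suc (L - Suc j)" using Suc.prems assms(5) by simp
  have "is_multiple N (replicate (length Y) (Suc c) @ c # replicate (L - Suc j) c @ w)
      (fold (lop N (r @ rest) c (Suc c)) (take j r) X)"
    using Suc by (simp add: lY L)
  then have "is_multiple N (replicate (length Y) (Suc c) @ Suc c # replicate (L - Suc j) c @ w)
      (lop N (Y @ z # ys) c (Suc c) z (fold (lop N (r @ rest) c (Suc c)) (take j r) X))"
    using assms Suc.prems by (intro is_multiple_row) (auto simp: ys_def)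
  moreover have "take (Suc j) r = take j r @ [z]" using Suc.prems by (simp add: z_def take_Suc_conv_app_nth)
  ultimately show ?case by (simp add: split lY replicate_app_Cons_same)
qed

text \<open>The rows of a block agree with the first sites only as multisets. The generality in
  \<open>ys\<close> lets the induction hypothesis be applied to the site order adapted to the next
  block.\<close>

lemma xst_wmin:
  assumes U: "gen_set U" and \<Lambda>: "mono \<Lambda>" "\<Lambda> 0 = 0"
    and "k < N" "\<Lambda> k \<le> n" "length ys = n" "set ys \<subseteq> U"
    and "\<And>j. j \<in> {1..k} \<Longrightarrow> mset (rs j) = mset (take (n - \<Lambda> j) ys)"
  shows "is_multiple N (replicate (n - \<Lambda> k) (Suc k) @ wmin \<Lambda> k) (xst N ys rs k)"
  using assms(4-)
proof (induction k arbitrary: ys)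
  case 0
  then show ?case unfolding is_multiple_def using \<Lambda>(2) by (intro exI[of _ 1]) auto
next
  case (Suc k)
  have mono: "\<Lambda> i \<le> \<Lambda> j" if "i \<le> j" for i j using \<Lambda>(1) that by (simp add: monoD)
  define M where "M = n - \<Lambda> (Suc k)"
  define r rest where "r = rs (Suc k)" and "rest = drop M ys"
  have mr: "mset r = mset (take M ys)" using Suc.prems(5)[of "Suc k"] by (simp add: r_def M_def)
  have lr: "length r = M" using mset_eq_length[OF mr] Suc.prems(3) by (simp add: M_def)
  define w0 where "w0 = replicate M (Suc (Suc k)) @ replicate (n - \<Lambda> k - M) (Suc k) @ wmin \<Lambda> k"
  have w0: "w0 = replicate (n - \<Lambda> (Suc k)) (Suc (Suc k)) @ wmin \<Lambda> (Suc k)"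
    using mono[of k "Suc k"] Suc.prems(2) by (simp add: w0_def M_def)
  have lw0: "length w0 = n" using length_wmin[OF \<Lambda>] Suc.prems(2) mono[of k "Suc k"] by (simp add: w0)
  \<comment> \<open>The first M sites are put in the order of the rows of the next block. The
    multisets attached to the earlier blocks are unchanged, since their prefixes contain these M
    sites.\<close>
  have "is_multiple N (replicate (n - \<Lambda> k) (Suc k) @ wmin \<Lambda> k) (xst N (r @ rest) rs k)"
  proof (rule Suc.IH)
    have "set r \<subseteq> U" using mr Suc.prems(4) by (metis mset_eq_setD in_set_takeD subset_iff)
    then show "set (r @ rest) \<subseteq> U" using Suc.prems(4) by (auto simp: rest_def dest: in_set_dropD)
    show "length (r @ rest) = n" using Suc.prems(3) by (simp add: lr rest_def M_def)
    fix j assume j: "j \<in> {1..k}"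
    then have le: "M \<le> n - \<Lambda> j" using mono[of j "Suc k"] by (simp add: M_def)
    have "take (n - \<Lambda> j) (r @ rest) = r @ take (n - \<Lambda> j - M) (drop M ys)"
      using le by (simp add: lr rest_def)
    moreover have "take (n - \<Lambda> j) ys = take M ys @ take (n - \<Lambda> j - M) (drop M ys)"
      using take_add[of M "n - \<Lambda> j - M" ys] by (simp only: le_add_diff_inverse[OF le])
    ultimately show "mset (rs j) = mset (take (n - \<Lambda> j) (r @ rest))"
      using Suc.prems(5)[of j] j mr by simp
  qed (use Suc.prems mono[of k "Suc k"] in auto)
  then have "is_multiple N w0 (fold (lop N (r @ rest) (Suc k) (Suc (Suc k))) (take M r) (xst N (r @ rest) rs k))"
    unfolding w0_def using set_wmin[of \<Lambda> k] Suc.prems lr mono[of k "Suc k"] length_wmin[OF \<Lambda>]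
    by (intro is_multiple_rows) (auto simp: M_def rest_def)
  then have "is_multiple N w0 (xst N (r @ rest) rs (Suc k))" using lr by (simp add: r_def)
  \<comment> \<open>Back to the original order. All transpositions stay within the first M sites,
    which now carry the same letter.\<close>
  then have "is_multiple N w0 (xst N (take M ys @ rest) rs (Suc k))"
  proof (rule swap_induct_mset[OF mr, where R = "\<lambda>r. is_multiple N w0 (xst N (r @ rest) rs (Suc k))"])
    fix A x y B
    assume ms: "mset (A @ x # y # B) = mset r" and mult: "is_multiple N w0 (xst N ((A @ x # y # B) @ rest) rs (Suc k))"
    have MAB: "M = length A + 2 + length B" using mset_eq_length[OF ms] lr by simp
    then have "replicate M (Suc (Suc k)) = replicate (length A) (Suc (Suc k)) @ Suc (Suc k) # Suc (Suc k) # replicate (length B) (Suc (Suc k))"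
      using replicate_split2[of "length A" "length B"] by simp
    then obtain w1 w2 b where w: "w0 = w1 @ b # b # w2" "length w1 = length A"
      by (simp add: w0_def)
    have "length w2 = length (B @ rest)" using lw0 w MAB Suc.prems(3) by (simp add: rest_def M_def)
    moreover have "x \<in> U" "y \<in> U"
      using mset_eq_setD[OF ms] mset_eq_setD[OF mr] Suc.prems(4) by (auto dest: in_set_takeD)
    ultimately have nz: "f (h + (x - y)) \<noteq> 0" and l2: "length w2 = length (B @ rest)"
      using gen_setD(1)[OF U] by auto
    have ex: "exchanged N (length w1) (length w2) (x - y)
        (xst N (A @ y # x # (B @ rest)) rs (Suc k)) (xst N (A @ x # y # (B @ rest)) rs (Suc k))"
      unfolding w(2) l2 by (rule xst_exchange[OF Suc.prems(1)])
    have mu: "is_multiple N (w1 @ b # b # w2) (xst N (A @ x # y # (B @ rest)) rs (Suc k))"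
      using mult unfolding w(1)[symmetric] append_assoc append_Cons .
    from is_multiple_exchange[OF ex nz mu] show "is_multiple N w0 (xst N ((A @ y # x # B) @ rest) rs (Suc k))"
      unfolding w(1) append_assoc append_Cons .
  qed
  then show ?case by (simp add: w0 rest_def)
qed

end

lemma filter_wmin: "k \<le> l \<Longrightarrow> filter (\<lambda>c. c \<le> k) (wmin \<Lambda> l) = wmin \<Lambda> k"
proof (induction l)
  case (Suc l)
  show ?case
  proof (cases "k = Suc l")
    case True
    then show ?thesis using set_wmin[of \<Lambda> "Suc l"] by (auto simp: filter_id_conv simp del: wmin.simps)
  qed (use Suc in simp)
qed simp

context theta_like
begin

text \<open>\<open>ys0\<close> is the reference order of the sites and \<open>ys\<close> the given
  one; the row lists and the level variables are fixed throughout. Words of the wrong content are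
  included, with value 0.\<close>

lemma xst_proportional_wsum:
  assumes U: "gen_set U" and \<Lambda>: "mono \<Lambda>" "\<Lambda> 0 = 0" "\<Lambda> N = n" and "N \<ge> 1"
    and ys: "set ys \<subseteq> U" "distinct ys" "length ys = n" and ys0: "mset ys0 = mset ys"
    and tt: "\<And>k. k < N \<Longrightarrow> mset (tt k) = mset (drop (n - \<Lambda> k) ys0)"
    and rs: "\<And>j. j \<in> {1..<N} \<Longrightarrow> mset (rs j) = mset (take (n - \<Lambda> j) ys0)"
  shows "\<exists>c. \<forall>P. generic N P \<longrightarrow> (\<forall>\<beta>\<in>lwords N n. xst N ys rs (N - 1) \<beta> P =
    c * (if \<forall>k\<le>N. length (filter (\<lambda>c. c \<le> k) \<beta>) = \<Lambda> k then wsum tt N \<beta> ys P else 0))"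
proof -
  define good where "good \<beta> \<longleftrightarrow> (\<forall>k\<le>N. length (filter (\<lambda>c. c \<le> k) \<beta>) = \<Lambda> k)" for \<beta>
  define R where "R zs \<longleftrightarrow> (\<exists>c. \<forall>P. generic N P \<longrightarrow> (\<forall>\<beta>\<in>lwords N n.
    xst N zs rs (N - 1) \<beta> P = c * (if good \<beta> then wsum tt N \<beta> zs P else 0)))" for zs
  have mono: "\<Lambda> i \<le> \<Lambda> j" if "i \<le> j" for i j using \<Lambda>(1) that by (simp add: monoD)
  have ys0': "set ys0 \<subseteq> U" "distinct ys0" "length ys0 = n"
    using ys ys0 mset_eq_setD mset_eq_imp_distinct_iff mset_eq_length by metis+
  obtain M where N: "N = Suc M" using \<open>N \<ge> 1\<close> by (cases N) auto
  have ttU: "set (tt k) \<subseteq> U \<and> distinct (tt k) \<and> length (tt k) = \<Lambda> k" if "k < N" for k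
  proof -
    have "set (tt k) = set (drop (n - \<Lambda> k) ys0)" using tt[OF that] by (rule mset_eq_setD)
    moreover have "distinct (tt k)" using tt[OF that] mset_eq_imp_distinct_iff ys0'(2) distinct_drop by metis
    moreover have "length (tt k) = \<Lambda> k"
      using mset_eq_length[OF tt[OF that]] ys0'(3) mono[of k N] that \<Lambda>(3) by simp
    ultimately show ?thesis using ys0'(1) by (auto dest: in_set_dropD)
  qed
  have "R ys0"
  proof -
    have "is_multiple N (replicate (n - \<Lambda> M) (Suc M) @ wmin \<Lambda> M) (xst N ys0 rs M)"
      using mono[of M N] ys0' rs \<Lambda>(3) by (intro xst_wmin[OF U \<Lambda>(1,2)]) (auto simp: N)
    moreover have "replicate (n - \<Lambda> M) (Suc M) @ wmin \<Lambda> M = wmin \<Lambda> N"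
      using \<Lambda>(3) by (simp add: N)
    moreover have "length (wmin \<Lambda> N) = n" using length_wmin[OF \<Lambda>(1,2)] \<Lambda>(3) by simp
    ultimately obtain K where K: "\<And>P \<beta>. generic N P \<Longrightarrow> \<beta> \<in> lwords N n \<Longrightarrow>
        xst N ys0 rs (N - 1) \<beta> P = (if \<beta> = wmin \<Lambda> N then K else 0)"
      unfolding is_multiple_def by (auto simp: N)
    have "length ys0 = \<Lambda> N" "\<And>k. k < N \<Longrightarrow> mset (tt k) = mset (drop (\<Lambda> N - \<Lambda> k) ys0)"
      using ys0'(3) \<Lambda>(3) tt by simp_all
    note len_tt = this
    have "\<exists>K'. K' \<noteq> 0 \<and> (\<forall>P w. generic N P \<longrightarrow> set w \<subseteq> {1..N} \<longrightarrow> good w \<longrightarrow>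
        wsum tt N w ys0 P = (if w = wmin \<Lambda> N then K' else 0))"
      unfolding good_def
      by (rule wsum_wmin[OF U \<Lambda>(1,2) order_refl len_tt(1) ys0'(2,1)]) (rule len_tt(2))
    then obtain K' where K': "K' \<noteq> 0" "\<And>P w. generic N P \<Longrightarrow> set w \<subseteq> {1..N} \<Longrightarrow> good w \<Longrightarrow>
        wsum tt N w ys0 P = (if w = wmin \<Lambda> N then K' else 0)"
      by auto
    have "good (wmin \<Lambda> N)"
      unfolding good_def using filter_wmin length_wmin[OF \<Lambda>(1,2)] by simp
    then show ?thesis
      \<comment> \<open>The constant is the quotient of the two values at the reference word;
        \<open>K'\<close> is nonzero.\<close>
      unfolding R_def using K K' by (intro exI[of _ "K / K'"]) (auto simp: lwords_def)
  qed
  have "R ys"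
  proof (rule swap_induct_mset[where R = R, OF ys0 \<open>R ys0\<close>])
    fix A x y B
    assume ms: "mset (A @ x # y # B) = mset ys0" and "R (A @ x # y # B)"
    then obtain c where c: "\<And>P \<beta>. generic N P \<Longrightarrow> \<beta> \<in> lwords N n \<Longrightarrow>
        xst N (A @ x # y # B) rs M \<beta> P = c * (if good \<beta> then wsum tt N \<beta> (A @ x # y # B) P else 0)"
      unfolding R_def N by auto
    have xy: "x \<in> U" "y \<in> U" "x \<noteq> y"
      using mset_eq_setD[OF ms] ys0' mset_eq_imp_distinct_iff[OF ms] by auto
    have n: "n = length A + 2 + length B" using mset_eq_length[OF ms] ys0'(3) by simp
    have "xst N (A @ y # x # B) rs M \<beta> P = c * (if good \<beta> then wsum tt N \<beta> (A @ y # x # B) P else 0)"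
      if P: "generic N P" and \<beta>: "\<beta> \<in> lwords N n" for P \<beta>
    proof -
      have "Suc (length A) < length \<beta>" using \<beta> n by (simp add: lwords_def)
      then obtain A' b1 b2 B' where \<beta>e: "\<beta> = A' @ b1 # b2 # B'" "length A' = length A" by (rule list_split2)
      then have mem: "A' \<in> lwords N (length A)" "B' \<in> lwords N (length B)" "b1 \<in> {1..N}" "b2 \<in> {1..N}"
        using \<beta> n by (auto simp: lwords_def)
      \<comment> \<open>Interchanging letters preserves the content, so an exchange never mixes
        words of right and wrong content.\<close>
      have goods: "good (A' @ e1 # e2 # B') \<longleftrightarrow> good \<beta>" "A' @ e1 # e2 # B' \<in> lwords N n"
        if "(e1, e2) \<in> {(b1, b2), (b2, b1), (b1, b1)}" "e1 = e2 \<longrightarrow> b1 = b2" for e1 e2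
        using that \<beta> by (auto simp: good_def \<beta>e lwords_def)
      let ?Q = "fold dshift A' P"
      have "f (h + (x - y)) * xst N (A @ y # x # B) rs M \<beta> P =
          exch b1 b2 ?Q (x - y) (\<lambda>e1 e2. xst N (A @ x # y # B) rs M (A' @ e1 # e2 # B') P)"
        unfolding \<beta>e by (rule exchangedD[OF xst_exchange mem P]) (simp add: N)
      also have "\<dots> = exch b1 b2 ?Q (x - y) (\<lambda>e1 e2. c * (if good \<beta> then wsum tt N (A' @ e1 # e2 # B') (A @ x # y # B) P else 0))"
        using c[OF P] goods unfolding exch_def by auto
      also have "\<dots> = c * (if good \<beta> then exch b1 b2 ?Q (x - y) (\<lambda>e1 e2. wsum tt N (A' @ e1 # e2 # B') (A @ x # y # B) P) else 0)"
        unfolding exch_mult by (simp add: exch_def)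
      also have "\<dots> = c * (if good \<beta> then f (h + (x - y)) * wsum tt N \<beta> (A @ y # x # B) P else 0)"
      proof (cases "good \<beta>")
        case True
        have "f (h + (x - y)) * wsum tt N (A' @ b1 # b2 # B') (A @ y # x # B) P =
            exch b1 b2 ?Q (x - y) (\<lambda>e1 e2. wsum tt N (A' @ e1 # e2 # B') (A @ x # y # B) P)"
        proof (rule wsum_exchange[OF U P order_refl])
          show "set (A' @ b1 # b2 # B') \<subseteq> {1..N}" using \<beta> by (simp add: \<beta>e lwords_def)
          show "length (tt k) = length (filter (\<lambda>c. c \<le> k) (A' @ b1 # b2 # B'))" if "k < N" for k
            using True ttU[OF that] that by (simp add: good_def \<beta>e)
        qed (use xy \<beta>e ttU in auto)
        then show ?thesis by (simp add: \<beta>e)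
      qed simp
      finally have "f (h + (x - y)) * xst N (A @ y # x # B) rs M \<beta> P =
          f (h + (x - y)) * (c * (if good \<beta> then wsum tt N \<beta> (A @ y # x # B) P else 0))"
        by simp
      then show ?thesis using gen_setD(1)[OF U xy(1,2)] by simp
    qed
    then show "R (A @ y # x # B)" unfolding R_def N by auto
  qed
  then show ?thesis unfolding R_def good_def .
qed

end

subsection \<open>Words as lists\<close>

lemma log_Pi_dgap: "log_Pi \<eta> P j k = 2 * \<eta> * dgap P j k"
  by (simp add: log_Pi_def dgap_def)

lemma dshifts_insert: "finite A \<Longrightarrow> a \<notin> A \<Longrightarrow> dshifts (insert a A) \<mu> P = dshift (\<mu> a) (dshifts A \<mu> P)"
  by (auto simp: dshifts_def dshift_def fun_eq_iff)

lemma dshifts_fold: "dshifts {1..<Suc m} \<mu> P = fold dshift (map \<mu> [1..<Suc m]) P"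
proof (induction m)
  case 0
  then show ?case by (simp add: dshifts_def)
next
  case (Suc m)
  have "{1..<Suc (Suc m)} = insert (Suc m) {1..<Suc m}" by auto
  then show ?case using Suc by (simp add: dshifts_insert)
qed

definition word_list :: "nat \<Rightarrow> (nat \<Rightarrow> 'a) \<Rightarrow> 'a list" where
  "word_list n \<mu> = map \<mu> [1..<Suc n]"

lemma length_word_list [simp]: "length (word_list n \<mu>) = n"
  by (simp add: word_list_def)

lemma word_list_Suc: "word_list (Suc n) \<mu> = word_list n \<mu> @ [\<mu> (Suc n)]"
  by (simp add: word_list_def)

lemma word_list_cong: "(\<And>i. i \<in> {1..n} \<Longrightarrow> \<mu> i = \<nu> i) \<Longrightarrow> word_list n \<mu> = word_list n \<nu>"
  by (auto simp: word_list_def)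

lemma bij_betw_word_list: "bij_betw (word_list n) (words N n) (lwords N n)"
proof (rule bij_betw_byWitness[where f' = "\<lambda>xs. \<lambda>i\<in>{1..n}. xs ! (i - 1)"])
  show "\<forall>\<mu>\<in>words N n. (\<lambda>i\<in>{1..n}. word_list n \<mu> ! (i - 1)) = \<mu>"
  proof
    fix \<mu> assume \<mu>: "\<mu> \<in> words N n"
    show "(\<lambda>i\<in>{1..n}. word_list n \<mu> ! (i - 1)) = \<mu>"
    proof (rule extensionalityI)
      show "\<mu> \<in> extensional {1..n}" using \<mu> by (simp add: words_def PiE_def)
      show "(\<lambda>i\<in>{1..n}. word_list n \<mu> ! (i - 1)) i = \<mu> i" if "i \<in> {1..n}" for i
        using that by (cases i) (simp_all add: word_list_def del: upt_Suc)
    qed (rule restrict_extensional)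
  qed
  show "\<forall>xs\<in>lwords N n. word_list n (\<lambda>i\<in>{1..n}. xs ! (i - 1)) = xs"
    by (auto simp: lwords_def word_list_def intro!: nth_equalityI simp del: upt_Suc)
  show "word_list n ` words N n \<subseteq> lwords N n"
    by (force simp: words_def lwords_def word_list_def)
  show "(\<lambda>xs. \<lambda>i\<in>{1..n}. xs ! (i - 1)) ` lwords N n \<subseteq> words N n"
  proof safe
    fix xs assume xs: "xs \<in> lwords N n"
    have "xs ! (i - 1) \<in> {1..N}" if "i \<in> {1..n}" for i
    proof -
      have "xs ! (i - 1) \<in> set xs" using that xs by (intro nth_mem) (auto simp: lwords_def)
      then show ?thesis using xs by (auto simp: lwords_def)
    qed
    then show "(\<lambda>i\<in>{1..n}. xs ! (i - 1)) \<in> words N n" by (auto simp: words_def)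
  qed
qed

lemma finite_words: "finite (words N n)"
  by (simp add: words_def finite_PiE)

locale theta_model = theta_like "theta p" "2 * \<eta>" for p \<eta> :: complex
begin

text \<open>In the double sum over j < k only the pair formed by the two outgoing labels can
  contribute.\<close>

lemma Rmat_rwt:
  assumes "b \<in> {1..N}" "\<beta> \<in> {1..N}" "c \<in> {1..N}" "\<gamma> \<in> {1..N}"
  shows "Rmat p \<eta> N z P b \<beta> c \<gamma> = rwt z P b \<beta> c \<gamma>"
proof -
  define F where "F = (\<lambda>j k. let x = log_Pi \<eta> P j k in
           theta p (2 * \<eta> + x) * theta p (- 2 * \<eta> + x) * theta p z / (theta p x)\<^sup>2
             * (Emat j j b c * Emat k k \<beta> \<gamma>)
         + theta p z * (Emat k k b c * Emat j j \<beta> \<gamma>)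
         + theta p (2 * \<eta>) * theta p (z + x) / theta p x
             * (Emat j k b c * Emat k j \<beta> \<gamma>)
         + theta p (2 * \<eta>) * theta p (z - x) / theta p (- x)
             * (Emat k j b c * Emat j k \<beta> \<gamma>))"
  have Fz: "F j k = 0" if "j < k" "(j, k) \<noteq> (b, \<beta>)" "(j, k) \<noteq> (\<beta>, b)" for j k
    using that by (auto simp: F_def Let_def Emat_def)
  have diag: "(\<Sum>j\<in>{1..N}. theta p (2 * \<eta> + z) * (Emat j j b c * Emat j j \<beta> \<gamma>)) =
      (if b = c \<and> \<beta> = \<gamma> \<and> b = \<beta> then theta p (2 * \<eta> + z) else 0)"
  proof -
    have "(\<Sum>j\<in>{1..N}. theta p (2 * \<eta> + z) * (Emat j j b c * Emat j j \<beta> \<gamma>)) =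
        (\<Sum>j\<in>{1..N}. if j = b then (if b = c \<and> \<beta> = \<gamma> \<and> b = \<beta> then theta p (2 * \<eta> + z) else 0) else 0)"
      by (intro sum.cong refl) (auto simp: Emat_def)
    then show ?thesis using assms by simp
  qed
  have off: "(\<Sum>j\<in>{1..N}. \<Sum>k\<in>{j<..N}. F j k) = (if b = \<beta> then 0 else F (min b \<beta>) (max b \<beta>))"
  proof -
    have "(\<Sum>j\<in>{1..N}. \<Sum>k\<in>{j<..N}. F j k) = (\<Sum>(j, k)\<in>(SIGMA j:{1..N}. {j<..N}). F j k)"
      by (simp add: sum.Sigma)
    also have "\<dots> = (\<Sum>(j, k)\<in>(if b = \<beta> then {} else {(min b \<beta>, max b \<beta>)}). F j k)"
    proof (rule sum.mono_neutral_right)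
      show "(if b = \<beta> then {} else {(min b \<beta>, max b \<beta>)}) \<subseteq> (SIGMA j:{1..N}. {j<..N})"
        using assms by auto
      show "\<forall>i\<in>(SIGMA j:{1..N}. {j<..N}) - (if b = \<beta> then {} else {(min b \<beta>, max b \<beta>)}). (case i of (j, k) \<Rightarrow> F j k) = 0"
        by (auto intro!: Fz split: if_splits simp: min_def max_def)
    qed auto
    finally show ?thesis by simp
  qed
  have Rm: "Rmat p \<eta> N z P b \<beta> c \<gamma> = (if b = c \<and> \<beta> = \<gamma> \<and> b = \<beta> then theta p (2 * \<eta> + z) else 0) +
      (if b = \<beta> then 0 else F (min b \<beta>) (max b \<beta>))"
    using diag off unfolding Rmat_def F_def by simp
  have neg: "dgap P j k = - dgap P k j" for j k by (simp add: dgap_def)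
  consider "b = \<beta>" | "b < \<beta>" | "\<beta> < b" by linarith
  then show ?thesis
  proof cases
    case 1
    then show ?thesis unfolding Rm rwt_def by auto
  next
    case 2
    then show ?thesis unfolding Rm F_def Let_def Emat_def rwt_def gauge_def log_Pi_dgap
      by (auto simp: min_def max_def algebra_simps)
  next
    case 3
    then show ?thesis unfolding Rm F_def Let_def Emat_def rwt_def gauge_def log_Pi_dgap
      by (auto simp: min_def max_def neg[of \<beta> b] algebra_simps)
  qed
qed

text \<open>\<open>tmat\<close> peels off the first site and \<open>monodromy\<close> the last. This
  recursion at the last site connects them.\<close>

lemma tmat_snoc:
  assumes "c \<in> {1..N}" "d \<in> {1..N}" "length \<alpha> = length ys" "length \<beta> = length ys"
  shows "tmat N z (ys @ [y]) P (\<alpha> @ [a]) (\<beta> @ [b]) c d =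
    (\<Sum>c'\<in>{1..N}. rwt (z - y) (fold dshift \<beta> P) d b c' a * tmat N z ys P \<alpha> \<beta> c c')"
  using assms
proof (induction ys arbitrary: \<alpha> \<beta> c P)
  case Nil
  then show ?case by (simp add: sum.delta sum.delta' of_bool_def if_distrib cong: if_cong)
next
  case (Cons x ys)
  obtain a' \<alpha>' b' \<beta>' where ab: "\<alpha> = a' # \<alpha>'" "\<beta> = b' # \<beta>'" using Cons.prems by (metis length_Suc_conv)
  have "tmat N z ((x # ys) @ [y]) P (\<alpha> @ [a]) (\<beta> @ [b]) c d =
      (\<Sum>c'\<in>{1..N}. rwt (z - x) P c' b' c a' * (\<Sum>c''\<in>{1..N}. rwt (z - y) (fold dshift \<beta>' (dshift b' P)) d b c'' a *
        tmat N z ys (dshift b' P) \<alpha>' \<beta>' c' c''))"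
    using Cons.IH[of _ \<alpha>' \<beta>' "dshift b' P"] Cons.prems ab by (simp add: ab)
  also have "\<dots> = (\<Sum>c''\<in>{1..N}. rwt (z - y) (fold dshift \<beta>' (dshift b' P)) d b c'' a *
      (\<Sum>c'\<in>{1..N}. rwt (z - x) P c' b' c a' * tmat N z ys (dshift b' P) \<alpha>' \<beta>' c' c''))"
    using sum_pull1[where A = "{1..N}" and C = "{1..N}" and k = "\<lambda>c'. rwt (z - x) P c' b' c a'"
        and r = "\<lambda>c''. rwt (z - y) (fold dshift \<beta>' (dshift b' P)) d b c'' a" and t = "\<lambda>c' c''. tmat N z ys (dshift b' P) \<alpha>' \<beta>' c' c''"]
    by (simp only: mult.commute[of "rwt (z - y) _ _ _ _ _"])
  finally show ?case by (simp add: ab)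
qed

text \<open>The first m R-matrices leave the later sites alone, which accounts for the condition on
  \<alpha> and \<beta>; each inductive step has a unique possible intermediate word.\<close>

lemma monodromy_tmat:
  assumes "m \<le> n" "\<alpha> \<in> words N n" "\<beta> \<in> words N n" "l \<in> {1..N}" "k \<in> {1..N}"
  shows "monodromy p \<eta> N n u m z P (l, \<alpha>) (k, \<beta>) =
    (if \<forall>j\<in>{Suc m..n}. \<alpha> j = \<beta> j then tmat N z (word_list m u) P (word_list m \<alpha>) (word_list m \<beta>) l k else 0)"
  using assms(1,3,5)
proof (induction m arbitrary: \<beta> k)
  case 0
  have "\<alpha> = \<beta> \<longleftrightarrow> (\<forall>j\<in>{Suc 0..n}. \<alpha> j = \<beta> j)"
    using assms(2) 0 by (auto simp: words_def intro: PiE_ext)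
  then show ?case by (auto simp: word_list_def)
next
  case (Suc m)
  \<comment> \<open>Before the R-matrix at site m + 1 acts, the earlier sites have their final
    letters and this site still has its initial one.\<close>
  define \<gamma>0 where "\<gamma>0 = \<beta>(Suc m := \<alpha> (Suc m))"
  have \<gamma>0: "\<gamma>0 \<in> words N n"
    using assms(2) Suc.prems by (auto simp: \<gamma>0_def words_def PiE_iff extensional_def)
  have only: "\<gamma> = \<gamma>0" if "\<gamma> \<in> words N n" "\<forall>j\<in>{1..n} - {Suc m}. \<gamma> j = \<beta> j" "\<forall>j\<in>{Suc m..n}. \<alpha> j = \<gamma> j" for \<gamma>
  proof (rule PiE_ext)
    show "\<gamma> \<in> {1..n} \<rightarrow>\<^sub>E {1..N}" "\<gamma>0 \<in> {1..n} \<rightarrow>\<^sub>E {1..N}" using that(1) \<gamma>0 by (auto simp: words_def)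
    show "\<gamma> i = \<gamma>0 i" if "i \<in> {1..n}" for i
      using that \<open>\<forall>j\<in>{1..n} - {Suc m}. \<gamma> j = \<beta> j\<close> \<open>\<forall>j\<in>{Suc m..n}. \<alpha> j = \<gamma> j\<close> Suc.prems
      by (auto simp: \<gamma>0_def)
  qed
  have "monodromy p \<eta> N n u (Suc m) z P (l, \<alpha>) (k, \<beta>) =
      (\<Sum>c\<in>{1..N}. \<Sum>\<gamma>\<in>words N n. R0 p \<eta> N n u (Suc m) z P (c, \<gamma>) (k, \<beta>) * monodromy p \<eta> N n u m z P (l, \<alpha>) (c, \<gamma>))"
    by (simp add: sum.cartesian_product)
  also have "\<dots> = (\<Sum>c\<in>{1..N}. R0 p \<eta> N n u (Suc m) z P (c, \<gamma>0) (k, \<beta>) * monodromy p \<eta> N n u m z P (l, \<alpha>) (c, \<gamma>0))"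
  proof (rule sum.cong[OF refl])
    fix c assume c: "c \<in> {1..N}"
    have "R0 p \<eta> N n u (Suc m) z P (c, \<gamma>) (k, \<beta>) * monodromy p \<eta> N n u m z P (l, \<alpha>) (c, \<gamma>) = 0"
      if "\<gamma> \<in> words N n" "\<gamma> \<noteq> \<gamma>0" for \<gamma>
      using only[OF that(1)] that Suc.IH[OF _ that(1) c] Suc.prems(1) by (auto simp: R0_def)
    then have "(\<Sum>\<gamma>\<in>words N n. R0 p \<eta> N n u (Suc m) z P (c, \<gamma>) (k, \<beta>) * monodromy p \<eta> N n u m z P (l, \<alpha>) (c, \<gamma>)) =
        (\<Sum>\<gamma>\<in>{\<gamma>0}. R0 p \<eta> N n u (Suc m) z P (c, \<gamma>) (k, \<beta>) * monodromy p \<eta> N n u m z P (l, \<alpha>) (c, \<gamma>))"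
      using \<gamma>0 by (intro sum.mono_neutral_right finite_words) auto
    then show "(\<Sum>\<gamma>\<in>words N n. R0 p \<eta> N n u (Suc m) z P (c, \<gamma>) (k, \<beta>) * monodromy p \<eta> N n u m z P (l, \<alpha>) (c, \<gamma>)) =
        R0 p \<eta> N n u (Suc m) z P (c, \<gamma>0) (k, \<beta>) * monodromy p \<eta> N n u m z P (l, \<alpha>) (c, \<gamma>0)" by simp
  qed
  also have "\<dots> = (\<Sum>c\<in>{1..N}. rwt (z - u (Suc m)) (fold dshift (word_list m \<beta>) P) k (\<beta> (Suc m)) c (\<alpha> (Suc m)) *
      (if \<forall>j\<in>{Suc (Suc m)..n}. \<alpha> j = \<beta> j then tmat N z (word_list m u) P (word_list m \<alpha>) (word_list m \<beta>) l c else 0))"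
  proof (rule sum.cong[OF refl])
    fix c assume c: "c \<in> {1..N}"
    have wl: "word_list m \<gamma>0 = word_list m \<beta>" by (rule word_list_cong) (simp add: \<gamma>0_def)
    have mem: "\<beta> (Suc m) \<in> {1..N}" "\<alpha> (Suc m) \<in> {1..N}"
      using assms(2) Suc.prems by (auto simp: words_def)
    have "dshifts {1..<Suc m} \<gamma>0 P = fold dshift (word_list m \<gamma>0) P"
      unfolding word_list_def by (rule dshifts_fold)
    then have "R0 p \<eta> N n u (Suc m) z P (c, \<gamma>0) (k, \<beta>) =
        rwt (z - u (Suc m)) (fold dshift (word_list m \<beta>) P) k (\<beta> (Suc m)) c (\<alpha> (Suc m))"
      using mem Suc.prems c by (simp add: R0_def Rmat_rwt wl) (simp add: \<gamma>0_def Rmat_rwt)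
    moreover have "(\<forall>j\<in>{Suc m..n}. \<alpha> j = \<gamma>0 j) \<longleftrightarrow> (\<forall>j\<in>{Suc (Suc m)..n}. \<alpha> j = \<beta> j)"
      using Suc.prems(1) by (force simp: \<gamma>0_def Suc_le_eq)
    ultimately show "R0 p \<eta> N n u (Suc m) z P (c, \<gamma>0) (k, \<beta>) * monodromy p \<eta> N n u m z P (l, \<alpha>) (c, \<gamma>0) =
        rwt (z - u (Suc m)) (fold dshift (word_list m \<beta>) P) k (\<beta> (Suc m)) c (\<alpha> (Suc m)) *
        (if \<forall>j\<in>{Suc (Suc m)..n}. \<alpha> j = \<beta> j then tmat N z (word_list m u) P (word_list m \<alpha>) (word_list m \<beta>) l c else 0)"
      using Suc.IH[OF _ \<gamma>0 c] Suc.prems(1) wl by simp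
  qed
  finally have eq: "monodromy p \<eta> N n u (Suc m) z P (l, \<alpha>) (k, \<beta>) = \<dots>" .
  show ?case
  proof (cases "\<forall>j\<in>{Suc (Suc m)..n}. \<alpha> j = \<beta> j")
    case True
    show ?thesis
      unfolding eq if_P[OF True] word_list_Suc
      using tmat_snoc[OF assms(4) Suc.prems(3), of "word_list m \<alpha>" "word_list m u" "word_list m \<beta>"] by simp
  next
    case False
    show ?thesis unfolding eq if_not_P[OF False] by simp
  qed
qed

lemma Top_tmat:
  assumes "\<alpha> \<in> words N n" "\<beta> \<in> words N n" "l \<in> {1..N}" "k \<in> {1..N}"
  shows "Top p \<eta> N n u k l z P \<alpha> \<beta> = tmat N z (word_list n u) P (word_list n \<alpha>) (word_list n \<beta>) l k"
  using monodromy_tmat[OF order_refl assms] by (simp add: Top_def)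

definition represents :: "nat \<Rightarrow> nat \<Rightarrow> (nat list \<Rightarrow> (nat \<Rightarrow> complex) \<Rightarrow> complex) \<Rightarrow> vec \<Rightarrow> bool" where
  "represents N n X x \<longleftrightarrow> (\<forall>\<beta>\<in>words N n. \<forall>P. x \<beta> P = X (word_list n \<beta>) P)"

lemma represents_Lop:
  assumes "represents N n X x" "l \<in> {1..N}" "k \<in> {1..N}"
  shows "represents N n (lop N (word_list n u) k l z X) (Lop p \<eta> N n u k l z x)"
  unfolding represents_def
proof (intro ballI allI)
  fix \<beta> P assume \<beta>: "\<beta> \<in> words N n"
  have "Lop p \<eta> N n u k l z x \<beta> P = (\<Sum>\<alpha>\<in>words N n. X (word_list n \<alpha>) (dshift l P) *
      tmat N z (word_list n u) P (word_list n \<alpha>) (word_list n \<beta>) l k)"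
    unfolding Lop_def using assms \<beta> by (intro sum.cong refl) (simp add: represents_def Top_tmat)
  also have "\<dots> = lop N (word_list n u) k l z X (word_list n \<beta>) P"
    unfolding lop_def length_word_list by (rule sum.reindex_bij_betw[OF bij_betw_word_list])
  finally show "Lop p \<eta> N n u k l z x \<beta> P = lop N (word_list n u) k l z X (word_list n \<beta>) P" .
qed

lemma represents_fold_Lop:
  assumes "represents N n X x" "l \<in> {1..N}" "k \<in> {1..N}"
  shows "represents N n (fold (lop N (word_list n u) k l) (map u ss) X) (fold (\<lambda>s. Lop p \<eta> N n u k l (u s)) ss x)"
  using assms(1)
proof (induction ss arbitrary: x X)
  case (Cons s ss)
  show ?case using Cons.IH[OF represents_Lop[OF Cons.prems assms(2,3)]] by simp
qed simp

lemma represents_bvec_ones: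
  "represents N n (\<lambda>\<beta> P. of_bool (\<beta> = replicate n 1)) (bvec (ones n))"
  unfolding represents_def
proof (intro ballI allI)
  fix \<beta> P assume "\<beta> \<in> words N n"
  then have "ones n = \<beta> \<longleftrightarrow> (\<forall>i\<in>{1..n}. \<beta> i = 1)"
    by (auto simp: ones_def words_def PiE_def intro!: extensionalityI[of _ "{1..n}"])
  moreover have "word_list n \<beta> = replicate n 1 \<longleftrightarrow> (\<forall>i\<in>{1..n}. \<beta> i = 1)"
  proof -
    have eq: "replicate n 1 = map (\<lambda>_. 1) [1..<Suc n]"
      by (simp add: map_replicate_const del: upt_Suc)
    show ?thesis unfolding word_list_def eq map_eq_conv
      by (simp add: atLeastLessThanSuc_atLeastAtMost del: upt_Suc)
  qed
  ultimately show "bvec (ones n) \<beta> P = of_bool (word_list n \<beta> = replicate n 1)"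
    by (simp add: bvec_def)
qed

definition row_lists :: "nat \<Rightarrow> (nat \<Rightarrow> complex) \<Rightarrow> (nat \<Rightarrow> nat set) \<Rightarrow> nat \<Rightarrow> complex list" where
  "row_lists N u I k = map u (sorted_list_of_set (upper N I (k + 1)))"

lemma represents_xi_tilde:
  assumes "N \<ge> 1"
  shows "represents N n (xst N (word_list n u) (row_lists N u I) (N - 1)) (xi_tilde p \<eta> N n u I)"
proof -
  have "represents N n (xst N (word_list n u) (row_lists N u I) m)
      (fold (\<lambda>k. Lset p \<eta> N n u k (k + 1) (upper N I (k + 1))) [1..<Suc m] (bvec (ones n)))" if "m < N" for m
    using that
  proof (induction m)
    case 0
    then show ?case using represents_bvec_ones by simp
  next
    case (Suc m)
    then have "represents N n (xst N (word_list n u) (row_lists N u I) m)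
      (fold (\<lambda>k. Lset p \<eta> N n u k (k + 1) (upper N I (k + 1))) [1..<Suc m] (bvec (ones n)))"
      by (simp del: upt_Suc)
    from represents_fold_Lop[OF this, of "Suc (Suc m)" "Suc m" u "sorted_list_of_set (upper N I (Suc (Suc m)))"]
    moreover have "[1..<Suc (Suc m)] = [1..<Suc m] @ [Suc m]" by simp
    moreover have "row_lists N u I (Suc m) = map u (sorted_list_of_set (upper N I (Suc (Suc m))))"
      by (simp add: row_lists_def)
    ultimately show ?case using Suc.prems by (simp add: Lset_def del: upt_Suc)
  qed
  from this[of "N - 1"] show ?thesis using assms by (simp add: xi_tilde_def)
qed

end

lemma zip_concat3:
  "zip (concat (map (\<lambda>k. replicate (length (A k)) (a k)) ks))
     (zip (concat (map (\<lambda>k. replicate (length (A k)) (b k)) ks)) (concat (map A ks))) =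
   concat (map (\<lambda>k. map (\<lambda>x. (a k, b k, x)) (A k)) ks)"
proof (induction ks)
  case (Cons k ks)
  have "zip (replicate (length xs) x) (zip (replicate (length xs) y) xs) = map (\<lambda>z. (x, y, z)) xs" for x y xs
    by (induction xs) auto
  then show ?case using Cons by (simp add: zip_append)
qed simp

lemma Zpart_xi_tilde:
  "Zpart p \<eta> N n (K_list N I) (L_list N I) (z_list N u I) u (ones n) = xi_tilde p \<eta> N n u I"
proof -
  define A where "A = (\<lambda>k. map u (sorted_list_of_set (upper N I (k + 1))))"
  have "zip (K_list N I) (zip (L_list N I) (z_list N u I)) =
      concat (map (\<lambda>k. map (\<lambda>x. (k, k + 1, x)) (A k)) [1..<N])"
    using zip_concat3[of A "\<lambda>k. k" "[1..<N]" "\<lambda>k. k + 1"]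
    by (simp add: K_list_def L_list_def z_list_def A_def)
  moreover have "fold F (concat (map (\<lambda>k. map (\<lambda>x. (k, k + 1, x)) (A k)) ks)) v =
      fold (\<lambda>k. fold (\<lambda>x. F (k, k + 1, x)) (A k)) ks v" for F :: "nat \<times> nat \<times> complex \<Rightarrow> vec \<Rightarrow> vec" and ks v
    by (induction ks arbitrary: v) (auto simp: fold_map o_def)
  ultimately show ?thesis
    by (intro ext) (simp add: Zpart_def xi_tilde_def Lset_def[abs_def] A_def fold_map o_def)
qed

subsection \<open>Weight functions as sums over orderings\<close>

lemma prod_filter_Suc:
  "(\<Prod>b | b < Suc n \<and> Q b. g b) = (if Q 0 then g 0 else 1) * (\<Prod>b | b < n \<and> Q (Suc b). g (Suc b))"
proof -
  have *: "(\<Prod>b | b < m \<and> R b. k b) = (\<Prod>b<m. if R b then k b else 1)" for m :: nat and R and k :: "nat \<Rightarrow> 'a"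
  proof -
    have "{b. b < m \<and> R b} = {b \<in> {..<m}. R b}" by auto
    then show ?thesis by (simp only: prod.inter_filter[OF finite_lessThan])
  qed
  show ?thesis unfolding * by (rule prod.lessThan_Suc_shift)
qed

lemma prod_filter_1_le:
  "(\<Prod>b | b \<in> {1..n} \<and> Q b. g b) = (\<Prod>b | b < n \<and> Q (Suc b). g (Suc b))"
  by (rule prod.reindex_bij_witness[of _ Suc "\<lambda>b. b - 1"]) auto

lemma prod_mset_nth: "(\<Prod>y\<in>#mset ys. g y) = (\<Prod>b<length ys. g (ys ! b))"
proof (induction ys)
  case (Cons y ys)
  then show ?case by (simp add: prod.lessThan_Suc_shift del: prod.lessThan_Suc)
qed simp

text \<open>For pairwise distinct variables, permutations and orderings correspond bijectively. This
  is where the distinctness of the site parameters is used for the symmetrization.\<close>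

lemma sum_permutes_map:
  fixes T :: "nat \<Rightarrow> 'a"
  assumes T: "inj_on T {1..k}"
  shows "(\<Sum>\<sigma> | \<sigma> permutes {1..k}. \<Phi> (map (T \<circ> \<sigma>) [1..<Suc k])) =
    (\<Sum>ts | mset ts = mset (map T [1..<Suc k]). \<Phi> ts)"
proof (rule sum.reindex_bij_betw, rule bij_betwI')
  have set: "set [1..<Suc k] = {1..k}" by auto
  show "map (T \<circ> \<sigma>) [1..<Suc k] = map (T \<circ> \<rho>) [1..<Suc k] \<longleftrightarrow> \<sigma> = \<rho>"
    if "\<sigma> \<in> {\<sigma>. \<sigma> permutes {1..k}}" "\<rho> \<in> {\<sigma>. \<sigma> permutes {1..k}}" for \<sigma> \<rho>
  proof
    assume eq: "map (T \<circ> \<sigma>) [1..<Suc k] = map (T \<circ> \<rho>) [1..<Suc k]"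
    show "\<sigma> = \<rho>"
    proof
      fix i
      show "\<sigma> i = \<rho> i"
      proof (cases "i \<in> {1..k}")
        case True
        then have "T (\<sigma> i) = T (\<rho> i)" using eq unfolding map_eq_conv set by simp
        moreover have "\<sigma> i \<in> {1..k}" "\<rho> i \<in> {1..k}"
          using permutes_in_image[of \<sigma> "{1..k}" i] permutes_in_image[of \<rho> "{1..k}" i] that True by simp_all
        ultimately show ?thesis using T by (auto dest: inj_onD)
      next
        case False
        then show ?thesis using that by (simp add: permutes_not_in)
      qed
    qed
  qed simp
  have ms: "mset (map g [1..<Suc k]) = image_mset g (mset_set {1..k})" for g :: "nat \<Rightarrow> 'a"
    by (simp add: atLeastLessThanSuc_atLeastAtMost del: upt_Suc)
  show "map (T \<circ> \<sigma>) [1..<Suc k] \<in> {ts. mset ts = mset (map T [1..<Suc k])}"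
    if "\<sigma> \<in> {\<sigma>. \<sigma> permutes {1..k}}" for \<sigma>
  proof -
    have \<sigma>: "\<sigma> permutes {1..k}" using that by simp
    have "image_mset (T \<circ> \<sigma>) (mset_set {1..k}) = image_mset T (image_mset \<sigma> (mset_set {1..k}))"
      by (simp add: multiset.map_comp)
    also have "image_mset \<sigma> (mset_set {1..k}) = mset_set (\<sigma> ` {1..k})"
      by (rule image_mset_mset_set) (rule permutes_inj_on[OF \<sigma>])
    finally show ?thesis unfolding mem_Collect_eq ms permutes_image[OF \<sigma>] .
  qed
  show "\<exists>\<sigma>\<in>{\<sigma>. \<sigma> permutes {1..k}}. ts = map (T \<circ> \<sigma>) [1..<Suc k]"
    if "ts \<in> {ts. mset ts = mset (map T [1..<Suc k])}" for ts
  proof -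
    have ts: "mset ts = mset (map T [1..<Suc k])" using that by simp
    have len: "length ts = k" using mset_eq_length[OF ts] by simp
    have sts: "set ts = T ` {1..k}" using mset_eq_setD[OF ts] set by (simp del: upt_Suc)
    have "distinct (map T [1..<Suc k])" using T set by (simp add: distinct_map del: upt_Suc)
    then have dts: "distinct ts" using mset_eq_imp_distinct_iff[OF ts] by simp
    define \<sigma> where "\<sigma> = (\<lambda>i. if i \<in> {1..k} then the_inv_into {1..k} T (ts ! (i - 1)) else i)"
    have nth: "ts ! (i - 1) \<in> T ` {1..k}" if "i \<in> {1..k}" for i
      using nth_mem[of "i - 1" ts] that len sts by auto
    have T\<sigma>: "T (\<sigma> i) = ts ! (i - 1)" if "i \<in> {1..k}" for i
      using that f_the_inv_into_f[OF T nth[OF that]] by (simp add: \<sigma>_def)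
    have "\<sigma> permutes {1..k}"
    proof (rule inj_imp_permutes)
      show "inj_on \<sigma> {1..k}"
      proof (rule inj_onI)
        fix i j assume ij: "i \<in> {1..k}" "j \<in> {1..k}" "\<sigma> i = \<sigma> j"
        then have "ts ! (i - 1) = ts ! (j - 1)" using T\<sigma>[of i] T\<sigma>[of j] by simp
        then have "i - 1 = j - 1" using dts ij len by (subst (asm) nth_eq_iff_index_eq) auto
        then show "i = j" using ij by auto
      qed
      show "\<sigma> i \<in> {1..k}" if "i \<in> {1..k}" for i
        using that the_inv_into_into[OF T nth[OF that] order_refl] by (simp add: \<sigma>_def)
    qed (auto simp: \<sigma>_def)
    moreover have "ts = map (T \<circ> \<sigma>) [1..<Suc k]"
      using T\<sigma> len by (intro nth_equalityI) (simp_all del: upt_Suc)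
    ultimately show ?thesis by blast
  qed
qed

text \<open>Symmetrizers of other levels commute with a sum over permutations of level m and with a
  factor that involves only levels m and m'.\<close>

lemma foldr_Sym_linear:
  assumes "m \<notin> set ls" "m' \<notin> set ls" "m \<noteq> m'"
  shows "foldr (\<lambda>l. Sym l (C l)) ls (\<lambda>t. \<Sum>\<sigma>\<in>A. F (t(m := t m \<circ> \<sigma>)) * c \<sigma> (t m') (t m)) t =
    (\<Sum>\<sigma>\<in>A. foldr (\<lambda>l. Sym l (C l)) ls F (t(m := t m \<circ> \<sigma>)) * c \<sigma> (t m') (t m))"
  using assms
proof (induction ls arbitrary: t)
  case (Cons a ls)
  have a: "a \<noteq> m" "a \<noteq> m'" using Cons.prems by auto
  have IH: "foldr (\<lambda>l. Sym l (C l)) ls (\<lambda>t. \<Sum>\<sigma>\<in>A. F (t(m := t m \<circ> \<sigma>)) * c \<sigma> (t m') (t m)) =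
      (\<lambda>t. \<Sum>\<sigma>\<in>A. foldr (\<lambda>l. Sym l (C l)) ls F (t(m := t m \<circ> \<sigma>)) * c \<sigma> (t m') (t m))"
    by (rule ext, rule Cons.IH) (use Cons.prems in auto)
  have "foldr (\<lambda>l. Sym l (C l)) (a # ls) (\<lambda>t. \<Sum>\<sigma>\<in>A. F (t(m := t m \<circ> \<sigma>)) * c \<sigma> (t m') (t m)) t =
      (\<Sum>\<rho> | \<rho> permutes {1..C a}. \<Sum>\<sigma>\<in>A. foldr (\<lambda>l. Sym l (C l)) ls F (t(a := t a \<circ> \<rho>, m := t m \<circ> \<sigma>)) * c \<sigma> (t m') (t m))"
    unfolding foldr.simps o_apply IH Sym_def[of a "C a"] using a by simp
  also have "\<dots> = (\<Sum>\<sigma>\<in>A. \<Sum>\<rho> | \<rho> permutes {1..C a}. foldr (\<lambda>l. Sym l (C l)) ls F (t(m := t m \<circ> \<sigma>, a := t a \<circ> \<rho>)) * c \<sigma> (t m') (t m))"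
    by (subst sum.swap) (simp add: fun_upd_twist[OF a(1)])
  also have "\<dots> = (\<Sum>\<sigma>\<in>A. foldr (\<lambda>l. Sym l (C l)) (a # ls) F (t(m := t m \<circ> \<sigma>)) * c \<sigma> (t m') (t m))"
    unfolding foldr.simps o_apply Sym_def[of a "C a"] using a by (simp add: sum_distrib_right)
  finally show ?case .
qed simp

context theta_like
begin

text \<open>The levels of \<open>wsum\<close> start at 0, those of U_J at 1. The extra level has no
  variables and contributes 1.\<close>

lemma lev_0: "0 \<notin> set w \<Longrightarrow> lev 0 w ys ts P = 1"
  by (induction w arbitrary: ys P) auto

lemma wsum_cong: "(\<And>k. k < l \<Longrightarrow> tt k = tt' k) \<Longrightarrow> wsum tt l w ys P = wsum tt' l w ys P"
  by (induction l arbitrary: w ys) simp_all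

text \<open>The iterated symmetrization has its highest level innermost, whereas \<open>wsum\<close>
  has it outermost; \<open>foldr_Sym_linear\<close> moves that sum to the outside.\<close>

lemma foldr_Sym_wsum:
  assumes "1 \<le> m" "\<And>l. l < m \<Longrightarrow> inj_on (t l) {1..C l}" "0 \<notin> set w" "C 0 = 0"
  shows "foldr (\<lambda>l. Sym l (C l)) [1..<m] (\<lambda>t. \<Prod>l\<in>{1..<m}.
      lev l (filter (\<lambda>c. c \<le> Suc l) w) (word_list (C (Suc l)) (t (Suc l))) (word_list (C l) (t l)) P) t =
    wsum (\<lambda>l. word_list (C l) (t l)) m (filter (\<lambda>c. c \<le> m) w) (word_list (C m) (t m)) P"
  using assms(1,2)
proof (induction m arbitrary: t rule: nat_induct_at_least)
  case base
  show ?case using assms(3,4) by (simp add: lev_0 word_list_def)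
next
  case (Suc m)
  define U where "U = (\<lambda>m t. \<Prod>l\<in>{1..<m}.
      lev l (filter (\<lambda>c. c \<le> Suc l) w) (word_list (C (Suc l)) (t (Suc l))) (word_list (C l) (t l)) P)"
  define w' where "w' = filter (\<lambda>c. c \<le> Suc m) w"
  have ww: "filter (\<lambda>c. c \<le> m) w' = filter (\<lambda>c. c \<le> m) w"
    by (auto simp: w'_def intro!: filter_cong)
  have U: "U (Suc m) t = U m t * lev m w' (word_list (C (Suc m)) (t (Suc m))) (word_list (C m) (t m)) P" for t
    using Suc.hyps by (simp add: U_def w'_def)
  have "foldr (\<lambda>l. Sym l (C l)) [1..<Suc m] (U (Suc m)) t =
      foldr (\<lambda>l. Sym l (C l)) [1..<m] (Sym m (C m) (U (Suc m))) t"
    using Suc.hyps by simp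
  also have "Sym m (C m) (U (Suc m)) = (\<lambda>t. \<Sum>\<sigma> | \<sigma> permutes {1..C m}. U m (t(m := t m \<circ> \<sigma>)) *
      lev m w' (word_list (C (Suc m)) (t (Suc m))) (word_list (C m) (t m \<circ> \<sigma>)) P)"
    unfolding Sym_def U by simp
  also have "foldr (\<lambda>l. Sym l (C l)) [1..<m] \<dots> t = (\<Sum>\<sigma> | \<sigma> permutes {1..C m}.
      foldr (\<lambda>l. Sym l (C l)) [1..<m] (U m) (t(m := t m \<circ> \<sigma>)) *
      lev m w' (word_list (C (Suc m)) (t (Suc m))) (word_list (C m) (t m \<circ> \<sigma>)) P)"
    by (rule foldr_Sym_linear[where m' = "Suc m" and c = "\<lambda>\<sigma> y s. lev m w' (word_list (C (Suc m)) y) (word_list (C m) (s \<circ> \<sigma>)) P"]) auto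
  also have "\<dots> = (\<Sum>\<sigma> | \<sigma> permutes {1..C m}.
      lev m w' (word_list (C (Suc m)) (t (Suc m))) (map (t m \<circ> \<sigma>) [1..<Suc (C m)]) P *
      wsum (\<lambda>l. word_list (C l) (t l)) m (filter (\<lambda>c. c \<le> m) w') (map (t m \<circ> \<sigma>) [1..<Suc (C m)]) P)"
  proof (rule sum.cong[OF refl])
    fix \<sigma>
    have "foldr (\<lambda>l. Sym l (C l)) [1..<m] (U m) (t(m := t m \<circ> \<sigma>)) =
        wsum (\<lambda>l. word_list (C l) ((t(m := t m \<circ> \<sigma>)) l)) m (filter (\<lambda>c. c \<le> m) w) (word_list (C m) (t m \<circ> \<sigma>)) P"
      unfolding U_def by (subst Suc.IH) (use Suc.prems in \<open>auto simp: less_Suc_eq\<close>)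
    also have "\<dots> = wsum (\<lambda>l. word_list (C l) (t l)) m (filter (\<lambda>c. c \<le> m) w) (word_list (C m) (t m \<circ> \<sigma>)) P"
      by (rule wsum_cong) simp
    finally show "foldr (\<lambda>l. Sym l (C l)) [1..<m] (U m) (t(m := t m \<circ> \<sigma>)) *
        lev m w' (word_list (C (Suc m)) (t (Suc m))) (word_list (C m) (t m \<circ> \<sigma>)) P =
      lev m w' (word_list (C (Suc m)) (t (Suc m))) (map (t m \<circ> \<sigma>) [1..<Suc (C m)]) P *
      wsum (\<lambda>l. word_list (C l) (t l)) m (filter (\<lambda>c. c \<le> m) w') (map (t m \<circ> \<sigma>) [1..<Suc (C m)]) P"
      by (simp only: ww word_list_def mult.commute)
  qed
  also have "\<dots> = wsum (\<lambda>l. word_list (C l) (t l)) (Suc m) w' (word_list (C (Suc m)) (t (Suc m))) P"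
    unfolding wsum.simps word_list_def[of "C m" "t m"]
    by (rule sum_permutes_map[where \<Phi> = "\<lambda>ts. lev m w' (word_list (C (Suc m)) (t (Suc m))) ts P *
        wsum (\<lambda>l. word_list (C l) (t l)) m (filter (\<lambda>c. c \<le> m) w') ts P"]) (rule Suc.prems, simp)
  finally show ?case by (simp only: U_def w'_def)
qed

text \<open>\<open>qs\<close> are the sites of level l + 1 and \<open>ss\<close> those of level l.
  Peeling off the first site moves its letter from the sum in \<open>x\<close> into the shift of
  \<open>P\<close>, which keeps the hypothesis on \<open>x\<close> invariant.\<close>

lemma lev_prod:
  fixes qs :: "nat list" and \<mu> :: "nat \<Rightarrow> nat"
  assumes "sorted_wrt (<) qs" "length ys = length qs" "ss = filter (\<lambda>i. \<mu> i \<le> l) qs" "length ts = length ss"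
    and "\<And>s. s \<in> set ss \<Longrightarrow> x s = h * (P (\<mu> s) - P (Suc l) +
      (\<Sum>q | q \<in> set qs \<and> q \<le> s. of_bool (\<mu> q = \<mu> s) - of_bool (\<mu> q = Suc l)))"
  shows "lev l (map \<mu> qs) ys ts P = (\<Prod>a<length ss.
      (\<Prod>b | b < length qs \<and> qs ! b = ss ! a. phi (x (ss ! a)) (ys ! b - ts ! a)) *
      (\<Prod>b | b < length qs \<and> ss ! a < qs ! b. psi (ys ! b - ts ! a)) *
      (\<Prod>a'\<in>{Suc a..<length ss}. kap (ts ! a - ts ! a')))"
  using assms
proof (induction qs arbitrary: ys ss ts P)
  case Nil
  then show ?case by simp
next
  case (Cons q qs)
  obtain y ys' where ys: "ys = y # ys'" using Cons.prems(2) by (metis length_Suc_conv)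
  define ss' where "ss' = filter (\<lambda>i. \<mu> i \<le> l) qs"
  have less: "q < s" if "s \<in> set qs" for s using Cons.prems(1) that by simp
  have less': "q < ss' ! a" if "a < length ss'" for a
    using less nth_mem[OF that] by (auto simp: ss'_def)
  have len: "length ys' = length qs" using Cons.prems(2) ys by simp
  have xs: "x s = h * (dshift (\<mu> q) P (\<mu> s) - dshift (\<mu> q) P (Suc l) +
      (\<Sum>q' | q' \<in> set qs \<and> q' \<le> s. of_bool (\<mu> q' = \<mu> s) - of_bool (\<mu> q' = Suc l)))" if "s \<in> set ss'" for s
  proof -
    have s: "s \<in> set qs" "s \<in> set ss" using that Cons.prems(3) by (auto simp: ss'_def)
    have "{q'. q' \<in> set (q # qs) \<and> q' \<le> s} = insert q {q'. q' \<in> set qs \<and> q' \<le> s}"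
      using less[OF s(1)] by auto
    moreover have "q \<notin> {q'. q' \<in> set qs \<and> q' \<le> s}" using less by auto
    ultimately show ?thesis
      using Cons.prems(5)[OF s(2)] by (auto simp: dshift_def algebra_simps)
  qed
  show ?case
  proof (cases "\<mu> q \<le> l")
    case True
    then have ss: "ss = q # ss'" using Cons.prems(3) by (simp add: ss'_def)
    obtain t ts' where ts: "ts = t # ts'" using Cons.prems(4) ss by (metis length_Suc_conv)
    have len': "length ts' = length ss'" using Cons.prems(4) ss ts by simp
    have "{q'. q' \<in> set (q # qs) \<and> q' \<le> q} = {q}" by (auto dest: less)
    then have xq: "h * dgap (dshift (\<mu> q) P) (\<mu> q) (Suc l) = x q"
      using Cons.prems(5)[of q] ss True by (simp add: dgap_dshift) (simp add: dgap_def algebra_simps)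
    have IH: "lev l (map \<mu> qs) ys' ts' (dshift (\<mu> q) P) = (\<Prod>a<length ss'.
      (\<Prod>b | b < length qs \<and> qs ! b = ss' ! a. phi (x (ss' ! a)) (ys' ! b - ts' ! a)) *
      (\<Prod>b | b < length qs \<and> ss' ! a < qs ! b. psi (ys' ! b - ts' ! a)) *
      (\<Prod>a'\<in>{Suc a..<length ss'}. kap (ts' ! a - ts' ! a')))"
      using Cons.prems(1) len ss'_def len' xs by (intro Cons.IH) auto
    have none: "(\<Prod>b | b < length qs \<and> qs ! b = q. g b) = 1" for g :: "nat \<Rightarrow> complex"
      by (rule prod.neutral) (use less in \<open>force dest: nth_mem\<close>)
    have all: "{b. b < length qs \<and> q < qs ! b} = {..<length qs}"
      using less nth_mem by auto
    have A1: "(\<Prod>b | b < length (q # qs) \<and> (q # qs) ! b = q. phi (x q) (ys ! b - t)) = phi (x q) (y - t)"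
      using none by (simp add: prod_filter_Suc ys)
    have A2: "(\<Prod>b | b < length (q # qs) \<and> q < (q # qs) ! b. psi (ys ! b - t)) = (\<Prod>y\<in>#mset ys'. psi (y - t))"
      by (simp add: prod_filter_Suc ys all prod_mset_nth[of _ ys'] len)
    have A3: "(\<Prod>a'\<in>{Suc 0..<length ss}. kap (t - ts ! a')) = (\<Prod>t'\<in>#mset ts'. kap (t - t'))"
      using prod.shift_bounds_Suc_ivl[of "\<lambda>a'. kap (t - ts ! a')" 0 "length ss'"]
      by (simp add: ss ts prod_mset_nth[of _ ts'] len' atLeast0LessThan)
    have B: "(\<Prod>b | b < length (q # qs) \<and> (q # qs) ! b = ss' ! a. phi (x (ss' ! a)) (ys ! b - ts' ! a)) *
        (\<Prod>b | b < length (q # qs) \<and> ss' ! a < (q # qs) ! b. psi (ys ! b - ts' ! a)) *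
        (\<Prod>a'\<in>{Suc (Suc a)..<length ss}. kap (ts' ! a - ts ! a')) =
      (\<Prod>b | b < length qs \<and> qs ! b = ss' ! a. phi (x (ss' ! a)) (ys' ! b - ts' ! a)) *
      (\<Prod>b | b < length qs \<and> ss' ! a < qs ! b. psi (ys' ! b - ts' ! a)) *
      (\<Prod>a'\<in>{Suc a..<length ss'}. kap (ts' ! a - ts' ! a'))" if "a < length ss'" for a
      using less'[OF that] prod.shift_bounds_Suc_ivl[of "\<lambda>a'. kap (ts' ! a - ts ! a')" "Suc a" "length ss'"]
      by (simp add: prod_filter_Suc ys ss ts)
    have split: "(\<Prod>a<length ss. g a) = g 0 * (\<Prod>a<length ss'. g (Suc a))" for g :: "nat \<Rightarrow> complex"
      by (simp add: ss prod.lessThan_Suc_shift del: prod.lessThan_Suc)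
    have lev: "lev l (map \<mu> (q # qs)) ys ts P = phi (x q) (y - t) * (\<Prod>y\<in>#mset ys'. psi (y - t)) *
        (\<Prod>t'\<in>#mset ts'. kap (t - t')) * lev l (map \<mu> qs) ys' ts' (dshift (\<mu> q) P)"
      using True by (simp add: ys ts xq del: dgap_dshift_cases)
    show ?thesis
      unfolding split lev IH unfolding ss ts nth_Cons_0 nth_Cons_Suc A1 A2 A3[unfolded ss ts]
      by (intro arg_cong2[where f = "(*)"] prod.cong refl B[unfolded ss ts, symmetric]) simp
  next
    case False
    then have ss: "ss = ss'" using Cons.prems(3) by (simp add: ss'_def)
    have IH: "lev l (map \<mu> qs) ys' ts (dshift (\<mu> q) P) = (\<Prod>a<length ss'.
      (\<Prod>b | b < length qs \<and> qs ! b = ss' ! a. phi (x (ss' ! a)) (ys' ! b - ts ! a)) *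
      (\<Prod>b | b < length qs \<and> ss' ! a < qs ! b. psi (ys' ! b - ts ! a)) *
      (\<Prod>a'\<in>{Suc a..<length ss'}. kap (ts ! a - ts ! a')))"
      using Cons.prems(1,4) len ss'_def ss xs by (intro Cons.IH) auto
    have lev: "lev l (map \<mu> (q # qs)) ys ts P = lev l (map \<mu> qs) ys' ts (dshift (\<mu> q) P)"
      using False by (simp add: ys)
    have C: "(\<Prod>b | b < length (q # qs) \<and> (q # qs) ! b = ss' ! a. phi (x (ss' ! a)) (ys ! b - ts ! a)) =
        (\<Prod>b | b < length qs \<and> qs ! b = ss' ! a. phi (x (ss' ! a)) (ys' ! b - ts ! a))"
      "(\<Prod>b | b < length (q # qs) \<and> ss' ! a < (q # qs) ! b. psi (ys ! b - ts ! a)) =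
        (\<Prod>b | b < length qs \<and> ss' ! a < qs ! b. psi (ys' ! b - ts ! a))" if "a < length ss'" for a
      using less'[OF that] by (simp_all add: prod_filter_Suc ys)
    show ?thesis
      unfolding ss lev IH using C by (intro prod.cong refl) simp
  qed
qed

end

subsection \<open>The theorem\<close>

lemma sorted_list_of_set_filter_upt: "sorted_list_of_set {i \<in> {1..n}. R i} = filter R [1..<Suc n]"
proof -
  have "set (filter R [1..<Suc n]) = {i \<in> {1..n}. R i}" by auto
  then show ?thesis
    using sorted_list_of_set.idem_if_sorted_distinct[of "filter R [1..<Suc n]"]
    by (simp add: sorted_wrt_filter del: upt_Suc)
qed

lemma lower_Jpart:
  assumes "\<mu> \<in> words N n" "l \<le> N"
  shows "lower (Jpart N n \<mu>) l = {i \<in> {1..n}. \<mu> i \<le> l}"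
  using assms by (auto simp: lower_def Jpart_def words_def)

lemma filter_word_list: "filter R (word_list n \<mu>) = map \<mu> (filter (R \<circ> \<mu>) [1..<Suc n])"
  by (simp add: word_list_def filter_map)

lemma card_lower_Jpart:
  assumes "\<mu> \<in> words N n" "l \<le> N"
  shows "card (lower (Jpart N n \<mu>) l) = length (filter (\<lambda>c. c \<le> l) (word_list n \<mu>))"
  unfolding lower_Jpart[OF assms] filter_word_list length_map o_def
    sorted_list_of_set_filter_upt[symmetric] by simp

lemma word_list_nth [simp]: "b < n \<Longrightarrow> word_list n \<mu> ! b = \<mu> (Suc b)"
  by (simp add: word_list_def del: upt_Suc)

context theta_model
begin

lemma Ufun_lev:
  assumes \<mu>: "\<mu> \<in> words N n"
  defines "C \<equiv> \<lambda>l. card (lower (Jpart N n \<mu>) l)"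
  shows "Ufun p \<eta> N n \<mu> (dshifts {1..n} \<mu> P) t = (\<Prod>l\<in>{1..<N}.
    lev l (filter (\<lambda>c. c \<le> Suc l) (word_list n \<mu>)) (word_list (C (Suc l)) (t (Suc l))) (word_list (C l) (t l)) P)"
  unfolding Ufun_def Let_def
proof (rule prod.cong[OF refl])
  fix l assume l: "l \<in> {1..<N}"
  define pos where "pos = (\<lambda>l. filter (\<lambda>i. \<mu> i \<le> l) [1..<Suc n])"
  define S where "S = lower (Jpart N n \<mu>)"
  define P' where "P' = dshifts {1..n} \<mu> P"
  define x where "x = (\<lambda>s. log_Pi \<eta> P' (\<mu> s) (l + 1) - 2 * \<eta> * Cnum n \<mu> (l + 1) s)"
  have sl: "sorted_list_of_set (S k) = pos k" if "k \<le> N" for k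
    unfolding S_def lower_Jpart[OF \<mu> that] pos_def by (rule sorted_list_of_set_filter_upt)
  have C: "C k = length (pos k)" if "k \<le> N" for k
    using card_lower_Jpart[OF \<mu> that] by (simp add: C_def pos_def filter_word_list o_def del: upt_Suc)
  have nth: "nth_elem (S k) a = pos k ! (a - 1)" if "k \<le> N" for k a
    by (simp add: nth_elem_def sl[OF that])
  have lN: "l \<le> N" "Suc l \<le> N" using l by auto
  have set_pos: "set (pos k) = {i \<in> {1..n}. \<mu> i \<le> k}" for k by (auto simp: pos_def)
  have P': "P' c = P c + (\<Sum>j\<in>{1..n}. of_bool (\<mu> j = c))" for c
    unfolding P'_def dshifts_def by (simp add: eq_commute[of c])
  have "lev l (map \<mu> (pos (Suc l))) (word_list (C (Suc l)) (t (Suc l))) (word_list (C l) (t l)) P =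
    (\<Prod>a<length (pos l).
      (\<Prod>b | b < length (pos (Suc l)) \<and> pos (Suc l) ! b = pos l ! a.
         phi (x (pos l ! a)) (word_list (C (Suc l)) (t (Suc l)) ! b - word_list (C l) (t l) ! a)) *
      (\<Prod>b | b < length (pos (Suc l)) \<and> pos l ! a < pos (Suc l) ! b.
         psi (word_list (C (Suc l)) (t (Suc l)) ! b - word_list (C l) (t l) ! a)) *
      (\<Prod>a'\<in>{Suc a..<length (pos l)}. kap (word_list (C l) (t l) ! a - word_list (C l) (t l) ! a')))"
  proof (rule lev_prod)
    show "sorted_wrt (<) (pos (Suc l))" unfolding pos_def by (intro sorted_wrt_filter) (simp del: upt_Suc)
    show "pos l = filter (\<lambda>i. \<mu> i \<le> l) (pos (Suc l))"
      by (auto simp: pos_def intro!: filter_cong simp del: upt_Suc)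
    fix s assume "s \<in> set (pos l)"
    then have s: "s \<in> {1..n}" "\<mu> s \<le> l" by (auto simp: set_pos)
    have split: "(\<Sum>j\<in>{1..n}. g j) = (\<Sum>j\<in>{1..s}. g j) + (\<Sum>j\<in>{s+1..n}. g j)" for g :: "nat \<Rightarrow> complex"
      using s(1) sum.ub_add_nat[of 1 s g "n - s"] by simp
    define g1 g2 :: "nat \<Rightarrow> complex" where "g1 = (\<lambda>j. of_bool (\<mu> j = \<mu> s))" and "g2 = (\<lambda>j. of_bool (\<mu> j = Suc l))"
    \<comment> \<open>Sites that are not on level l + 1 carry letters above \<open>Suc l\<close>,
      for which both indicators vanish.\<close>
    have sum: "(\<Sum>q | q \<in> set (pos (Suc l)) \<and> q \<le> s. g1 q - g2 q) = (\<Sum>q\<in>{1..s}. g1 q - g2 q)"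
      using s by (intro sum.mono_neutral_left) (auto simp: set_pos g1_def g2_def)
    have "x s = 2 * \<eta> * (P (\<mu> s) + (\<Sum>j\<in>{1..n}. g1 j) - (P (Suc l) + (\<Sum>j\<in>{1..n}. g2 j)))
        - 2 * \<eta> * (\<Sum>j\<in>{s+1..n}. g1 j - g2 j)"
      by (simp only: x_def log_Pi_def P' Cnum_def g1_def g2_def Suc_eq_plus1)
    \<comment> \<open>The sums over the whole word minus those behind s leave the letters up to and
      including s.\<close>
    also have "\<dots> = 2 * \<eta> * (P (\<mu> s) - P (Suc l) + (\<Sum>q\<in>{1..s}. g1 q - g2 q))"
      unfolding split sum_subtractf by (simp only: algebra_simps)
    finally show "x s = 2 * \<eta> * (P (\<mu> s) - P (Suc l) +
        (\<Sum>q | q \<in> set (pos (Suc l)) \<and> q \<le> s. of_bool (\<mu> q = \<mu> s) - of_bool (\<mu> q = Suc l)))"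
      unfolding sum[symmetric] by (simp only: g1_def g2_def)
  qed (simp_all add: C lN)
  also have "\<dots> = (\<Prod>a\<in>{1..card (S l)}.
      (\<Prod>b | b \<in> {1..card (S (l + 1))} \<and> nth_elem (S (l + 1)) b = nth_elem (S l) a.
          theta p (x (nth_elem (S l) a) + t (l + 1) b - t l a) * theta p (2 * \<eta>)
            / (theta p (2 * \<eta> + t (l + 1) b - t l a) * theta p (x (nth_elem (S l) a)))) *
      (\<Prod>b | b \<in> {1..card (S (l + 1))} \<and> nth_elem (S (l + 1)) b > nth_elem (S l) a.
          theta p (t (l + 1) b - t l a) / theta p (2 * \<eta> + t (l + 1) b - t l a)) *
      (\<Prod>b\<in>{a+1..card (S l)}. theta p (- 2 * \<eta> + t l a - t l b) / theta p (t l a - t l b)))"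
  proof -
    have card: "card (S l) = length (pos l)" "card (S (l + 1)) = length (pos (Suc l))"
      using C lN by (simp_all add: C_def S_def)
    have CC: "C l = length (pos l)" "C (Suc l) = length (pos (Suc l))" using C lN by simp_all
    have kk: "(\<Prod>b\<in>{Suc a + 1..length (pos l)}. g b) = (\<Prod>b\<in>{Suc a..<length (pos l)}. g (Suc b))" for g :: "nat \<Rightarrow> complex" and a
      using prod.shift_bounds_Suc_ivl[of g "Suc a" "length (pos l)"]
      by (simp add: atLeastLessThanSuc_atLeastAtMost)
    have shift: "(\<Prod>a\<in>{1..k}. g a) = (\<Prod>a<k. g (Suc a))" for g :: "nat \<Rightarrow> complex" and k
      using prod.atLeast1_atMost_eq[of g k] by simp
    show ?thesis
      unfolding card shift prod_filter_1_le
    proof (rule prod.cong[OF refl], intro arg_cong2[where f = "(*)"])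
      fix a assume "a \<in> {..<length (pos l)}"
      then have a: "a < length (pos l)" by simp
      have na: "nth_elem (S l) (Suc a) = pos l ! a" using nth[OF lN(1), of "Suc a"] by simp
      have nb: "nth_elem (S (l + 1)) (Suc b) = pos (Suc l) ! b" for b using nth[OF lN(2), of "Suc b"] by simp
      show "(\<Prod>b | b < length (pos (Suc l)) \<and> pos (Suc l) ! b = pos l ! a.
            phi (x (pos l ! a)) (word_list (C (Suc l)) (t (Suc l)) ! b - word_list (C l) (t l) ! a)) =
          (\<Prod>b | b < length (pos (Suc l)) \<and> nth_elem (S (l + 1)) (Suc b) = nth_elem (S l) (Suc a).
            theta p (x (nth_elem (S l) (Suc a)) + t (l + 1) (Suc b) - t l (Suc a)) * theta p (2 * \<eta>)
              / (theta p (2 * \<eta> + t (l + 1) (Suc b) - t l (Suc a)) * theta p (x (nth_elem (S l) (Suc a)))))"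
        unfolding na nb phi_def using a by (intro prod.cong) (simp_all add: CC add_diff_eq)
      show "(\<Prod>b | b < length (pos (Suc l)) \<and> pos l ! a < pos (Suc l) ! b.
            psi (word_list (C (Suc l)) (t (Suc l)) ! b - word_list (C l) (t l) ! a)) =
          (\<Prod>b | b < length (pos (Suc l)) \<and> nth_elem (S l) (Suc a) < nth_elem (S (l + 1)) (Suc b).
            theta p (t (l + 1) (Suc b) - t l (Suc a)) / theta p (2 * \<eta> + t (l + 1) (Suc b) - t l (Suc a)))"
        unfolding na nb psi_def using a by (intro prod.cong) (simp_all add: CC add_diff_eq)
      have neg: "- 2 * \<eta> + y - z = y - z - 2 * \<eta>" for y z by simp
      show "(\<Prod>a'\<in>{Suc a..<length (pos l)}. kap (word_list (C l) (t l) ! a - word_list (C l) (t l) ! a')) =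
          (\<Prod>b\<in>{Suc a + 1..length (pos l)}. theta p (- 2 * \<eta> + t l (Suc a) - t l b) / theta p (t l (Suc a) - t l b))"
        unfolding kk neg kap_def using a by (intro prod.cong) (simp_all add: CC)
    qed
  qed
  finally show "(\<Prod>a\<in>{1..card (lower (Jpart N n \<mu>) l)}.
        (\<Prod>b | b \<in> {1..card (lower (Jpart N n \<mu>) (l + 1))} \<and> nth_elem (lower (Jpart N n \<mu>) (l + 1)) b = nth_elem (lower (Jpart N n \<mu>) l) a.
              theta p (log_Pi \<eta> (dshifts {1..n} \<mu> P) (\<mu> (nth_elem (lower (Jpart N n \<mu>) l) a)) (l + 1) - 2 * \<eta> * Cnum n \<mu> (l + 1) (nth_elem (lower (Jpart N n \<mu>) l) a) + t (l + 1) b - t l a) * theta p (2 * \<eta>)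
                / (theta p (2 * \<eta> + t (l + 1) b - t l a) * theta p (log_Pi \<eta> (dshifts {1..n} \<mu> P) (\<mu> (nth_elem (lower (Jpart N n \<mu>) l) a)) (l + 1) - 2 * \<eta> * Cnum n \<mu> (l + 1) (nth_elem (lower (Jpart N n \<mu>) l) a))))
         * (\<Prod>b | b \<in> {1..card (lower (Jpart N n \<mu>) (l + 1))} \<and> nth_elem (lower (Jpart N n \<mu>) (l + 1)) b > nth_elem (lower (Jpart N n \<mu>) l) a.
              theta p (t (l + 1) b - t l a) / theta p (2 * \<eta> + t (l + 1) b - t l a))
         * (\<Prod>b\<in>{a+1..card (lower (Jpart N n \<mu>) l)}.
              theta p (- 2 * \<eta> + t l a - t l b) / theta p (t l a - t l b))) =
      lev l (filter (\<lambda>c. c \<le> Suc l) (word_list n \<mu>)) (word_list (C (Suc l)) (t (Suc l))) (word_list (C l) (t l)) P"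
    by (simp only: S_def x_def P'_def pos_def filter_word_list o_def)
qed

definition level_lists :: "(nat \<Rightarrow> complex) \<Rightarrow> (nat \<Rightarrow> nat set) \<Rightarrow> nat \<Rightarrow> complex list" where
  "level_lists u I l = map u (sorted_list_of_set (lower I l))"

text \<open>The specialization is built from I and the number of variables from \<mu>; the
  hypothesis on cardinalities says that both have the same content.\<close>

lemma Wfun_wsum:
  assumes \<mu>: "\<mu> \<in> words N n" and "N \<ge> 1" and u: "inj_on u {1..n}"
    and I: "\<And>l. l \<le> N \<Longrightarrow> lower I l \<subseteq> {1..n} \<and> card (lower I l) = length (filter (\<lambda>c. c \<le> l) (word_list n \<mu>))"
  shows "Wfun p \<eta> N n \<mu> (spec u I) u (dshifts {1..n} \<mu> P) = wsum (level_lists u I) N (word_list n \<mu>) (word_list n u) P"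
proof -
  define C where "C = (\<lambda>l. card (lower (Jpart N n \<mu>) l))"
  define t where "t = (spec u I)(N := u)"
  have C: "C l = card (lower I l)" if "l \<le> N" for l
    using I[OF that] card_lower_Jpart[OF \<mu> that] by (simp add: C_def)
  have w: "set (word_list n \<mu>) \<subseteq> {1..N}" using bij_betw_word_list[of n N] \<mu> by (auto simp: bij_betw_def lwords_def)
  then have wN: "filter (\<lambda>c. c \<le> N) (word_list n \<mu>) = word_list n \<mu>" by (auto simp: filter_id_conv)
  then have CN: "C N = n" using card_lower_Jpart[OF \<mu> order_refl] by (simp add: C_def)
  have tl: "word_list (C l) (t l) = level_lists u I l" if "l < N" for l
    using that C[of l] unfolding word_list_def level_lists_def
    by (intro nth_equalityI) (simp_all add: t_def spec_def nth_elem_def del: upt_Suc)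
  have inj: "inj_on (t l) {1..C l}" if "l < N" for l
  proof (rule inj_onI)
    fix a b assume ab: "a \<in> {1..C l}" "b \<in> {1..C l}" "t l a = t l b"
    let ?L = "sorted_list_of_set (lower I l)"
    have fin: "finite (lower I l)" using I[of l] that finite_subset by auto
    have lt: "a - 1 < length ?L" "b - 1 < length ?L" using ab C[of l] that by auto
    have "?L ! (a - 1) \<in> {1..n}" "?L ! (b - 1) \<in> {1..n}"
      using nth_mem[OF lt(1)] nth_mem[OF lt(2)] fin I[of l] that by auto
    moreover have "u (?L ! (a - 1)) = u (?L ! (b - 1))" using ab(3) that by (simp add: t_def spec_def nth_elem_def)
    ultimately have "?L ! (a - 1) = ?L ! (b - 1)" using u by (auto dest: inj_onD)
    then have "a - 1 = b - 1" using lt nth_eq_iff_index_eq[of ?L] by simp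
    then show "a = b" using ab by auto
  qed
  have "Wfun p \<eta> N n \<mu> (spec u I) u (dshifts {1..n} \<mu> P) =
      foldr (\<lambda>l. Sym l (C l)) [1..<N] (\<lambda>t. \<Prod>l\<in>{1..<N}.
        lev l (filter (\<lambda>c. c \<le> Suc l) (word_list n \<mu>)) (word_list (C (Suc l)) (t (Suc l))) (word_list (C l) (t l)) P) t"
    unfolding Wfun_def Ufun_lev[OF \<mu>, abs_def] C_def t_def ..
  also have "\<dots> = wsum (\<lambda>l. word_list (C l) (t l)) N (word_list n \<mu>) (word_list n u) P"
  proof -
    have zero: "0 \<notin> set (word_list n \<mu>)" using w by force
    have "C 0 = 0" "t N = u" using C[of 0] by (simp_all add: lower_def t_def)
    then show ?thesis
      using foldr_Sym_wsum[of N t C "word_list n \<mu>" P, OF assms(2) inj zero] by (simp only: wN CN)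
  qed
  also have "\<dots> = wsum (level_lists u I) N (word_list n \<mu>) (word_list n u) P"
    by (rule wsum_cong) (rule tl)
  finally show ?thesis .
qed

end

section \<open>Ordered partitions and the reference order they define\<close>

lemma opartitionsD:
  assumes "I \<in> opartitions N n lam"
  shows "l \<in> {1..N} \<Longrightarrow> I l \<subseteq> {1..n}" "l \<in> {1..N} \<Longrightarrow> card (I l) = lam l" "lower I N = {1..n}"
    "disjoint_family_on I {1..N}"
proof -
  show "l \<in> {1..N} \<Longrightarrow> I l \<subseteq> {1..n}"
    using assms by (auto simp: opartitions_def dest!: PiE_mem)
qed (use assms in \<open>auto simp: opartitions_def lower_def\<close>)

lemma lower_subset:
  assumes "I \<in> opartitions N n lam" "k \<le> N"
  shows "lower I k \<subseteq> {1..n}" "finite (lower I k)"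
proof -
  show "lower I k \<subseteq> {1..n}"
    using opartitionsD(1)[OF assms(1)] assms(2) unfolding lower_def by (intro UN_least) auto
  then show "finite (lower I k)" using finite_subset by blast
qed

lemma lower_Suc: "lower I (Suc k) = lower I k \<union> I (Suc k)"
  by (simp add: lower_def atLeastAtMostSuc_conv Un_commute)

lemma lower_disjoint:
  assumes "I \<in> opartitions N n lam" "Suc k \<le> N"
  shows "lower I k \<inter> I (Suc k) = {}"
proof -
  have "I j \<inter> I (Suc k) = {}" if "j \<in> {1..k}" for j
    using opartitionsD(4)[OF assms(1)] assms(2) that by (intro disjoint_family_onD[of I "{1..N}"]) auto
  then show ?thesis unfolding lower_def by blast
qed

lemma card_lower:
  assumes I: "I \<in> opartitions N n lam" and "k \<le> N"
  shows "card (lower I k) = (\<Sum>l\<in>{1..k}. lam l)"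
  using assms(2)
proof (induction k)
  case 0
  show ?case by (simp add: lower_def)
next
  case (Suc k)
  have "finite (I (Suc k))" using opartitionsD(1)[OF I, of "Suc k"] Suc.prems finite_subset by auto
  then have "card (lower I (Suc k)) = card (lower I k) + card (I (Suc k))"
    unfolding lower_Suc using lower_disjoint[OF I Suc.prems] lower_subset(2)[OF I, of k] Suc.prems
    by (intro card_Un_disjoint) auto
  then show ?case using Suc opartitionsD(2)[OF I, of "Suc k"] by simp
qed

lemma upper_lower:
  assumes I: "I \<in> opartitions N n lam" and "k < N"
  shows "upper N I (Suc k) = {1..n} - lower I k"
proof -
  have "{1..N} = {1..k} \<union> {Suc k..N}" using assms(2) by auto
  then have "lower I N = lower I k \<union> upper N I (Suc k)"
    by (simp only: lower_def upper_def UN_Un)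
  moreover have "I i \<inter> I j = {}" if "i \<in> {1..k}" "j \<in> {Suc k..N}" for i j
    using opartitionsD(4)[OF I] assms(2) that by (intro disjoint_family_onD[of I "{1..N}"]) auto
  then have "lower I k \<inter> upper N I (Suc k) = {}" unfolding lower_def upper_def by blast
  ultimately show ?thesis using opartitionsD(3)[OF I] by blast
qed

text \<open>Translates the content condition into the cumulative counts used for words; individual
  block sizes are recovered as differences.\<close>

lemma Jpart_opartitions_iff:
  assumes \<mu>: "\<mu> \<in> words N n"
  shows "Jpart N n \<mu> \<in> opartitions N n lam \<longleftrightarrow>
    (\<forall>k\<le>N. length (filter (\<lambda>c. c \<le> k) (word_list n \<mu>)) = (\<Sum>l\<in>{1..k}. lam l))"
proof
  assume "Jpart N n \<mu> \<in> opartitions N n lam"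
  then show "\<forall>k\<le>N. length (filter (\<lambda>c. c \<le> k) (word_list n \<mu>)) = (\<Sum>l\<in>{1..k}. lam l)"
    using card_lower card_lower_Jpart[OF \<mu>] by metis
next
  assume *: "\<forall>k\<le>N. length (filter (\<lambda>c. c \<le> k) (word_list n \<mu>)) = (\<Sum>l\<in>{1..k}. lam l)"
  have low: "card {i \<in> {1..n}. \<mu> i \<le> k} = (\<Sum>l\<in>{1..k}. lam l)" if "k \<le> N" for k
    using * card_lower_Jpart[OF \<mu> that] lower_Jpart[OF \<mu> that] that by simp
  have "card {i \<in> {1..n}. \<mu> i = l} = lam l" if l: "l \<in> {1..N}" for l
  proof -
    obtain k where k: "l = Suc k" using l by (cases l) auto
    have "{i \<in> {1..n}. \<mu> i \<le> Suc k} = {i \<in> {1..n}. \<mu> i \<le> k} \<union> {i \<in> {1..n}. \<mu> i = Suc k}" by auto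
    then have "card {i \<in> {1..n}. \<mu> i \<le> Suc k} = card {i \<in> {1..n}. \<mu> i \<le> k} + card {i \<in> {1..n}. \<mu> i = Suc k}"
      by (simp only:) (rule card_Un_disjoint, auto)
    then show ?thesis using low[of k] low[of "Suc k"] l k by simp
  qed
  moreover have "disjoint_family_on (Jpart N n \<mu>) {1..N}"
    by (auto simp: disjoint_family_on_def Jpart_def)
  moreover have "(\<Union>l\<in>{1..N}. Jpart N n \<mu> l) = {1..n}"
    using \<mu> by (auto simp: Jpart_def words_def dest: PiE_mem)
  ultimately show "Jpart N n \<mu> \<in> opartitions N n lam"
    by (auto simp: opartitions_def Jpart_def)
qed

text \<open>The reference order for I: with k = N, the parameters of the last block come first and
  those of the first block last.\<close>

primrec blocks :: "(nat \<Rightarrow> 'a) \<Rightarrow> (nat \<Rightarrow> nat set) \<Rightarrow> nat \<Rightarrow> 'a list" where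
  "blocks u I 0 = []"
| "blocks u I (Suc k) = map u (sorted_list_of_set (I (Suc k))) @ blocks u I k"

lemma mset_sorted_list_of_set: "finite S \<Longrightarrow> mset (sorted_list_of_set S) = mset_set S"
  by (metis distinct_sorted_list_of_set mset_set_set set_sorted_list_of_set)

lemma mset_blocks:
  assumes I: "I \<in> opartitions N n lam" and "k \<le> N"
  shows "mset (blocks u I k) = image_mset u (mset_set (lower I k))"
  using assms(2)
proof (induction k)
  case 0
  show ?case by (simp add: lower_def)
next
  case (Suc k)
  have "finite (I (Suc k))" using opartitionsD(1)[OF I, of "Suc k"] Suc.prems finite_subset by auto
  moreover from this have "mset_set (lower I (Suc k)) = mset_set (lower I k) + mset_set (I (Suc k))"
    unfolding lower_Suc using lower_disjoint[OF I Suc.prems] lower_subset(2)[OF I, of k] Suc.prems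
    by (intro mset_set_Union) auto
  ultimately show ?case using Suc by (simp add: mset_sorted_list_of_set)
qed

lemma blocks_suffix: "k \<le> m \<Longrightarrow> \<exists>T. blocks u I m = T @ blocks u I k"
proof (induction m)
  case (Suc m)
  then show ?case
  proof (cases "k = Suc m")
    case False
    then obtain T where "blocks u I m = T @ blocks u I k" using Suc by auto
    then show ?thesis by (intro exI[of _ "map u (sorted_list_of_set (I (Suc m))) @ T"]) simp
  qed simp
qed simp

text \<open>A suffix of the reference order gives the variables of level k, the complementary prefix
  the parameters of the rows in block k; both agree with the prescribed lists only up to
  order.\<close>

lemma blocks_split:
  assumes I: "I \<in> opartitions N n lam" and "k < N"
  shows "mset (drop (n - card (lower I k)) (blocks u I N)) = mset (map u (sorted_list_of_set (lower I k)))"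
    and "mset (take (n - card (lower I k)) (blocks u I N)) = mset (map u (sorted_list_of_set (upper N I (Suc k))))"
proof -
  obtain T where T: "blocks u I N = T @ blocks u I k" using blocks_suffix[of k N] assms(2) by auto
  have kN: "k \<le> N" using assms(2) by simp
  note mk = mset_blocks[OF I kN, of u] and mN = mset_blocks[OF I order_refl, of u]
  have lk: "length (blocks u I k) = card (lower I k)" using arg_cong[OF mk, of size] by simp
  have "length (blocks u I N) = n" using arg_cong[OF mN, of size] opartitionsD(3)[OF I] by simp
  then have lT: "length T = n - card (lower I k)" using T lk by simp
  show "mset (drop (n - card (lower I k)) (blocks u I N)) = mset (map u (sorted_list_of_set (lower I k)))"
    using mk lower_subset(2)[OF I kN] by (simp add: T mset_sorted_list_of_set flip: lT)
  have "mset_set {1..n} = mset_set (upper N I (Suc k)) + mset_set (lower I k)"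
    using mset_set_Union[of "{1..n} - lower I k" "lower I k"] lower_subset[OF I kN]
    unfolding upper_lower[OF assms] by (simp add: Un_absorb2 Diff_Int_distrib2)
  then have "mset T + mset (blocks u I k) = image_mset u (mset_set (upper N I (Suc k))) + mset (blocks u I k)"
    using mN mk opartitionsD(3)[OF I] by (simp add: T)
  then show "mset (take (n - card (lower I k)) (blocks u I N)) = mset (map u (sorted_list_of_set (upper N I (Suc k))))"
    by (simp add: T mset_sorted_list_of_set upper_lower[OF assms] flip: lT)
qed

text \<open>The zeros of \<theta> lie at the integral powers of p, and by genericity q^2 is not one
  of them.\<close>

lemma theta_model_generic:
  assumes "p \<noteq> 0" "norm p < 1" "generic_qp q p" "q \<noteq> 0" "exp \<eta> = q"
  shows "theta_model p \<eta>"
proof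
  show "theta p (- u) = - theta p u" for u by (rule theta_odd[OF assms(1,2)])
  show "theta p (x + z) * theta p (x - z) * theta p (y + w) * theta p (y - w)
     - theta p (x + w) * theta p (x - w) * theta p (y + z) * theta p (y - z)
     = theta p (z + w) * theta p (z - w) * theta p (x + y) * theta p (x - y)" for x y z w
    by (rule theta_three_term[OF assms(1,2)])
  show "theta p (2 * \<eta>) \<noteq> 0"
  proof
    assume "theta p (2 * \<eta>) = 0"
    then obtain b :: int where "exp (2 * \<eta>) = p powi b" using theta_eq_0D[OF assms(1,2)] by blast
    moreover have "exp (2 * \<eta>) = q powi (2 * 1)" using assms(5) by (simp add: exp_double)
    ultimately show False using assms(3) unfolding generic_qp_def by (metis one_neq_zero)
  qed
qed

theorem proposition6p5:
  fixes N n :: nat and q p :: complex and lg :: "complex \<Rightarrow> complex"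
    and lam :: "nat \<Rightarrow> nat" and I :: "nat \<Rightarrow> nat set"
  assumes "N \<ge> 1"
    and "q \<noteq> 0" and "norm q < 1" and "p \<noteq> 0" and "norm p < 1" and "generic_qp q p"
    and lg: "\<And>z. z \<noteq> 0 \<Longrightarrow> exp (lg z) = z"
    and "(\<Sum>l\<in>{1..N}. lam l) = n"
    and "I \<in> opartitions N n lam"
  shows "\<exists>Nscal :: complex list \<Rightarrow> complex. \<forall>w. generic_w q p n w \<longrightarrow>
    (let \<eta> = lg q; u = (\<lambda>i. lg (w i)); c = Nscal (map w [1..<n+1]) in
       vec_eq p \<eta> N n (xi_tilde p \<eta> N n u I)
                      (\<lambda>\<beta> P. c * xi_prime p \<eta> N n lam u I \<beta> P) \<and>
       (\<forall>\<mu>\<in>words N n. Jpart N n \<mu> \<in> opartitions N n lam \<longrightarrow>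
          dyn_eq p \<eta> N
            (Zpart p \<eta> N n (K_list N I) (L_list N I) (z_list N u I) u (ones n) \<mu>)
            (\<lambda>P. c * Wfun p \<eta> N n \<mu> (spec u I) u (dshifts {1..n} \<mu> P))))"
proof -
  define \<eta> where "\<eta> = lg q"
  have \<eta>: "exp \<eta> = q" using lg assms(2) by (simp add: \<eta>_def)
  interpret theta_model p \<eta>
    by (rule theta_model_generic[OF assms(4,5,6,2) \<eta>])
  note I = \<open>I \<in> opartitions N n lam\<close>
  note zero = theta_eq_0D[OF assms(4,5)]
  define \<Lambda> where "\<Lambda> = (\<lambda>k. \<Sum>l\<in>{1..k}. lam l)"
  have \<Lambda>: "mono \<Lambda>" "\<Lambda> 0 = 0" "\<Lambda> N = n"
    using assms(8) by (auto simp: \<Lambda>_def mono_iff_le_Suc)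
  have card: "card (lower I k) = \<Lambda> k" if "k \<le> N" for k
    using card_lower[OF I that] by (simp add: \<Lambda>_def)
  have generic: "generic N P" if "generic_dyn p \<eta> N P" for P
    unfolding generic_def
  proof (intro ballI allI impI notI)
    fix j k :: nat and m :: int
    assume jk: "j \<in> {1..N}" "k \<in> {1..N}" "j \<noteq> k"
      and "theta p (2 * \<eta> * of_int m + 2 * \<eta> * dgap P j k) = 0"
    then obtain b :: int where b: "exp (2 * \<eta> * of_int m + log_Pi \<eta> P j k) = p powi b"
      using zero by (auto simp: log_Pi_dgap)
    have "2 * \<eta> * of_int m = of_int (2 * m) * \<eta>" by simp
    then have "exp (2 * \<eta> * of_int m) = exp \<eta> powi (2 * m)" by (simp only: exp_power_int)
    then have "exp (log_Pi \<eta> P j k) = exp \<eta> powi (2 * (- m)) * p powi b"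
      using b by (simp add: exp_add power_int_minus field_simps)
    then show False using that jk unfolding generic_dyn_def by blast
  qed
  define Q where "Q = (\<lambda>u c. \<forall>P. generic N P \<longrightarrow> (\<forall>\<beta>\<in>lwords N n.
    xst N (word_list n u) (row_lists N u I) (N - 1) \<beta> P =
    c * (if \<forall>k\<le>N. length (filter (\<lambda>c. c \<le> k) \<beta>) = \<Lambda> k
         then wsum (level_lists u I) N \<beta> (word_list n u) P else 0)))"
  \<comment> \<open>The scalar has to be a function of the values w_1, ..., w_n alone, so it is
    chosen from the list, whose entry i - 1 is w_i; \<open>Q_cong\<close> passes between this list
    and \<open>u\<close>.\<close>
  define Nscal where "Nscal ws = (SOME c. Q (\<lambda>i. lg (ws ! (i - 1))) c)" for ws
  have Q_cong: "Q u c \<longleftrightarrow> Q u' c" if "\<And>i. i \<in> {1..n} \<Longrightarrow> u i = u' i" for u u' c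
  proof -
    have "word_list n u = word_list n u'" using that by (rule word_list_cong)
    moreover have sub: "map u (sorted_list_of_set S) = map u' (sorted_list_of_set S)" if "S \<subseteq> {1..n}" for S
    proof -
      have "finite S" using that finite_subset by blast
      then show ?thesis using that \<open>\<And>i. i \<in> {1..n} \<Longrightarrow> u i = u' i\<close> by auto
    qed
    have "xst N (word_list n u') (row_lists N u I) (N - 1) = xst N (word_list n u') (row_lists N u' I) (N - 1)"
    proof -
      have "xst N ys r k = xst N ys r' k" if "\<And>j. j \<in> {1..k} \<Longrightarrow> r j = r' j" for ys r r' k
        using that by (induction k) auto
      moreover have "row_lists N u I j = row_lists N u' I j" if "j \<in> {1..N - 1}" for j
        unfolding row_lists_def by (rule sub) (use upper_lower[OF I, of j] that in auto)
      ultimately show ?thesis by blast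
    qed
    moreover have "wsum (level_lists u I) N \<beta> ys P = wsum (level_lists u' I) N \<beta> ys P" for \<beta> ys P
      unfolding level_lists_def by (rule wsum_cong, rule sub, rule lower_subset(1)[OF I]) simp
    ultimately show ?thesis unfolding Q_def by simp
  qed
  have main: "let u = (\<lambda>i. lg (w i)); c = Nscal (map w [1..<n+1]) in
       vec_eq p \<eta> N n (xi_tilde p \<eta> N n u I)
                      (\<lambda>\<beta> P. c * xi_prime p \<eta> N n lam u I \<beta> P) \<and>
       (\<forall>\<mu>\<in>words N n. Jpart N n \<mu> \<in> opartitions N n lam \<longrightarrow>
          dyn_eq p \<eta> N
            (Zpart p \<eta> N n (K_list N I) (L_list N I) (z_list N u I) u (ones n) \<mu>)
            (\<lambda>P. c * Wfun p \<eta> N n \<mu> (spec u I) u (dshifts {1..n} \<mu> P)))"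
    if w: "generic_w q p n w" for w
  proof -
    define u where "u = (\<lambda>i. lg (w i))"
    define c where "c = Nscal (map w [1..<n+1])"
    have expu: "exp (u i) = w i" if "i \<in> {1..n}" for i
      using lg w that by (simp add: u_def generic_w_def)
    have nw: "w i / w j \<noteq> q powi (2 * a) * p powi b" if "i \<in> {1..n}" "j \<in> {1..n}" "i \<noteq> j" for i j and a b :: int
      using w that unfolding generic_w_def by blast
    have inj: "inj_on u {1..n}"
    proof (rule inj_onI, rule ccontr)
      fix i j assume ij: "i \<in> {1..n}" "j \<in> {1..n}" "u i = u j" "i \<noteq> j"
      then have "w i = w j" "w j \<noteq> 0" using expu[of i] expu[of j] exp_not_eq_zero[of "u j"] by simp_all
      then show False using nw[OF ij(1,2,4), of 0 0] by simp
    qed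
    define U where "U = u ` {1..n}"
    have U: "gen_set U"
      unfolding gen_set_def
    proof (intro ballI conjI impI)
      fix a b assume ab: "a \<in> U" "b \<in> U"
      then obtain i j where ij: "i \<in> {1..n}" "j \<in> {1..n}" "a = u i" "b = u j" by (auto simp: U_def)
      have e: "exp (a - b) = w i / w j" using ij expu by (simp add: exp_diff)
      show "theta p (2 * \<eta> + (a - b)) \<noteq> 0"
      proof
        assume "theta p (2 * \<eta> + (a - b)) = 0"
        then obtain m :: int where "exp (2 * \<eta> + (a - b)) = p powi m" using zero by blast
        then have m: "q\<^sup>2 * (w i / w j) = p powi m" using \<eta> by (simp only: exp_add exp_double e)
        \<comment> \<open>Coinciding sites are excluded by the genericity of q and p, different ones
          by that of w.\<close>
        show False
        proof (cases "i = j")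
          case True
          then have "q powi (2 * 1) = p powi m" using m ij expu[of j] exp_not_eq_zero[of "u j"] by simp
          then show False using assms(6) unfolding generic_qp_def by (metis one_neq_zero)
        next
          case False
          have "w i / w j = q powi (2 * (- 1)) * p powi m"
            using m assms(2) by (simp add: power_int_minus field_simps)
          then show False using nw[OF ij(1,2) False] by blast
        qed
      qed
      assume "a \<noteq> b"
      then have "i \<noteq> j" using ij by auto
      show "theta p (a - b) \<noteq> 0"
      proof
        assume "theta p (a - b) = 0"
        then obtain m :: int where "exp (a - b) = p powi m" using zero by blast
        then show False using nw[OF ij(1,2) \<open>i \<noteq> j\<close>, of 0 m] e by simp
      qed
    qed
    have "\<exists>c. Q u c"
      unfolding Q_def
    proof (rule xst_proportional_wsum[OF U \<Lambda> assms(1)])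
      have set: "set [1..<Suc n] = {1..n}" by auto
      show "set (word_list n u) \<subseteq> U" unfolding word_list_def set_map set U_def ..
      show "distinct (word_list n u)" unfolding word_list_def distinct_map set using inj by simp
      show "mset (blocks u I N) = mset (word_list n u)"
        using mset_blocks[OF I order_refl, of u] opartitionsD(3)[OF I]
        by (simp add: word_list_def atLeastLessThanSuc_atLeastAtMost del: upt_Suc)
      show "mset (level_lists u I k) = mset (drop (n - \<Lambda> k) (blocks u I N))" if "k < N" for k
        using blocks_split(1)[OF I that, of u] card[of k] that by (simp only: level_lists_def less_imp_le)
      show "mset (row_lists N u I k) = mset (take (n - \<Lambda> k) (blocks u I N))" if "k \<in> {1..<N}" for k
        using blocks_split(2)[OF I, of k u] card[of k] that by (simp add: row_lists_def del: mset_map)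
    qed simp
    then have "\<exists>c. Q (\<lambda>i. lg (map w [1..<n+1] ! (i - 1))) c"
      by (rule ex_forward) (subst (asm) Q_cong[of _ "\<lambda>i. lg (map w [1..<n+1] ! (i - 1))"],
        auto simp: u_def simp del: upt_Suc)
    then have "Q (\<lambda>i. lg (map w [1..<n+1] ! (i - 1))) c"
      unfolding c_def Nscal_def by (rule someI_ex)
    then have Qc: "Q u c"
      by (subst Q_cong[of _ "\<lambda>i. lg (map w [1..<n+1] ! (i - 1))"]) (auto simp: u_def simp del: upt_Suc)
    have Wf: "Wfun p \<eta> N n \<mu> (spec u I) u (dshifts {1..n} \<mu> P) = wsum (level_lists u I) N (word_list n \<mu>) (word_list n u) P"
      if "\<mu> \<in> words N n" "Jpart N n \<mu> \<in> opartitions N n lam" for \<mu> P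
      using that lower_subset(1)[OF I] card Jpart_opartitions_iff[OF that(1)]
      by (intro Wfun_wsum[OF that(1) assms(1) inj]) (auto simp: \<Lambda>_def)
    have xi: "xi_tilde p \<eta> N n u I \<beta> P = c * (if Jpart N n \<beta> \<in> opartitions N n lam
        then Wfun p \<eta> N n \<beta> (spec u I) u (dshifts {1..n} \<beta> P) else 0)"
      if "\<beta> \<in> words N n" "generic_dyn p \<eta> N P" for \<beta> P
    proof -
      have "word_list n \<beta> \<in> lwords N n" using bij_betw_word_list that(1) by (auto simp: bij_betw_def)
      moreover have "xi_tilde p \<eta> N n u I \<beta> P = xst N (word_list n u) (row_lists N u I) (N - 1) (word_list n \<beta>) P"
        using represents_xi_tilde[OF assms(1), of n u I] that(1) by (simp add: represents_def)
      ultimately have "xi_tilde p \<eta> N n u I \<beta> P = c * (if Jpart N n \<beta> \<in> opartitions N n lam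
          then wsum (level_lists u I) N (word_list n \<beta>) (word_list n u) P else 0)"
        using Qc generic[OF that(2)] unfolding Q_def \<Lambda>_def Jpart_opartitions_iff[OF that(1)] by simp
      then show ?thesis using Wf[OF that(1), of P] by (cases "Jpart N n \<beta> \<in> opartitions N n lam") (simp_all only: if_True if_False)
    qed
    have xi': "xi_prime p \<eta> N n lam u I \<beta> P = (if Jpart N n \<beta> \<in> opartitions N n lam
        then Wfun p \<eta> N n \<beta> (spec u I) u (dshifts {1..n} \<beta> P) else 0)"
      if "\<beta> \<in> words N n" for \<beta> P
    proof -
      let ?A = "{\<mu>. \<mu> \<in> words N n \<and> Jpart N n \<mu> \<in> opartitions N n lam}"
      have "finite ?A" by (rule finite_subset[OF _ finite_words[of N n]]) auto
      moreover have "xi_prime p \<eta> N n lam u I \<beta> P =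
          (\<Sum>\<mu>\<in>?A. if \<mu> = \<beta> then Wfun p \<eta> N n \<mu> (spec u I) u (dshifts {1..n} \<mu> P) else 0)"
        unfolding xi_prime_def bvec_def by (rule sum.cong[OF refl]) (simp only: of_bool_def if_distrib[of "\<lambda>x. _ * x"] mult_1_right mult_zero_right)
      ultimately show ?thesis using that by (simp only: sum.delta' sum.delta mem_Collect_eq simp_thms)
    qed
    have "vec_eq p \<eta> N n (xi_tilde p \<eta> N n u I) (\<lambda>\<beta> P. c * xi_prime p \<eta> N n lam u I \<beta> P)"
      unfolding vec_eq_def dyn_eq_def by (intro ballI allI impI) (simp only: xi xi')
    moreover have "dyn_eq p \<eta> N (Zpart p \<eta> N n (K_list N I) (L_list N I) (z_list N u I) u (ones n) \<mu>)
        (\<lambda>P. c * Wfun p \<eta> N n \<mu> (spec u I) u (dshifts {1..n} \<mu> P))"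
      if "\<mu> \<in> words N n" "Jpart N n \<mu> \<in> opartitions N n lam" for \<mu>
      unfolding dyn_eq_def Zpart_xi_tilde by (intro allI impI) (simp only: xi[OF that(1)] that(2) if_True)
    ultimately show ?thesis unfolding Let_def u_def c_def by (intro conjI ballI impI)
  qed
  show ?thesis
    unfolding Let_def \<eta>_def[symmetric] by (intro exI[of _ Nscal] allI impI) (rule main[unfolded Let_def])
qed

end
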